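(* Let $b=(b_1,\dots,b_d)\in\mathbb{R}_+^d$, let $I^+=\{j\in\{1,\dots,d\}:b_j>0\}$, and assume $\mathcal{J}\cap I^+\neq\emptyset$. For $y\in\mathbb{R}$ let $$V_{\geqslant}(y)=\Big\{\xi\in\prod_{i=1}^d\mathbb{D}^{(\gamma-\mathcal{Q}r)_i}_{\leqslant\infty}[0,T]:\ b^{\top}\phi(\xi)(T)\ge y\Big\},\qquad V^*_{\geqslant}(y)=\inf_{\xi\in V_{\geqslant}(y)}\tilde I^{(d)}(\xi).$$ Then the overflow probabilities of the scaled buffer content process $Z_n$ satisfy $$\lim_{n\to\infty}\frac{1}{L(n)n^{\alpha}}\log\mathbf{P}\big(b^{\top}Z_n(T)\ge y\big)=-V^*_{\geqslant}(y).$$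
   Context: **Path spaces.** Fix $T>0$, $d\ge1$. $\mathbb{D}[0,T]$ is the space of real-valued càdlàg functions on $[0,T]$; $e(t)=t$. $\mathbb{D}^{\uparrow}[0,T]$ is the set of non-decreasing $\xi\in\mathbb{D}[0,T]$ with $\xi(0)\ge0$. $\mathbb{D}^{\uparrow}_{\leqslant\infty}[0,T]$ is the set of non-decreasing pure jump functions in $\mathbb{D}[0,T]$ that are nonnegative at $0$, i.e. $\xi=\sum_{j\ge1}x^{(j)}\mathbf{1}_{[u^{(j)},T]}$ with $x^{(j)}\ge0$ and distinct $u^{(j)}\in[0,T]$. For $\beta\in\mathbb{R}$, $\mathbb{D}^{\beta}_{\leqslant\infty}[0,T]=\{\xi+\beta e:\xi\in\mathbb{D}^{\uparrow}_{\leqslant\infty}[0,T]\}$. **Reflection map.** $Q=[q_{ij}]$ is a $d\times d$ substochastic matrix ($q_{ij}\ge0$, row sums at most $1$) with $q_{ii}=0$ and $Q^n\to0$ as $n\to\infty$; $\mathcal{Q}=\mathrm{I}-Q^{\top}$. Vector and path inequalities are componentwise (and pointwise in $t$). For $\xi\in\prod_{i=1}^d\mathbb{D}[0,T]$ let $\Psi(\xi)=\{\zeta\in\prod_{i=1}^d\mathbb{D}^{\uparrow}[0,T]:\xi+\mathcal{Q}\zeta\ge0\}$. The regulator is $\psi(\xi)=\inf\Psi(\xi)$, i.e. $\psi_i(\xi)(t)=\inf\{\omega_i(t):\omega\in\Psi(\xi)\}$ (it is known that $\Psi(\xi)\neq\emptyset$ and $\psi(\xi)\in\Psi(\xi)$),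 and the content map is $\phi(\xi)=\xi+\mathcal{Q}\psi(\xi)$. **Model.** $\mathcal{J}\subseteq\{1,\dots,d\}$ is the set of nodes with exogenous input. For $i\in\mathcal{J}$, $J_i(t)=\sum_{j=1}^{N_i(t)}J_i^{(j)}$ is a compound Poisson process with $N_i$ a unit-rate Poisson process and $(J_i^{(j)})_{j\ge1}$ i.i.d. nonnegative with mean $\gamma_i$, and $\mathbf{P}(J_i^{(1)}\ge x)=e^{-c_iL(x)x^{\alpha}}$, where $\alpha\in(0,1)$, $c_i\in(0,\infty)$, and $L$ is slowly varying with $L(x)/x^{1-\alpha}$ non-increasing for sufficiently large $x$. For $i\notin\mathcal{J}$, $J_i\equiv0$ and $\gamma_i=0$. The processes $J_1,\dots,J_d$ are independent. Let $J=(J_1,\dots,J_d)$, $\gamma=(\gamma_1,\dots,\gamma_d)^{\top}$, and let $r=(r_1,\dots,r_d)^{\top}$ be the vector of deterministic output rates; stability is assumed: $r>\mathcal{Q}^{-1}\gamma$ componentwise. The network starts empty, so the potential content process is $X(t)=J(t)-\mathcal{Q}r\,t$ and the buffer content process is $Z=\phi(X)$. The scaled processes on $[0,T]$ are $X_n(t)=\frac1nX(nt)$ and $Z_n(t)=\frac1nZ(nt)$, so that $Z_n=\phi(X_n)$. **Rate function.** For a path $\xi$ let $I(\xi)=\sum_{t\in[0,T]:\,\xi(t)\ne\xi(t-)}(\xi(t)-\xi(t-))^{\alpha}$, with the convention $\xi(0-)=0$. Define $\tilde I^{(d)}(\xi)=\sum_{j\in\mathcal{J}}c_jI(\xi_j)$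 if $\xi_j\in\mathbb{D}^{(\gamma-\mathcal{Q}r)_j}_{\leqslant\infty}[0,T]$ for all $j\in\mathcal{J}$ and $\xi_j=-(\mathcal{Q}r)_j\,e$ for all $j\notin\mathcal{J}$; and $\tilde I^{(d)}(\xi)=\infty$ otherwise. *)

theory Defs
  imports "HOL-Probability.Probability"
begin

section \<open>Path spaces\<close>

text \<open>
  Paths are total functions on the reals of which only the values on a time set \<open>S\<close> matter;
  \<open>S\<close> is \<open>{0..T}\<close> for the scaled processes and \<open>{0..}\<close> for the unscaled ones.  The one-sided
  limits are taken within \<open>S\<close>, so nothing is required to the left of \<open>0\<close> or to the right of \<open>T\<close>.
\<close>

definition cadlag_on :: "real set \<Rightarrow> (real \<Rightarrow> real) \<Rightarrow> bool" where
  "cadlag_on S \<xi> \<longleftrightarrow>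
     (\<forall>t\<in>S. (\<xi> \<longlongrightarrow> \<xi> t) (at t within (S \<inter> {t<..})) \<and>
            (\<exists>l. (\<xi> \<longlongrightarrow> l) (at t within (S \<inter> {..<t}))))"

definition D_up :: "real set \<Rightarrow> (real \<Rightarrow> real) set" where
  "D_up S = {\<xi>. cadlag_on S \<xi> \<and> mono_on S \<xi> \<and> 0 \<le> \<xi> 0}"

definition D_jump :: "real \<Rightarrow> (real \<Rightarrow> real) set" where
  "D_jump T = {\<xi> \<in> D_up {0..T}.
     \<exists>x u :: nat \<Rightarrow> real.
       (\<forall>j. 0 \<le> x j) \<and> inj u \<and> range u \<subseteq> {0..T} \<and>
       (\<forall>t\<in>{0..T}. (\<lambda>j. x j * indicator {u j..T} t) sums \<xi> t)}"

definition D_jump_drift :: "real \<Rightarrow> real \<Rightarrow> (real \<Rightarrow> real) set" where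
  "D_jump_drift T \<beta> = {(\<lambda>t. \<xi> t + \<beta> * t) | \<xi>. \<xi> \<in> D_jump T}"


section \<open>The reflection map\<close>

definition routing_matrix :: "real^'d^'d \<Rightarrow> bool" where
  "routing_matrix Q \<longleftrightarrow>
     (\<forall>i j. 0 \<le> Q $ i $ j) \<and> (\<forall>i. (\<Sum>j\<in>UNIV. Q $ i $ j) \<le> 1) \<and> (\<forall>i. Q $ i $ i = 0) \<and>
     (\<lambda>n. (((**) Q) ^^ n) (mat 1)) \<longlonglongrightarrow> 0"

definition reflection_matrix :: "real^'d^'d \<Rightarrow> real^'d^'d" where
  "reflection_matrix Q = mat 1 - transpose Q"

definition regulator_set ::
    "real set \<Rightarrow> real^'d^'d \<Rightarrow> (real \<Rightarrow> real^'d) \<Rightarrow> (real \<Rightarrow> real^'d) set" where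
  "regulator_set S Q \<xi> = {\<zeta>. (\<forall>i. (\<lambda>t. \<zeta> t $ i) \<in> D_up S) \<and>
                             (\<forall>t\<in>S. 0 \<le> \<xi> t + reflection_matrix Q *v \<zeta> t)}"

definition regulator ::
    "real set \<Rightarrow> real^'d^'d \<Rightarrow> (real \<Rightarrow> real^'d) \<Rightarrow> real \<Rightarrow> real^'d" where
  "regulator S Q \<xi> t = (\<chi> i. INF \<omega>\<in>regulator_set S Q \<xi>. \<omega> t $ i)"

definition content_map ::
    "real set \<Rightarrow> real^'d^'d \<Rightarrow> (real \<Rightarrow> real^'d) \<Rightarrow> real \<Rightarrow> real^'d" where
  "content_map S Q \<xi> t = \<xi> t + reflection_matrix Q *v regulator S Q \<xi> t"


section \<open>The input and content processes\<close>

text \<open>As usual, a slowly varying function only needs to be positive and measurable near infinity.\<close>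

definition slowly_varying :: "(real \<Rightarrow> real) \<Rightarrow> bool" where
  "slowly_varying L \<longleftrightarrow>
     (\<exists>A. set_borel_measurable borel {A..} L \<and> (\<forall>x\<ge>A. 0 < L x)) \<and>
     (\<forall>a>0. ((\<lambda>x. L (a * x) / L x) \<longlongrightarrow> 1) at_top)"

text \<open>
  The differences of counts below are natural-number differences; they are genuine because the
  counting paths are monotone.
\<close>

definition poisson_process :: "'a measure \<Rightarrow> real \<Rightarrow> (real \<Rightarrow> 'a \<Rightarrow> nat) \<Rightarrow> bool" where
  "poisson_process M rate N \<longleftrightarrow>
     (\<forall>t\<ge>0. N t \<in> measurable M (count_space UNIV)) \<and>
     (\<forall>\<omega>\<in>space M. N 0 \<omega> = 0 \<and> mono_on {0..} (\<lambda>t. N t \<omega>) \<and>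
        (\<forall>t\<ge>0. \<forall>\<^sub>F s in at_right t. N s \<omega> = N t \<omega>)) \<and>
     (\<forall>(\<tau>::nat \<Rightarrow> real) m. mono \<tau> \<and> 0 \<le> \<tau> 0 \<longrightarrow>
        prob_space.indep_vars M (\<lambda>_. count_space UNIV)
          (\<lambda>k \<omega>. N (\<tau> (Suc k)) \<omega> - N (\<tau> k) \<omega>) {..<m}) \<and>
     (\<forall>s t. 0 \<le> s \<and> s < t \<longrightarrow>
        distr M (count_space UNIV) (\<lambda>\<omega>. N t \<omega> - N s \<omega>) =
          measure_pmf (poisson_pmf (rate * (t - s))))"

text \<open>The \<open>j\<close>-th jump size, counted from \<open>1\<close>, is \<open>Y (j - 1)\<close>.\<close>

definition compound_poisson_process ::
    "'a measure \<Rightarrow> real \<Rightarrow> (real \<Rightarrow> 'a \<Rightarrow> nat) \<Rightarrow> (nat \<Rightarrow> 'a \<Rightarrow> real) \<Rightarrow>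
     (real \<Rightarrow> 'a \<Rightarrow> real) \<Rightarrow> bool" where
  "compound_poisson_process M rate N Y J \<longleftrightarrow>
     poisson_process M rate N \<and>
     prob_space.indep_vars M (\<lambda>_. borel) Y UNIV \<and>
     (\<forall>j. distr M borel (Y j) = distr M borel (Y 0)) \<and>
     prob_space.indep_var M
       (Pi\<^sub>M {0..} (\<lambda>_. count_space UNIV)) (\<lambda>\<omega>. \<lambda>t\<in>{0..}. N t \<omega>)
       (Pi\<^sub>M UNIV (\<lambda>_. borel)) (\<lambda>\<omega> j. Y j \<omega>) \<and>
     (\<forall>\<omega>\<in>space M. \<forall>t\<ge>0. J t \<omega> = (\<Sum>j<N t \<omega>. Y j \<omega>))"

definition independent_processes ::
    "'a measure \<Rightarrow> ('i \<Rightarrow> real \<Rightarrow> 'a \<Rightarrow> real) \<Rightarrow> 'i set \<Rightarrow> bool" where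
  "independent_processes M J A \<longleftrightarrow>
     prob_space.indep_vars M (\<lambda>_. Pi\<^sub>M {0..} (\<lambda>_. borel)) (\<lambda>i \<omega>. \<lambda>t\<in>{0..}. J i t \<omega>) A"

definition potential_content ::
    "real^'d^'d \<Rightarrow> real^'d \<Rightarrow> ('d \<Rightarrow> real \<Rightarrow> 'a \<Rightarrow> real) \<Rightarrow> 'a \<Rightarrow> real \<Rightarrow> real^'d" where
  "potential_content Q r J \<omega> t = (\<chi> i. J i t \<omega>) - t *\<^sub>R (reflection_matrix Q *v r)"

definition buffer_content ::
    "real^'d^'d \<Rightarrow> real^'d \<Rightarrow> ('d \<Rightarrow> real \<Rightarrow> 'a \<Rightarrow> real) \<Rightarrow> 'a \<Rightarrow> real \<Rightarrow> real^'d" where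
  "buffer_content Q r J \<omega> = content_map {0..} Q (potential_content Q r J \<omega>)"

definition scaled_buffer_content ::
    "real^'d^'d \<Rightarrow> real^'d \<Rightarrow> ('d \<Rightarrow> real \<Rightarrow> 'a \<Rightarrow> real) \<Rightarrow> nat \<Rightarrow> 'a \<Rightarrow> real \<Rightarrow> real^'d" where
  "scaled_buffer_content Q r J n \<omega> t = (1 / real n) *\<^sub>R buffer_content Q r J \<omega> (real n * t)"


section \<open>The rate function\<close>

definition left_value :: "(real \<Rightarrow> real) \<Rightarrow> real \<Rightarrow> real" where
  "left_value \<xi> t = (if t = 0 then 0 else Lim (at_left t) \<xi>)"

text \<open>
  The sum over the jump times is unordered and takes the value \<open>\<infinity>\<close> when it diverges.  It is
  only meaningful for paths whose jumps are all upward, since \<open>powr\<close> expects a nonnegative base.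
\<close>

definition jump_cost :: "real \<Rightarrow> real \<Rightarrow> (real \<Rightarrow> real) \<Rightarrow> ereal" where
  "jump_cost T \<alpha> \<xi> =
     (\<Sum>\<^sub>\<infinity>t\<in>{t\<in>{0..T}. \<xi> t \<noteq> left_value \<xi> t}. ereal ((\<xi> t - left_value \<xi> t) powr \<alpha>))"

definition rate_function ::
    "real \<Rightarrow> real \<Rightarrow> real^'d^'d \<Rightarrow> real^'d \<Rightarrow> real^'d \<Rightarrow> 'd set \<Rightarrow> ('d \<Rightarrow> real) \<Rightarrow>
     (real \<Rightarrow> real^'d) \<Rightarrow> ereal" where
  "rate_function T \<alpha> Q r \<gamma> \<J> c \<xi> =
     (if (\<forall>j\<in>\<J>. (\<lambda>t. \<xi> t $ j) \<in> D_jump_drift T ((\<gamma> - reflection_matrix Q *v r) $ j)) \<and>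
         (\<forall>j. j \<notin> \<J> \<longrightarrow> (\<forall>t\<in>{0..T}. \<xi> t $ j = - (reflection_matrix Q *v r) $ j * t))
      then (\<Sum>j\<in>\<J>. ereal (c j) * jump_cost T \<alpha> (\<lambda>t. \<xi> t $ j))
      else \<infinity>)"

definition V_ge ::
    "real \<Rightarrow> real^'d^'d \<Rightarrow> real^'d \<Rightarrow> real^'d \<Rightarrow> real^'d \<Rightarrow> real \<Rightarrow> (real \<Rightarrow> real^'d) set" where
  "V_ge T Q r \<gamma> b y =
     {\<xi>. (\<forall>i. (\<lambda>t. \<xi> t $ i) \<in> D_jump_drift T ((\<gamma> - reflection_matrix Q *v r) $ i)) \<and>
         y \<le> b \<bullet> content_map {0..T} Q \<xi> T}"

definition V_star_ge ::
    "real \<Rightarrow> real \<Rightarrow> real^'d^'d \<Rightarrow> real^'d \<Rightarrow> real^'d \<Rightarrow> 'd set \<Rightarrow> ('d \<Rightarrow> real) \<Rightarrow>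
     real^'d \<Rightarrow> real \<Rightarrow> ereal" where
  "V_star_ge T \<alpha> Q r \<gamma> \<J> c b y = (INF \<xi>\<in>V_ge T Q r \<gamma> b y. rate_function T \<alpha> Q r \<gamma> \<J> c \<xi>)"

end

theory Submission
  imports Defs "HOL-Real_Asymp.Real_Asymp"
begin

text \<open>
  Delaying the input by \<open>d\<close> and lowering it by \<open>e\<close> raises the regulator by at most \<open>d r + e p\<close>, where
  \<open>\<Q> p \<ge> 1\<close>.  Hence the content at time \<open>T\<close> depends, up to an error proportional to the mesh, only on
  the values of the input at finitely many grid times, and no large deviation principle on path
  space is needed: the increments over the grid cells are independent, and each of them exceeds its
  mean by \<open>n x\<close> with probability \<open>exp (- c x\<^sup>\<alpha> L(n) n\<^sup>\<alpha> (1 + o(1)))\<close>, by a truncated Chernoff bound from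
  above and by one big jump from below, while falling short of the mean is exponentially
  unlikely in \<open>n\<close>.  On the deterministic side, collecting the jumps of a path inside a cell into a
  single jump only lowers its cost because \<open>x \<mapsto> x\<^sup>\<alpha>\<close> is subadditive, and the discretisation
  errors are made up for by an arbitrarily cheap additional jump at time \<open>T\<close>, which raises the content
  by its full size.
\<close>

section \<open>The reflection map\<close>

text \<open>The content at T combines the regulators of the nodes with both signs, so a one-sided
  comparison of inputs is not enough: the two inputs are controlled from both sides, at the price of
  a lag of one cell. This shapes both bounds. From below, every cell increment is prescribed in a
  narrow window, which loses nothing on the scale q(n) = L(n) n^\<alpha> because the rate is
  strictly increasing in the size. From above, shortfalls have to be excluded as well, which is free
  because their exponent is of order n and q(n) = o(n). The lag arises since block ends have to be
  integers and jumps may lie anywhere in a cell; the paths compared are close only after a small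
  time shift, not uniformly. For cells of length \<delta> the resulting error is C (\<delta> +
  \<delta>): one \<delta> for the time shift, one for the inaccuracy of the increments. A final jump
  of size 2 C \<delta> / b_j at an input node j with b_j > 0 repairs it at the price c_j (2 C
  \<delta> / b_j)^\<alpha>, which tends to 0.\<close>

lemma vector_mult_matrix_power:
  "v v* (((**) Q) ^^ n) (mat 1) = ((\<lambda>u. u v* Q) ^^ n) v"
  for Q :: "real^'d^'d"
proof (induction n arbitrary: v)
  case (Suc n)
  have "v v* (((**) Q) ^^ Suc n) (mat 1) = (v v* Q) v* (((**) Q) ^^ n) (mat 1)"
    by (simp add: vector_matrix_mul_assoc)
  then show ?case
    by (simp only: Suc funpow_Suc_right o_apply)
qed simp

lemma routing_matrix_funpow_tendsto_0:
  fixes Q :: "real^'d^'d"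
  assumes "routing_matrix Q"
  shows "(\<lambda>n. ((\<lambda>u. u v* Q) ^^ n) v) \<longlonglongrightarrow> 0"
proof -
  have "linear (\<lambda>A :: real^'d^'d. v v* A)"
    by (intro linearI)
      (simp_all add: vec_eq_iff vector_matrix_mult_def sum.distrib sum_distrib_left algebra_simps)
  then have "bounded_linear (\<lambda>A :: real^'d^'d. v v* A)"
    by (simp add: linear_conv_bounded_linear)
  then have "(\<lambda>n. v v* (((**) Q) ^^ n) (mat 1)) \<longlonglongrightarrow> v v* (0 :: real^'d^'d)"
    by (rule bounded_linear.tendsto) (use assms in \<open>simp add: routing_matrix_def\<close>)
  moreover have "v v* (0 :: real^'d^'d) = 0"
    by (simp add: vec_eq_iff vector_matrix_mult_def)
  ultimately show ?thesis
    by (simp add: vector_mult_matrix_power)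
qed

lemma reflection_matrix_mult: "reflection_matrix Q *v v = v - v v* Q"
  by (simp add: reflection_matrix_def matrix_vector_mult_diff_rdistrib)

lemma vector_mult_routing_matrix_mono:
  fixes Q :: "real^'d^'d"
  assumes "routing_matrix Q" "\<And>i. u $ i \<le> v $ i"
  shows "(u v* Q) $ i \<le> (v v* Q) $ i"
  using assms
  by (auto simp: routing_matrix_def vector_matrix_mult_def intro!: sum_mono mult_right_mono)

text \<open>p is twice a truncated Neumann series for the transpose of Q, applied to the vector of
  ones. Once the remainder is below 1/2 in every coordinate, \<open>reflection_matrix Q *v p\<close>
  is at least 2 (1 - 1/2) = 1. Raising a regulator by e p therefore raises every content by at least
  e.\<close>

lemma routing_matrix_ex_superharmonic:
  assumes Q: "routing_matrix Q"
  obtains p :: "real^'d" where "\<And>i. 0 \<le> p $ i" "\<And>i. 1 \<le> (reflection_matrix Q *v p) $ i"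
proof -
  let ?u = "\<lambda>k. ((\<lambda>u. u v* Q) ^^ k) (1 :: real^'d)"
  have nonneg: "0 \<le> ?u k $ i" for k i
  proof (induction k arbitrary: i)
    case (Suc k)
    then have "(0 v* Q) $ i \<le> (?u k v* Q) $ i"
      by (intro vector_mult_routing_matrix_mono[OF Q]) simp
    then show ?case by simp
  qed simp
  have "(\<lambda>n. ?u n) \<longlonglongrightarrow> 0"
    by (rule routing_matrix_funpow_tendsto_0[OF Q])
  then have "\<forall>\<^sub>F n in sequentially. dist (?u n) 0 < 1/2"
    by (rule tendstoD) simp
  then obtain n where n: "norm (?u n) < 1/2"
    by (auto simp: eventually_sequentially)
  have half: "?u n $ i < 1/2" for i
    using component_le_norm_cart[of "?u n" i] n by linarith
  have tele: "reflection_matrix Q *v (\<Sum>k<n. ?u k) = 1 - ?u n" for n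
  proof (induction n)
    case (Suc n)
    have "reflection_matrix Q *v ?u n = ?u n - ?u (Suc n)"
      by (simp add: reflection_matrix_mult)
    with Suc show ?case
      by (simp add: matrix_vector_right_distrib)
  qed simp
  show thesis
  proof (rule that)
    show "0 \<le> (2 *\<^sub>R (\<Sum>k<n. ?u k)) $ i" for i
      by (simp add: sum_nonneg nonneg)
    show "1 \<le> (reflection_matrix Q *v (2 *\<^sub>R (\<Sum>k<n. ?u k))) $ i" for i
      using half[of i] by (simp add: matrix_vector_mult_scaleR tele)
  qed
qed

text \<open>By hypothesis v dominates its image under the transpose of Q, hence all iterated images
  by monotonicity, and these tend to 0.\<close>

lemma routing_matrix_nonneg_of_reflection_nonneg:
  assumes Q: "routing_matrix Q" and "\<And>i. 0 \<le> (reflection_matrix Q *v v) $ i"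
  shows "0 \<le> v $ i"
proof -
  have step: "(v v* Q) $ i \<le> v $ i" for i
    using assms(2)[of i] by (simp add: reflection_matrix_mult)
  have "((\<lambda>u. u v* Q) ^^ n) v $ i \<le> v $ i" for n i
  proof (induction n arbitrary: i)
    case (Suc n)
    then show ?case
      using vector_mult_routing_matrix_mono[OF Q, of "((\<lambda>u. u v* Q) ^^ n) v" v i] step[of i] by simp
  qed simp
  moreover have "(\<lambda>n. ((\<lambda>u. u v* Q) ^^ n) v $ i) \<longlonglongrightarrow> 0 $ i"
    by (intro tendsto_vec_nth routing_matrix_funpow_tendsto_0[OF Q])
  ultimately show ?thesis
    by (auto intro: LIMSEQ_le_const2)
qed

text \<open>Injectivity comes from applying the preceding minimum principle to v and to -v. The
  lemma gives the stability condition its meaning, since \<open>matrix_inv\<close> is only a choice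
  operator until invertibility is known.\<close>

lemma reflection_matrix_inv:
  assumes Q: "routing_matrix Q"
  shows "reflection_matrix Q *v (matrix_inv (reflection_matrix Q) *v v) = v"
proof -
  have "v = 0" if "reflection_matrix Q *v v = 0" for v
  proof -
    have "reflection_matrix Q *v (- v) = 0"
      using that linear_neg[OF matrix_vector_mul_linear[of "reflection_matrix Q"], of v] by simp
    then have "0 \<le> v $ i" "0 \<le> (- v) $ i" for i
      using that routing_matrix_nonneg_of_reflection_nonneg[OF Q, of v i]
        routing_matrix_nonneg_of_reflection_nonneg[OF Q, of "- v" i] by simp_all
    then show ?thesis
      by (simp add: vec_eq_iff eq_iff)
  qed
  then have "\<exists>B. B ** reflection_matrix Q = mat 1"
    by (simp add: matrix_left_invertible_ker)
  then have "invertible (reflection_matrix Q)"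
    by (simp add: invertible_left_inverse)
  then have "reflection_matrix Q ** matrix_inv (reflection_matrix Q) = mat 1"
    unfolding invertible_def matrix_inv_def by (rule someI2_ex) blast
  then show ?thesis
    by (simp add: matrix_vector_mul_assoc)
qed

lemma mono_on_left_limit:
  fixes f :: "real \<Rightarrow> real"
  assumes "mono_on S f" "t \<in> S"
  shows "\<exists>l. (f \<longlongrightarrow> l) (at t within (S \<inter> {..<t}))"
proof (cases "S \<inter> {..<t} = {}")
  case False
  let ?l = "Sup (f ` (S \<inter> {..<t}))"
  have bdd: "bdd_above (f ` (S \<inter> {..<t}))"
    using assms by (intro bdd_aboveI[of _ "f t"]) (auto dest: mono_onD)
  have "(f \<longlongrightarrow> ?l) (at t within (S \<inter> {..<t}))"
  proof (rule increasing_tendsto)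
    show "\<forall>\<^sub>F s in at t within (S \<inter> {..<t}). f s \<le> ?l"
      unfolding eventually_at_filter by (intro always_eventually) (auto intro!: cSup_upper bdd)
  next
    fix x assume "x < ?l"
    then obtain s where s: "s \<in> S" "s < t" "x < f s"
      using False bdd by (auto simp: less_cSup_iff)
    have "\<forall>\<^sub>F u in nhds t. u > s"
      using s by (intro eventually_nhds_in_open[of "{s<..}", simplified]) auto
    then show "\<forall>\<^sub>F u in at t within (S \<inter> {..<t}). x < f u"
      unfolding eventually_at_filter
    proof eventually_elim
      case (elim u)
      then show ?case
        using mono_onD[OF assms(1) s(1), of u] s(3) by auto
    qed
  qed
  then show ?thesis ..
qed simp

lemma D_up_mono: "f \<in> D_up S \<Longrightarrow> s \<in> S \<Longrightarrow> t \<in> S \<Longrightarrow> s \<le> t \<Longrightarrow> f s \<le> f t"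
  unfolding D_up_def by (blast dest: mono_onD)

lemma D_up_nonneg: "f \<in> D_up S \<Longrightarrow> 0 \<in> S \<Longrightarrow> t \<in> S \<Longrightarrow> 0 \<le> t \<Longrightarrow> 0 \<le> f t"
  using D_up_mono[of f S 0 t] by (auto simp: D_up_def)

text \<open>A monotone path has left limits for free, as suprema, so right-continuity is the only
  regularity left to check.\<close>

lemma D_upI:
  assumes "mono_on S f" "0 \<le> f 0"
    and "\<And>t. t \<in> S \<Longrightarrow> (f \<longlongrightarrow> f t) (at t within (S \<inter> {t<..}))"
  shows "f \<in> D_up S"
  using assms mono_on_left_limit[OF assms(1)] by (auto simp: D_up_def cadlag_on_def)

text \<open>Separates the input from the drain caused by the output rates. The regulator t r cancels
  this drain exactly, which is why feasibility and the price of a delay are expressed through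
  r.\<close>

definition net_input :: "real^'d^'d \<Rightarrow> real^'d \<Rightarrow> (real \<Rightarrow> real^'d) \<Rightarrow> real \<Rightarrow> real^'d" where
  "net_input Q r \<eta> t = \<eta> t - t *\<^sub>R (reflection_matrix Q *v r)"

lemma regulator_set_nonneg:
  assumes "\<zeta> \<in> regulator_set S Q \<xi>" "0 \<in> S" "t \<in> S" "0 \<le> t"
  shows "0 \<le> \<zeta> t $ i"
proof -
  have "(\<lambda>t. \<zeta> t $ i) \<in> D_up S"
    using assms by (simp add: regulator_set_def)
  then show ?thesis
    using assms by (auto dest: D_up_nonneg)
qed

text \<open>Two infima are compared candidate by candidate: each feasible regulator of one problem
  is converted into one of the other. The factor k serves the change of time scale, the offset a the
  price of a delay.\<close>

lemma regulator_le_transfer: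
  assumes "regulator_set S Q \<xi> \<noteq> {}" "0 \<in> S'" "t' \<in> S'" "0 \<le> t'" "0 < k"
    and "\<And>\<zeta>. \<zeta> \<in> regulator_set S Q \<xi> \<Longrightarrow> \<exists>\<zeta>'\<in>regulator_set S' Q \<xi>'. \<zeta>' t' $ i \<le> k * \<zeta> t $ i + a"
  shows "regulator S' Q \<xi>' t' $ i \<le> k * regulator S Q \<xi> t $ i + a"
proof -
  have "(regulator S' Q \<xi>' t' $ i - a) / k \<le> \<zeta> t $ i" if \<zeta>: "\<zeta> \<in> regulator_set S Q \<xi>" for \<zeta>
  proof -
    obtain \<zeta>' where \<zeta>': "\<zeta>' \<in> regulator_set S' Q \<xi>'" "\<zeta>' t' $ i \<le> k * \<zeta> t $ i + a"
      using assms(6)[OF \<zeta>] by blast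
    have "regulator S' Q \<xi>' t' $ i \<le> \<zeta>' t' $ i"
      unfolding regulator_def using regulator_set_nonneg[OF _ assms(2-4)] \<zeta>'(1)
      by (auto intro!: cINF_lower bdd_belowI[of _ 0])
    then show ?thesis
      using \<zeta>'(2) \<open>0 < k\<close> by (simp add: field_simps)
  qed
  then have "(regulator S' Q \<xi>' t' $ i - a) / k \<le> regulator S Q \<xi> t $ i"
    unfolding regulator_def[of S] using assms(1) by (simp add: cINF_greatest)
  then show ?thesis
    using \<open>0 < k\<close> by (simp add: field_simps)
qed

lemma linear_in_D_up: "0 \<le> a \<Longrightarrow> (\<lambda>t. t * a) \<in> D_up S"
  by (intro D_upI) (auto intro!: mono_onI mult_right_mono tendsto_intros)

lemma regulator_set_nonempty:
  assumes "\<And>i. 0 \<le> r $ i" "\<And>t i. t \<in> S \<Longrightarrow> 0 \<le> \<eta> t $ i"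
  shows "(\<lambda>t. t *\<^sub>R r) \<in> regulator_set S Q (net_input Q r \<eta>)"
  using assms
  by (auto simp: regulator_set_def net_input_def matrix_vector_mult_scaleR linear_in_D_up
      less_eq_vec_def)

lemma tendsto_shift_right:
  fixes f :: "real \<Rightarrow> real"
  assumes "(f \<longlongrightarrow> l) (at (t - d) within ({0..T} \<inter> {t - d<..}))" "0 \<le> d" "d \<le> t"
  shows "((\<lambda>s. f (s - d)) \<longlongrightarrow> l) (at t within ({0..T} \<inter> {t<..}))"
proof (rule filterlim_compose[OF assms(1)])
  have "((\<lambda>s. s - d) \<longlongrightarrow> t - d) (at t within ({0..T} \<inter> {t<..}))"
    by (intro tendsto_intros)
  moreover have "\<forall>\<^sub>F s in at t within ({0..T} \<inter> {t<..}). s - d \<in> {0..T} \<inter> {t - d<..} \<and> s - d \<noteq> t - d"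
    unfolding eventually_at_filter using assms by (intro always_eventually) auto
  ultimately show "filterlim (\<lambda>s. s - d) (at (t - d) within ({0..T} \<inter> {t - d<..}))
      (at t within ({0..T} \<inter> {t<..}))"
    by (auto simp: filterlim_at elim: eventually_mono)
qed

text \<open>The candidate for a delayed input: slope a up to time d, then f from its start on top of
  d a. At d it can only jump upward because f is nonnegative.\<close>

lemma shifted_in_D_up:
  assumes f: "f \<in> D_up {0..T}" and "0 \<le> d" "0 \<le> a" "0 \<le> e"
  shows "(\<lambda>t. (if t < d then t * a else f (t - d) + d * a) + e) \<in> D_up {0..T}"
proof (rule D_upI)
  let ?g = "\<lambda>t. (if t < d then t * a else f (t - d) + d * a) + e"
  have nn: "0 \<le> f t" if "t \<in> {0..T}" for t
    using f that by (auto intro: D_up_nonneg)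
  have mono: "f s \<le> f t" if "s \<in> {0..T}" "t \<in> {0..T}" "s \<le> t" for s t
    using f that by (auto intro: D_up_mono)
  show "mono_on {0..T} ?g"
  proof (rule mono_onI)
    fix s t assume st: "s \<in> {0..T}" "t \<in> {0..T}" "s \<le> t"
    have "s * a \<le> f (t - d) + d * a" if "s < d" "d \<le> t"
      using that st nn[of "t - d"] mult_right_mono[of s d a] assms by simp
    moreover have "f (s - d) \<le> f (t - d)" if "d \<le> s"
      using that st assms by (intro mono) auto
    moreover have "s * a \<le> t * a"
      using st assms by (intro mult_right_mono)
    ultimately show "?g s \<le> ?g t"
      using st by auto
  qed
  show "0 \<le> ?g 0"
    using assms f by (auto simp: D_up_def)
  fix t assume t: "t \<in> {0..T}"
  show "(?g \<longlongrightarrow> ?g t) (at t within ({0..T} \<inter> {t<..}))"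
  proof (cases "t < d")
    case True
    have "\<forall>\<^sub>F s in at t within ({0..T} \<inter> {t<..}). s * a + e = ?g s"
      using eventually_nhds_in_open[of "{..<d}" t] True unfolding eventually_at_filter
      by (auto elim!: eventually_mono)
    moreover have "((\<lambda>s. s * a + e) \<longlongrightarrow> t * a + e) (at t within ({0..T} \<inter> {t<..}))"
      by (intro tendsto_intros)
    ultimately show ?thesis
      using True by (simp add: filterlim_cong[OF refl refl, THEN iffD1, rotated])
  next
    case False
    have "\<forall>\<^sub>F s in at t within ({0..T} \<inter> {t<..}). f (s - d) + d * a + e = ?g s"
      using False unfolding eventually_at_filter by (intro always_eventually) auto
    moreover have "((\<lambda>s. f (s - d) + d * a + e) \<longlongrightarrow> f (t - d) + d * a + e)
        (at t within ({0..T} \<inter> {t<..}))"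
      using f t False assms
      by (intro tendsto_intros tendsto_shift_right) (auto simp: D_up_def cadlag_on_def)
    ultimately show ?thesis
      using False by (simp add: filterlim_cong[OF refl refl, THEN iffD1, rotated])
  qed
qed

text \<open>
  Delaying the input by \<open>d\<close> costs at most \<open>d\<close> units of full-rate service, and lowering it by \<open>e\<close>
  costs at most \<open>e p\<close>; hence the regulator is Lipschitz for the Levy distance of the inputs.
\<close>

lemma regulator_le_shift:
  fixes r p :: "real^'d"
  assumes r: "\<And>i. 0 \<le> r $ i"
    and p: "\<And>i. 0 \<le> p $ i" "\<And>i. 1 \<le> (reflection_matrix Q *v p) $ i"
    and "0 \<le> d" "0 \<le> e" "0 \<le> T"
    and \<eta>: "\<And>t i. t \<in> {0..T} \<Longrightarrow> 0 \<le> \<eta> t $ i"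
    and \<eta>': "\<And>t i. t \<in> {0..T} \<Longrightarrow> 0 \<le> \<eta>' t $ i"
    and le: "\<And>t i. t \<in> {d..T} \<Longrightarrow> \<eta> (t - d) $ i - e \<le> \<eta>' t $ i"
  shows "regulator {0..T} Q (net_input Q r \<eta>') T $ i
       \<le> regulator {0..T} Q (net_input Q r \<eta>) T $ i + d * r $ i + e * p $ i"
proof -
  let ?R = "reflection_matrix Q"
  have "regulator {0..T} Q (net_input Q r \<eta>') T $ i
      \<le> 1 * regulator {0..T} Q (net_input Q r \<eta>) T $ i + (d * r $ i + e * p $ i)"
  proof (rule regulator_le_transfer)
    show "regulator_set {0..T} Q (net_input Q r \<eta>) \<noteq> {}"
      using regulator_set_nonempty[of r "{0..T}" \<eta> Q] r \<eta> by auto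
    fix \<zeta> assume \<zeta>: "\<zeta> \<in> regulator_set {0..T} Q (net_input Q r \<eta>)"
    \<comment> \<open>Until time d the drain is cancelled completely, so the content is at least the
      nonnegative input. Afterwards the delayed candidate takes over, with d r making up for the
      drain of the lost time and e p for the deficit e.\<close>
    define \<zeta>' where "\<zeta>' t = (if t < d then t *\<^sub>R r else \<zeta> (t - d) + d *\<^sub>R r) + e *\<^sub>R p" for t
    have up: "(\<lambda>t. \<zeta> t $ i) \<in> D_up {0..T}" for i
      using \<zeta> by (simp add: regulator_set_def)
    have comp: "\<zeta>' t $ i = (if t < d then t * r $ i else \<zeta> (t - d) $ i + d * r $ i) + e * p $ i" for t i
      by (simp add: \<zeta>'_def)
    have "(\<lambda>t. \<zeta>' t $ i) \<in> D_up {0..T}" for i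
      unfolding comp using up[of i] r p assms by (intro shifted_in_D_up) auto
    moreover have "0 \<le> net_input Q r \<eta>' t + ?R *v \<zeta>' t" if t: "t \<in> {0..T}" for t
      unfolding less_eq_vec_def
    proof
      fix i
      have ep: "e \<le> e * (?R *v p) $ i"
        using p(2)[of i] \<open>0 \<le> e\<close> mult_left_mono[of 1 "(?R *v p) $ i" e] by simp
      have "0 \<le> (net_input Q r \<eta> (t - d) + ?R *v \<zeta> (t - d)) $ i" if "d \<le> t"
        using \<zeta> that t \<open>0 \<le> d\<close> by (auto simp: regulator_set_def less_eq_vec_def)
      then show "0 $ i \<le> (net_input Q r \<eta>' t + ?R *v \<zeta>' t) $ i"
        using le[of t i] \<eta>'[OF t, of i] t ep \<open>0 \<le> e\<close>
        by (auto simp: \<zeta>'_def net_input_def matrix_vector_right_distrib matrix_vector_mult_scaleR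
            algebra_simps split: if_splits)
    qed
    ultimately have "\<zeta>' \<in> regulator_set {0..T} Q (net_input Q r \<eta>')"
      by (simp add: regulator_set_def)
    moreover have "\<zeta>' T $ i \<le> 1 * \<zeta> T $ i + (d * r $ i + e * p $ i)"
    proof (cases "T < d")
      case True
      then show ?thesis
        using mult_right_mono[of T d "r $ i"] r[of i] regulator_set_nonneg[OF \<zeta>, of T i] \<open>0 \<le> T\<close>
        by (simp add: comp)
    next
      case False
      then have "\<zeta> (T - d) $ i \<le> \<zeta> T $ i"
        using \<open>0 \<le> d\<close> \<open>0 \<le> T\<close> by (intro D_up_mono[OF up[of i]]) auto
      with False show ?thesis
        by (simp add: comp)
    qed
    ultimately show "\<exists>\<zeta>'\<in>regulator_set {0..T} Q (net_input Q r \<eta>').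
        \<zeta>' T $ i \<le> 1 * \<zeta> T $ i + (d * r $ i + e * p $ i)"
      by blast
  qed (use \<open>0 \<le> T\<close> in auto)
  then show ?thesis by simp
qed

section \<open>The weighted content at time T as a functional of the input\<close>

definition content_functional ::
    "real \<Rightarrow> real^'d^'d \<Rightarrow> real^'d \<Rightarrow> real^'d \<Rightarrow> (real \<Rightarrow> real^'d) \<Rightarrow> real" where
  "content_functional T Q r b \<eta> = b \<bullet> content_map {0..T} Q (net_input Q r \<eta>) T"

definition input_path :: "real \<Rightarrow> (real \<Rightarrow> real^'d) \<Rightarrow> bool" where
  "input_path T \<eta> \<longleftrightarrow> (\<forall>i. mono_on {0..T} (\<lambda>t. \<eta> t $ i) \<and> 0 \<le> \<eta> 0 $ i)"

lemma input_path_mono: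
  "input_path T \<eta> \<Longrightarrow> 0 \<le> s \<Longrightarrow> s \<le> t \<Longrightarrow> t \<le> T \<Longrightarrow> \<eta> s $ i \<le> \<eta> t $ i"
  unfolding input_path_def by (auto intro: mono_onD[where A = "{0..T}" and f = "\<lambda>t. \<eta> t $ i"])

lemma input_path_nonneg: "input_path T \<eta> \<Longrightarrow> t \<in> {0..T} \<Longrightarrow> 0 \<le> \<eta> t $ i"
  using input_path_mono[of T \<eta> 0 t i] by (auto simp: input_path_def intro: order_trans)

lemma content_functional_diff:
  "content_functional T Q r b \<eta> - content_functional T Q r b \<eta>' =
    b \<bullet> (\<eta> T - \<eta>' T) + b \<bullet> (reflection_matrix Q *v
      (regulator {0..T} Q (net_input Q r \<eta>) T - regulator {0..T} Q (net_input Q r \<eta>') T))"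
  by (simp add: content_functional_def content_map_def net_input_def matrix_vector_mult_diff_distrib
      inner_diff_right inner_add_right)

lemma grid_floor:
  fixes t T :: real
  assumes "0 < m" "0 < T" "T / real m \<le> t" "t \<le> T"
  obtains k where "1 \<le> k" "k \<le> m" "real k * T / real m \<le> t" "t - T / real m \<le> real k * T / real m"
proof
  let ?k = "nat \<lfloor>t * real m / T\<rfloor>"
  have t: "1 \<le> t * real m / T" "t * real m / T \<le> real m"
    using assms by (simp_all add: field_simps)
  then show "1 \<le> ?k" "?k \<le> m"
    by linarith+
  have "real ?k \<le> t * real m / T" "t * real m / T - 1 \<le> real ?k"
    using t by linarith+
  then have "real ?k * (T / real m) \<le> t * real m / T * (T / real m)"
    "(t * real m / T - 1) * (T / real m) \<le> real ?k * (T / real m)"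
    using assms(1,2) by (intro mult_right_mono; simp)+
  then show "real ?k * T / real m \<le> t" "t - T / real m \<le> real ?k * T / real m"
    using assms(1,2) by (simp_all only: left_diff_distrib) simp_all
qed

text \<open>The second family of inequalities compares one cell later, because a jump may lie
  anywhere in its cell. It enters although only one content is bounded by the other: the
  off-diagonal entries of the reflection matrix are nonpositive, so a larger regulator at one node
  lowers the content at another.\<close>

lemma content_functional_grid_le:
  fixes Q :: "real^'d^'d" and b :: "real^'d"
  assumes Q: "routing_matrix Q" and r: "\<And>i. 0 \<le> r $ i" and b: "\<And>i. 0 \<le> b $ i" and T: "0 < T"
  obtains C where "0 < C"
    "\<And>m e (\<eta> :: real \<Rightarrow> real^'d) \<eta>'. 0 < m \<Longrightarrow> 0 \<le> e \<Longrightarrow> input_path T \<eta> \<Longrightarrow> input_path T \<eta>' \<Longrightarrow>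
      (\<And>k i. 1 \<le> k \<Longrightarrow> k \<le> m \<Longrightarrow> \<eta> (real k * T / real m) $ i \<le> \<eta>' (real k * T / real m) $ i + e) \<Longrightarrow>
      (\<And>k i. 1 \<le> k \<Longrightarrow> k < m \<Longrightarrow>
        \<eta>' (real k * T / real m) $ i \<le> \<eta> (real (Suc k) * T / real m) $ i + e) \<Longrightarrow>
      content_functional T Q r b \<eta> \<le> content_functional T Q r b \<eta>' + C * (T / real m + e)"
proof -
  obtain p :: "real^'d" where p: "\<And>i. 0 \<le> p $ i" "\<And>i. 1 \<le> (reflection_matrix Q *v p) $ i"
    using routing_matrix_ex_superharmonic[OF Q] by blast
  let ?R = "(*v) (reflection_matrix Q)"
  let ?reg = "\<lambda>\<eta>. regulator {0..T} Q (net_input Q r \<eta>) T"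
  have bl: "bounded_linear ?R"
    by simp
  \<comment> \<open>The first sum pays for the inputs at time T, the second term for the regulators,
    through the operator norm and the l1 bound of the Euclidean norm. The factor 3 is the delay in
    cells, and 1 makes C positive.\<close>
  define C where "C = (\<Sum>i\<in>UNIV. b $ i) + norm b * (onorm ?R * (3 * (\<Sum>i\<in>UNIV. r $ i + p $ i))) + 1"
  have sb: "0 \<le> (\<Sum>i\<in>UNIV. b $ i)"
    by (intro sum_nonneg b)
  have C1: "0 \<le> norm b * (onorm ?R * (3 * (\<Sum>i\<in>UNIV. r $ i + p $ i)))"
    by (intro mult_nonneg_nonneg sum_nonneg add_nonneg_nonneg onorm_pos_le bl norm_ge_zero r p) simp
  show thesis
  proof (rule that)
    show "0 < C"
      unfolding C_def using C1 sb by simp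
    fix m e and \<eta> \<eta>' :: "real \<Rightarrow> real^'d"
    assume m: "0 < m" and e: "0 \<le> e" and ip: "input_path T \<eta>" "input_path T \<eta>'"
      and le1: "\<And>k i. 1 \<le> k \<Longrightarrow> k \<le> m \<Longrightarrow>
        \<eta> (real k * T / real m) $ i \<le> \<eta>' (real k * T / real m) $ i + e"
      and le2: "\<And>k i. 1 \<le> k \<Longrightarrow> k < m \<Longrightarrow>
        \<eta>' (real k * T / real m) $ i \<le> \<eta> (real (Suc k) * T / real m) $ i + e"
    define d where "d = T / real m"
    have d: "0 < d"
      using m T by (simp add: d_def)
    \<comment> \<open>Three cells of delay: one for rounding t down to a grid time, one for the lag
      in \<open>le2\<close>, and one more that makes k at least 2, so that the preceding grid time
      has positive index.\<close>
    have close: "\<eta> (t - 3 * d) $ i - e \<le> \<eta>' t $ i" "\<eta>' (t - 3 * d) $ i - e \<le> \<eta> t $ i"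
      if t: "t \<in> {3 * d..T}" for t i
    proof -
      obtain k where k: "1 \<le> k" "k \<le> m" "real k * T / real m \<le> t" "t - d \<le> real k * T / real m"
      proof -
        have "d \<le> t" "t \<le> T"
          using t d by auto
        then show thesis
          using grid_floor[of m T t] m T that unfolding d_def by blast
      qed
      have kd: "real l * T / real m = real l * d" for l
        by (simp add: d_def)
      have "2 * d \<le> real k * d"
        using k(4) t unfolding kd by auto
      then have "2 \<le> k"
        using d by simp
      then obtain l where l: "k = Suc l" "1 \<le> l" "l < m"
        using k(2) by (cases k) auto
      have ld: "t - 3 * d \<le> real l * d" "real l * d \<le> T" "real (Suc l) * d \<le> t"
        using k(3,4) d t unfolding kd l(1) by (simp_all add: algebra_simps)
      have "\<eta> (t - 3 * d) $ i \<le> \<eta> (real k * T / real m) $ i"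
        using k t d by (intro input_path_mono[OF ip(1)]) (auto simp: kd)
      moreover have "\<eta>' (real k * T / real m) $ i \<le> \<eta>' t $ i"
        using k t d by (intro input_path_mono[OF ip(2)]) (auto simp: kd)
      ultimately show "\<eta> (t - 3 * d) $ i - e \<le> \<eta>' t $ i"
        using le1[OF k(1,2), of i] by linarith
      have "\<eta>' (t - 3 * d) $ i \<le> \<eta>' (real l * T / real m) $ i"
        using ld t d unfolding kd by (intro input_path_mono[OF ip(2)]) auto
      moreover have "\<eta> (real (Suc l) * T / real m) $ i \<le> \<eta> t $ i"
        using ld t d unfolding kd by (intro input_path_mono[OF ip(1)]) auto
      ultimately show "\<eta>' (t - 3 * d) $ i - e \<le> \<eta> t $ i"
        using le2[OF l(2,3), of i] by linarith
    qed
    have reg: "\<bar>?reg \<eta> $ i - ?reg \<eta>' $ i\<bar> \<le> 3 * d * r $ i + e * p $ i" for i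
    proof -
      have "?reg \<eta>' $ i \<le> ?reg \<eta> $ i + 3 * d * r $ i + e * p $ i"
        by (rule regulator_le_shift[OF r p])
          (use d T e close ip[THEN input_path_nonneg] in \<open>simp_all (no_asm_simp)\<close>)
      moreover have "?reg \<eta> $ i \<le> ?reg \<eta>' $ i + 3 * d * r $ i + e * p $ i"
        by (rule regulator_le_shift[OF r p])
          (use d T e close ip[THEN input_path_nonneg] in \<open>simp_all (no_asm_simp)\<close>)
      ultimately show ?thesis by linarith
    qed
    have "norm (?reg \<eta> - ?reg \<eta>') \<le> (\<Sum>i\<in>UNIV. \<bar>?reg \<eta> $ i - ?reg \<eta>' $ i\<bar>)"
      using norm_le_l1_cart[of "?reg \<eta> - ?reg \<eta>'"] by simp
    also have "\<dots> \<le> (\<Sum>i\<in>UNIV. (d + e) * (3 * (r $ i + p $ i)))"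
    proof (rule sum_mono)
      fix i
      have "0 \<le> d * p $ i" "0 \<le> e * r $ i" "0 \<le> e * p $ i"
        using d e r p by simp_all
      then have "3 * d * r $ i + e * p $ i \<le> (d + e) * (3 * (r $ i + p $ i))"
        by (simp add: algebra_simps)
      with reg[of i] show "\<bar>?reg \<eta> $ i - ?reg \<eta>' $ i\<bar> \<le> (d + e) * (3 * (r $ i + p $ i))"
        by linarith
    qed
    finally have nreg: "norm (?reg \<eta> - ?reg \<eta>') \<le> (d + e) * (3 * (\<Sum>i\<in>UNIV. r $ i + p $ i))"
      by (simp only: sum_distrib_left)
    have "b \<bullet> ?R (?reg \<eta> - ?reg \<eta>') \<le> norm b * norm (?R (?reg \<eta> - ?reg \<eta>'))"
      by (rule norm_cauchy_schwarz)
    also have "\<dots> \<le> norm b * (onorm ?R * norm (?reg \<eta> - ?reg \<eta>'))"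
      by (intro mult_left_mono onorm[OF bl]) simp
    also have "\<dots> \<le> norm b * (onorm ?R * ((d + e) * (3 * (\<Sum>i\<in>UNIV. r $ i + p $ i))))"
      by (intro mult_left_mono nreg onorm_pos_le bl) simp
    finally have 1: "b \<bullet> ?R (?reg \<eta> - ?reg \<eta>')
        \<le> norm b * (onorm ?R * (3 * (\<Sum>i\<in>UNIV. r $ i + p $ i))) * (d + e)"
      by (simp only: ac_simps)
    have "b \<bullet> (\<eta> T - \<eta>' T) = (\<Sum>i\<in>UNIV. b $ i * (\<eta> T - \<eta>' T) $ i)"
      by (simp add: inner_vec_def)
    also have "\<dots> \<le> (\<Sum>i\<in>UNIV. b $ i * (d + e))"
    proof (intro sum_mono mult_left_mono b)
      fix i
      show "(\<eta> T - \<eta>' T) $ i \<le> d + e"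
        using le1[of m i] m d by simp
    qed
    finally have 2: "b \<bullet> (\<eta> T - \<eta>' T) \<le> (\<Sum>i\<in>UNIV. b $ i) * (d + e)"
      by (simp add: sum_distrib_right)
    have "content_functional T Q r b \<eta> - content_functional T Q r b \<eta>'
        = b \<bullet> (\<eta> T - \<eta>' T) + b \<bullet> ?R (?reg \<eta> - ?reg \<eta>')"
      by (rule content_functional_diff)
    also have "\<dots> \<le> C * (d + e)"
      using 1 2 d e by (simp add: C_def distrib_right)
    finally show "content_functional T Q r b \<eta> \<le> content_functional T Q r b \<eta>' + C * (T / real m + e)"
      by (simp add: d_def)
  qed
qed

text \<open>Comparison on ever finer grids: the mesh term vanishes in the limit and only the uniform
  distance remains. This gives the continuity behind measurability.\<close>

lemma content_functional_lipschitz: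
  fixes Q :: "real^'d^'d" and b :: "real^'d"
  assumes Q: "routing_matrix Q" and r: "\<And>i. 0 \<le> r $ i" and b: "\<And>i. 0 \<le> b $ i" and T: "0 < T"
  obtains C where "0 < C"
    "\<And>e (\<eta> :: real \<Rightarrow> real^'d) \<eta>'. 0 \<le> e \<Longrightarrow> input_path T \<eta> \<Longrightarrow> input_path T \<eta>' \<Longrightarrow>
      (\<And>t i. t \<in> {0..T} \<Longrightarrow> \<bar>\<eta> t $ i - \<eta>' t $ i\<bar> \<le> e) \<Longrightarrow>
      \<bar>content_functional T Q r b \<eta> - content_functional T Q r b \<eta>'\<bar> \<le> C * e"
proof -
  obtain C where C: "0 < C" and
    grid: "\<And>m e (\<eta> :: real \<Rightarrow> real^'d) \<eta>'. 0 < m \<Longrightarrow> 0 \<le> e \<Longrightarrow> input_path T \<eta> \<Longrightarrow> input_path T \<eta>' \<Longrightarrow>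
      (\<And>k i. 1 \<le> k \<Longrightarrow> k \<le> m \<Longrightarrow> \<eta> (real k * T / real m) $ i \<le> \<eta>' (real k * T / real m) $ i + e) \<Longrightarrow>
      (\<And>k i. 1 \<le> k \<Longrightarrow> k < m \<Longrightarrow>
        \<eta>' (real k * T / real m) $ i \<le> \<eta> (real (Suc k) * T / real m) $ i + e) \<Longrightarrow>
      content_functional T Q r b \<eta> \<le> content_functional T Q r b \<eta>' + C * (T / real m + e)"
    using content_functional_grid_le[OF Q r b T] by blast
  have le: "content_functional T Q r b \<eta> \<le> content_functional T Q r b \<eta>' + C * e"
    if e: "0 \<le> e" and ip: "input_path T \<eta>" "input_path T \<eta>'"
      and close: "\<And>t i. t \<in> {0..T} \<Longrightarrow> \<bar>\<eta> t $ i - \<eta>' t $ i\<bar> \<le> e" for e and \<eta> \<eta>' :: "real \<Rightarrow> real^'d"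
  proof (rule LIMSEQ_le_const)
    have "(\<lambda>m. T / real (Suc m)) \<longlonglongrightarrow> 0"
      by real_asymp
    then have "(\<lambda>m. content_functional T Q r b \<eta>' + C * (T / real (Suc m) + e))
        \<longlonglongrightarrow> content_functional T Q r b \<eta>' + C * (0 + e)"
      by (intro tendsto_intros)
    then show "(\<lambda>m. content_functional T Q r b \<eta>' + C * (T / real (Suc m) + e))
        \<longlonglongrightarrow> content_functional T Q r b \<eta>' + C * e"
      by simp
    have "content_functional T Q r b \<eta> \<le> content_functional T Q r b \<eta>' + C * (T / real (Suc m) + e)" for m
    proof (rule grid[OF _ e ip])
      have pt: "real k * T / real (Suc m) \<in> {0..T}" if "k \<le> Suc m" for k
        using mult_right_mono[of "real k" "real (Suc m)" T] that T
        by (simp add: field_simps del: of_nat_Suc)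
      show "\<eta> (real k * T / real (Suc m)) $ i \<le> \<eta>' (real k * T / real (Suc m)) $ i + e"
        if "k \<le> Suc m" for k i
        using close[OF pt[OF that], of i] by linarith
      show "\<eta>' (real k * T / real (Suc m)) $ i \<le> \<eta> (real (Suc k) * T / real (Suc m)) $ i + e"
        if "k < Suc m" for k i
      proof -
        have "\<eta> (real k * T / real (Suc m)) $ i \<le> \<eta> (real (Suc k) * T / real (Suc m)) $ i"
          using pt[of k] pt[of "Suc k"] that T
          by (intro input_path_mono[OF ip(1)] divide_right_mono mult_right_mono) auto
        moreover have "\<bar>\<eta> (real k * T / real (Suc m)) $ i - \<eta>' (real k * T / real (Suc m)) $ i\<bar> \<le> e"
          using that by (intro close pt) auto
        ultimately show ?thesis
          by linarith
      qed
    qed simp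
    then show "\<exists>n0. \<forall>m\<ge>n0. content_functional T Q r b \<eta>
        \<le> content_functional T Q r b \<eta>' + C * (T / real (Suc m) + e)"
      by blast
  qed
  show thesis
  proof (rule that[OF C])
    fix e and \<eta> \<eta>' :: "real \<Rightarrow> real^'d"
    assume e: "0 \<le> e" and ip: "input_path T \<eta>" "input_path T \<eta>'"
      and close: "\<And>t i. t \<in> {0..T} \<Longrightarrow> \<bar>\<eta> t $ i - \<eta>' t $ i\<bar> \<le> e"
    have "\<bar>\<eta>' t $ i - \<eta> t $ i\<bar> \<le> e" if "t \<in> {0..T}" for t i
      using close[OF that, of i] by (simp add: abs_minus_commute)
    then show "\<bar>content_functional T Q r b \<eta> - content_functional T Q r b \<eta>'\<bar> \<le> C * e"
      using le[OF e ip close] le[OF e ip(2,1)] by (simp add: abs_le_iff)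
  qed
qed

text \<open>
  An arbitrarily small delay hides a jump at time \<open>T\<close>, so the regulator at \<open>T\<close> does not see it.
\<close>

lemma content_functional_final_jump:
  fixes Q :: "real^'d^'d"
  assumes Q: "routing_matrix Q" and r: "\<And>i. 0 \<le> r $ i" and T: "0 < T" and a: "0 \<le> a"
    and ip: "input_path T \<eta>"
  shows "content_functional T Q r b (\<lambda>t. \<eta> t + (if T \<le> t then a *\<^sub>R axis j 1 else 0)) =
    content_functional T Q r b \<eta> + a * b $ j"
proof -
  let ?\<eta>' = "\<lambda>t. \<eta> t + (if T \<le> t then a *\<^sub>R axis j 1 else 0)"
  let ?reg = "\<lambda>\<eta>. regulator {0..T} Q (net_input Q r \<eta>) T"
  obtain p :: "real^'d" where p: "\<And>i. 0 \<le> p $ i" "\<And>i. 1 \<le> (reflection_matrix Q *v p) $ i"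
    using routing_matrix_ex_superharmonic[OF Q] by blast
  have nn: "0 \<le> \<eta> t $ i" "0 \<le> ?\<eta>' t $ i" if "t \<in> {0..T}" for t i
    using input_path_nonneg[OF ip that, of i] a by (auto simp: axis_def)
  have "?reg ?\<eta>' $ i \<le> ?reg \<eta> $ i + 0 * r $ i + 0 * p $ i" for i
    using nn T a by (intro regulator_le_shift[OF r p]) (auto simp: axis_def)
  moreover have "?reg \<eta> $ i \<le> ?reg ?\<eta>' $ i" for i
  proof (rule field_le_epsilon)
    fix e :: real assume e: "0 < e"
    define d where "d = e / (r $ i + 1)"
    have d: "0 < d" "d * r $ i \<le> e"
      using e r[of i] by (auto simp: d_def field_simps)
    \<comment> \<open>A path delayed by d > 0 has not reached time T, so the delayed
      \<open>?\<eta>'\<close> is the delayed \<eta>, which lies below \<eta> by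
      monotonicity.\<close>
    have "?reg \<eta> $ i \<le> ?reg ?\<eta>' $ i + d * r $ i + 0 * p $ i"
      using nn T a d(1) ip by (intro regulator_le_shift[OF r p]) (auto intro!: input_path_mono)
    with d(2) show "?reg \<eta> $ i \<le> ?reg ?\<eta>' $ i + e"
      by simp
  qed
  ultimately have "?reg ?\<eta>' = ?reg \<eta>"
    by (simp add: vec_eq_iff eq_iff)
  then show ?thesis
    using content_functional_diff[of T Q r b ?\<eta>' \<eta>] by (simp add: inner_axis)
qed

section \<open>Change of time scale and horizon in the reflection map\<close>

lemma D_up_rescale:
  assumes f: "f \<in> D_up {0..}" and k: "0 < k"
  shows "(\<lambda>t. f (k * t) / k) \<in> D_up {0..T}"
proof (rule D_upI)
  have mono: "f s \<le> f t" if "0 \<le> s" "s \<le> t" for s t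
    using f that by (auto intro: D_up_mono)
  show "mono_on {0..T} (\<lambda>t. f (k * t) / k)"
    using k by (intro mono_onI divide_right_mono mono) auto
  show "0 \<le> f (k * 0) / k"
    using f k by (auto simp: D_up_def)
  fix t assume t: "t \<in> {0..T}"
  have "((\<lambda>s. k * s) \<longlongrightarrow> k * t) (at t within ({0..T} \<inter> {t<..}))"
    by (intro tendsto_intros)
  moreover have "\<forall>\<^sub>F s in at t within ({0..T} \<inter> {t<..}). k * s \<in> {0..} \<inter> {k * t<..} \<and> k * s \<noteq> k * t"
    unfolding eventually_at_filter using k by (intro always_eventually) auto
  ultimately have *: "filterlim (\<lambda>s. k * s) (at (k * t) within ({0..} \<inter> {k * t<..}))
      (at t within ({0..T} \<inter> {t<..}))"
    by (auto simp: filterlim_at elim: eventually_mono)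
  have "(f \<longlongrightarrow> f (k * t)) (at (k * t) within ({0..} \<inter> {k * t<..}))"
    using f t k by (auto simp: D_up_def cadlag_on_def)
  from filterlim_compose[OF this *]
  show "((\<lambda>t. f (k * t) / k) \<longlongrightarrow> f (k * t) / k) (at t within ({0..T} \<inter> {t<..}))"
    using k by (intro tendsto_intros) auto
qed

lemma D_up_extend:
  assumes f: "f \<in> D_up {0..T}" and k: "0 < k" and a: "0 \<le> a" and T: "0 \<le> T"
  shows "(\<lambda>s. if s \<le> k * T then k * f (s / k) else k * f T + (s - k * T) * a) \<in> D_up {0..}"
    (is "?g \<in> _")
proof (rule D_upI)
  have mono: "f s \<le> f t" if "0 \<le> s" "s \<le> t" "t \<le> T" for s t
    using f that by (auto intro: D_up_mono)
  show "mono_on {0..} ?g"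
  proof (rule mono_onI)
    fix s t :: real assume st: "s \<in> {0..}" "s \<le> t"
    have "k * f (s / k) \<le> k * f (t / k)" if "t \<le> k * T"
      using that st k by (intro mult_left_mono mono) (auto simp: field_simps divide_right_mono)
    moreover have "k * f (s / k) \<le> k * f T" if "s \<le> k * T"
      using that st k by (intro mult_left_mono mono) (auto simp: field_simps)
    moreover have "s * a \<le> t * a" "k * T < t \<Longrightarrow> k * T * a \<le> t * a"
      using a st by (auto intro!: mult_right_mono)
    ultimately show "?g s \<le> ?g t"
      using st by (auto simp: left_diff_distrib)
  qed
  show "0 \<le> ?g 0"
    using f k T by (auto simp: D_up_def)
  fix t :: real assume t: "t \<in> {0..}"
  show "(?g \<longlongrightarrow> ?g t) (at t within ({0..} \<inter> {t<..}))"
  proof (cases "t < k * T")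
    case True
    have "((\<lambda>s. s / k) \<longlongrightarrow> t / k) (at t within ({0..} \<inter> {t<..}))"
      using k by (intro tendsto_intros) auto
    moreover have ev: "\<forall>\<^sub>F s in at t within ({0..} \<inter> {t<..}). s < k * T \<and> s > t \<and> s \<ge> 0"
      using eventually_nhds_in_open[of "{..<k * T}" t] True unfolding eventually_at_filter
      by (auto elim!: eventually_mono)
    then have "\<forall>\<^sub>F s in at t within ({0..} \<inter> {t<..}). s / k \<in> {0..T} \<inter> {t / k<..} \<and> s / k \<noteq> t / k"
      by eventually_elim (use k t in \<open>auto simp: field_simps divide_less_cancel\<close>)
    ultimately have *: "filterlim (\<lambda>s. s / k) (at (t / k) within ({0..T} \<inter> {t / k<..}))
        (at t within ({0..} \<inter> {t<..}))"
      by (auto simp: filterlim_at elim: eventually_mono)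
    have "(f \<longlongrightarrow> f (t / k)) (at (t / k) within ({0..T} \<inter> {t / k<..}))"
      using f t k True by (auto simp: D_up_def cadlag_on_def field_simps)
    from tendsto_mult[OF tendsto_const filterlim_compose[OF this *], of k]
    have "((\<lambda>s. k * f (s / k)) \<longlongrightarrow> k * f (t / k)) (at t within ({0..} \<inter> {t<..}))" .
    moreover have "\<forall>\<^sub>F s in at t within ({0..} \<inter> {t<..}). k * f (s / k) = ?g s"
      using ev by eventually_elim auto
    ultimately show ?thesis
      using True by (simp add: filterlim_cong[OF refl refl, THEN iffD1, rotated])
  next
    case False
    have "\<forall>\<^sub>F s in at t within ({0..} \<inter> {t<..}). k * f T + (s - k * T) * a = ?g s"
      using False unfolding eventually_at_filter by (intro always_eventually) auto
    moreover have "((\<lambda>s. k * f T + (s - k * T) * a) \<longlongrightarrow> k * f T + (t - k * T) * a)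
        (at t within ({0..} \<inter> {t<..}))"
      by (intro tendsto_intros)
    moreover have "?g t = k * f T + (t - k * T) * a"
      using False k by (cases "t = k * T") auto
    ultimately show ?thesis
      by (simp add: filterlim_cong[OF refl refl, THEN iffD1, rotated])
  qed
qed

text \<open>The model reflects on the whole half-line, the rate function on [0,T]. The regulator at
  time k T sees only the path up to k T: a regulator on the half-line restricts, and one on the
  interval extends with slope r, which cancels the drain while \<eta> does not decrease.\<close>

lemma content_map_rescale:
  fixes Q :: "real^'d^'d" and \<eta> :: "real \<Rightarrow> real^'d"
  assumes r: "\<And>i. 0 \<le> r $ i" and T: "0 < T" and k: "0 < k"
    and mono: "\<And>s t i. 0 \<le> s \<Longrightarrow> s \<le> t \<Longrightarrow> \<eta> s $ i \<le> \<eta> t $ i"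
    and zero: "\<And>i. 0 \<le> \<eta> 0 $ i"
  shows "b \<bullet> ((1 / k) *\<^sub>R content_map {0..} Q (net_input Q r \<eta>) (k * T)) =
    content_functional T Q r b (\<lambda>t. (1 / k) *\<^sub>R \<eta> (k * t))"
proof -
  let ?R = "reflection_matrix Q"
  let ?\<eta>' = "\<lambda>t. (1 / k) *\<^sub>R \<eta> (k * t)"
  have nn: "0 \<le> \<eta> t $ i" if "0 \<le> t" for t i
    using mono[of 0 t i] zero[of i] that by simp
  have "regulator {0..T} Q (net_input Q r ?\<eta>') T $ i
      = (1 / k) * regulator {0..} Q (net_input Q r \<eta>) (k * T) $ i" for i
  proof (rule antisym)
    have "regulator {0..T} Q (net_input Q r ?\<eta>') T $ i
        \<le> (1 / k) * regulator {0..} Q (net_input Q r \<eta>) (k * T) $ i + 0"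
    proof (rule regulator_le_transfer)
      show "regulator_set {0..} Q (net_input Q r \<eta>) \<noteq> {}"
        using regulator_set_nonempty[of r "{0..}" \<eta> Q] r nn by auto
      fix \<zeta> assume \<zeta>: "\<zeta> \<in> regulator_set {0..} Q (net_input Q r \<eta>)"
      have "(\<lambda>t. (1 / k) *\<^sub>R \<zeta> (k * t)) \<in> regulator_set {0..T} Q (net_input Q r ?\<eta>')"
        unfolding regulator_set_def
      proof (intro CollectI conjI allI ballI)
        show "(\<lambda>t. ((1 / k) *\<^sub>R \<zeta> (k * t)) $ i) \<in> D_up {0..T}" for i
          using \<zeta> k D_up_rescale[of "\<lambda>t. \<zeta> t $ i" k T] by (simp add: regulator_set_def)
        fix t assume t: "t \<in> {0..T}"
        have "0 \<le> net_input Q r \<eta> (k * t) + ?R *v \<zeta> (k * t)"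
          using \<zeta> t k by (auto simp: regulator_set_def)
        then have "0 \<le> (1 / k) *\<^sub>R (net_input Q r \<eta> (k * t) + ?R *v \<zeta> (k * t))"
          using k by (simp add: less_eq_vec_def)
        also have "\<dots> = net_input Q r ?\<eta>' t + ?R *v ((1 / k) *\<^sub>R \<zeta> (k * t))"
          using k by (simp add: net_input_def matrix_vector_mult_scaleR scaleR_add_right scaleR_diff_right)
        finally show "0 \<le> net_input Q r ?\<eta>' t + ?R *v ((1 / k) *\<^sub>R \<zeta> (k * t))" .
      qed
      then show "\<exists>\<zeta>'\<in>regulator_set {0..T} Q (net_input Q r ?\<eta>'). \<zeta>' T $ i \<le> 1 / k * \<zeta> (k * T) $ i + 0"
        by (intro bexI[of _ "\<lambda>t. (1 / k) *\<^sub>R \<zeta> (k * t)"]) auto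
    qed (use T k in auto)
    then show "regulator {0..T} Q (net_input Q r ?\<eta>') T $ i
        \<le> (1 / k) * regulator {0..} Q (net_input Q r \<eta>) (k * T) $ i" by simp
    have "regulator {0..} Q (net_input Q r \<eta>) (k * T) $ i
        \<le> k * regulator {0..T} Q (net_input Q r ?\<eta>') T $ i + 0"
    proof (rule regulator_le_transfer)
      show "regulator_set {0..T} Q (net_input Q r ?\<eta>') \<noteq> {}"
        using regulator_set_nonempty[of r "{0..T}" ?\<eta>' Q] r nn k by auto
      fix \<zeta> assume \<zeta>: "\<zeta> \<in> regulator_set {0..T} Q (net_input Q r ?\<eta>')"
      define \<zeta>' where "\<zeta>' s = (if s \<le> k * T then k *\<^sub>R \<zeta> (s / k) else k *\<^sub>R \<zeta> T + (s - k * T) *\<^sub>R r)" for s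
      have "\<zeta>' \<in> regulator_set {0..} Q (net_input Q r \<eta>)"
        unfolding regulator_set_def
      proof (intro CollectI conjI allI ballI)
        fix i
        have "(\<lambda>t. \<zeta>' t $ i) =
            (\<lambda>s. if s \<le> k * T then k * \<zeta> (s / k) $ i else k * \<zeta> T $ i + (s - k * T) * r $ i)"
          by (auto simp: \<zeta>'_def)
        then show "(\<lambda>t. \<zeta>' t $ i) \<in> D_up {0..}"
          using \<zeta> k D_up_extend[of "\<lambda>t. \<zeta> t $ i" T k "r $ i"] r[of i] T
          by (simp add: regulator_set_def)
      next
        fix s :: real assume s: "s \<in> {0..}"
        have feas: "0 \<le> k *\<^sub>R (net_input Q r ?\<eta>' t + ?R *v \<zeta> t)" if "0 \<le> t" "t \<le> T" for t
          using \<zeta> k that by (auto simp: regulator_set_def less_eq_vec_def)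
        show "0 \<le> net_input Q r \<eta> s + ?R *v \<zeta>' s"
        proof (cases "s \<le> k * T")
          case True
          then have "0 \<le> k *\<^sub>R (net_input Q r ?\<eta>' (s / k) + ?R *v \<zeta> (s / k))"
            using s k by (intro feas) (auto simp: field_simps)
          also have "\<dots> = net_input Q r \<eta> s + ?R *v \<zeta>' s"
            using True k by (simp add: \<zeta>'_def net_input_def matrix_vector_mult_scaleR
                scaleR_add_right scaleR_diff_right)
          finally show ?thesis .
        next
          case False
          have "0 \<le> k *\<^sub>R (net_input Q r ?\<eta>' T + ?R *v \<zeta> T)"
            using T by (intro feas) auto
          also have "\<dots> = \<eta> (k * T) - (k * T) *\<^sub>R (?R *v r) + k *\<^sub>R (?R *v \<zeta> T)"
            using k by (simp add: net_input_def scaleR_add_right scaleR_diff_right)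
          also have "\<dots> \<le> net_input Q r \<eta> s + ?R *v \<zeta>' s"
            using False mono[of "k * T" s] k T
            by (simp add: \<zeta>'_def net_input_def matrix_vector_mult_scaleR matrix_vector_right_distrib
                less_eq_vec_def algebra_simps)
          finally show ?thesis .
        qed
      qed
      then show "\<exists>\<zeta>'\<in>regulator_set {0..} Q (net_input Q r \<eta>). \<zeta>' (k * T) $ i \<le> k * \<zeta> T $ i + 0"
        using k by (intro bexI[of _ \<zeta>']) (auto simp: \<zeta>'_def)
    qed (use T k in auto)
    then show "(1 / k) * regulator {0..} Q (net_input Q r \<eta>) (k * T) $ i
        \<le> regulator {0..T} Q (net_input Q r ?\<eta>') T $ i"
      using k by (simp add: field_simps)
  qed
  then have "regulator {0..T} Q (net_input Q r ?\<eta>') T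
      = (1 / k) *\<^sub>R regulator {0..} Q (net_input Q r \<eta>) (k * T)"
    by (simp add: vec_eq_iff)
  then show ?thesis
    using k by (simp add: content_functional_def content_map_def net_input_def
        matrix_vector_mult_scaleR scaleR_add_right scaleR_diff_right)
qed

section \<open>Paths with jumps on a grid\<close>

text \<open>s \<le> s^\<alpha> for s in (0,1], applied to the shares a / (a + b) and b / (a + b),
  which add up to 1.\<close>

lemma powr_subadditive:
  fixes a b \<alpha> :: real
  assumes "0 \<le> a" "0 \<le> b" "\<alpha> \<le> 1"
  shows "(a + b) powr \<alpha> \<le> a powr \<alpha> + b powr \<alpha>"
proof (cases "a + b = 0")
  case False
  then have pos: "0 < a + b"
    using assms by simp
  have *: "(a + b) powr \<alpha> * (x / (a + b)) \<le> x powr \<alpha>" if x: "0 \<le> x" "x \<le> a + b" for x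
  proof (cases "x = 0")
    case False
    with x have "0 < x / (a + b)" "x / (a + b) \<le> 1"
      using pos by auto
    then have "x / (a + b) \<le> (x / (a + b)) powr \<alpha>"
      using powr_mono'[of \<alpha> 1 "x / (a + b)"] assms by (simp del: abs_divide)
    then have "(a + b) powr \<alpha> * (x / (a + b)) \<le> (a + b) powr \<alpha> * (x / (a + b)) powr \<alpha>"
      using \<open>0 < x / (a + b)\<close> by (intro mult_left_mono) auto
    also have "\<dots> = x powr \<alpha>"
      using pos x by (simp add: powr_divide)
    finally show ?thesis .
  qed simp
  have "(a + b) powr \<alpha> = (a + b) powr \<alpha> * (a / (a + b)) + (a + b) powr \<alpha> * (b / (a + b))"
    using pos by (simp add: distrib_left[symmetric] add_divide_distrib[symmetric])
  also have "\<dots> \<le> a powr \<alpha> + b powr \<alpha>"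
    using assms by (intro add_mono *) auto
  finally show ?thesis .
qed (use assms in auto)

lemma powr_sum_subadditive:
  fixes f :: "'a \<Rightarrow> real"
  assumes "\<And>x. x \<in> A \<Longrightarrow> 0 \<le> f x" "\<alpha> \<le> 1"
  shows "(\<Sum>x\<in>A. f x) powr \<alpha> \<le> (\<Sum>x\<in>A. f x powr \<alpha>)"
  using assms(1)
proof (induction A rule: infinite_finite_induct)
  case (insert x A)
  then have "(f x + (\<Sum>x\<in>A. f x)) powr \<alpha> \<le> f x powr \<alpha> + (\<Sum>x\<in>A. f x) powr \<alpha>"
    by (intro powr_subadditive sum_nonneg assms(2)) auto
  with insert show ?case by fastforce
qed auto

text \<open>The jump of cell k sits at the right end of the cell, so the value at grid time k
  contains exactly the cells below k, and the last cell jumps at T. The linear part stands for the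
  mean input.\<close>

definition grid_path :: "real \<Rightarrow> nat \<Rightarrow> real^'d \<Rightarrow> ('d \<Rightarrow> nat \<Rightarrow> real) \<Rightarrow> real \<Rightarrow> real^'d" where
  "grid_path T m \<gamma> x t =
    (\<chi> i. \<gamma> $ i * t + (\<Sum>k<m. x i k * indicator {real (Suc k) * T / real m..} t))"

lemma grid_path_at_grid:
  assumes "0 < T" "0 < m" "k \<le> m"
  shows "grid_path T m \<gamma> x (real k * T / real m) $ i = (\<Sum>l<k. \<gamma> $ i * (T / real m) + x i l)"
proof -
  have "(\<Sum>l<m. x i l * indicator {real (Suc l) * T / real m..} (real k * T / real m)) =
      (\<Sum>l<m. if l \<in> {..<k} then x i l else 0)"
  proof (rule sum.cong[OF refl])
    fix l
    have "real (Suc l) * T / real m \<le> real k * T / real m \<longleftrightarrow> real (Suc l) \<le> real k"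
      using assms by (simp add: divide_le_cancel del: of_nat_Suc)
    then show "x i l * indicator {real (Suc l) * T / real m..} (real k * T / real m) =
        (if l \<in> {..<k} then x i l else 0)"
      by (auto simp: indicator_def simp del: of_nat_Suc)
  qed
  also have "\<dots> = (\<Sum>l\<in>{..<m} \<inter> {..<k}. x i l)"
    by (simp add: sum.inter_restrict)
  also have "{..<m} \<inter> {..<k} = {..<k}"
    using assms by auto
  finally show ?thesis
    by (simp add: grid_path_def sum.distrib algebra_simps)
qed

lemma indicator_atLeast_mono: "s \<le> t \<Longrightarrow> indicator {u..} s \<le> (indicator {u..} t :: real)"
  for s t u :: real
  by (auto simp: indicator_def)

lemma grid_path_input_path:
  assumes "\<And>i. 0 \<le> \<gamma> $ i" "\<And>i k. 0 \<le> x i k" "0 < T"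
  shows "input_path T (grid_path T m \<gamma> x)"
  unfolding input_path_def grid_path_def vec_lambda_beta using assms
  by (intro allI conjI mono_onI add_mono mult_left_mono sum_mono indicator_atLeast_mono
      add_nonneg_nonneg mult_nonneg_nonneg sum_nonneg) auto

lemma tendsto_indicator_right:
  "((indicator {u..} :: real \<Rightarrow> real) \<longlongrightarrow> indicator {u..} t) (at t within (S \<inter> {t<..}))"
proof (rule tendsto_eventually, cases "u \<le> t")
  case True
  then show "\<forall>\<^sub>F s in at t within (S \<inter> {t<..}). (indicator {u..} s :: real) = indicator {u..} t"
    unfolding eventually_at_filter by (intro always_eventually) (auto simp: indicator_def)
next
  case False
  then show "\<forall>\<^sub>F s in at t within (S \<inter> {t<..}). (indicator {u..} s :: real) = indicator {u..} t"
    using eventually_nhds_in_open[of "{..<u}" t] unfolding eventually_at_filter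
    by (auto elim!: eventually_mono simp: indicator_def)
qed

lemma tendsto_indicator_left:
  "((indicator {u..} :: real \<Rightarrow> real) \<longlongrightarrow> indicator {u<..} t) (at_left t)"
proof (rule tendsto_eventually, cases "t \<le> u")
  case True
  then show "\<forall>\<^sub>F s in at_left t. (indicator {u..} s :: real) = indicator {u<..} t"
    unfolding eventually_at_filter by (intro always_eventually) (auto simp: indicator_def)
next
  case False
  then show "\<forall>\<^sub>F s in at_left t. (indicator {u..} s :: real) = indicator {u<..} t"
    using eventually_nhds_in_open[of "{u<..}" t] unfolding eventually_at_filter
    by (auto elim!: eventually_mono simp: indicator_def)
qed

lemma finite_jumps_D_jump:
  assumes T: "0 < T" and m: "0 < m" and x: "\<And>k. 0 \<le> x k"
  shows "(\<lambda>t. \<Sum>k<m. x k * indicator {real (Suc k) * T / real m..} t) \<in> D_jump T"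
    (is "?S \<in> _")
proof -
  \<comment> \<open>\<open>D_jump\<close> asks for an infinite sequence of distinct times. The
    surplus indices get jumps of size 0 at times before the first grid time; j + 2 keeps them
    strictly inside the first cell.\<close>
  define u where "u j = (if j < m then real (Suc j) * T / real m else T / real m / real (j + 2))" for j
  define y where "y j = (if j < m then x j else 0)" for j
  have small: "0 < T / real m / real (j + 2)" "T / real m / real (j + 2) < T / real m" for j
  proof -
    have D: "0 < T / real m"
      using T m by simp
    then show "0 < T / real m / real (j + 2)"
      by (rule divide_pos_pos) simp
    have "T / real m / real (j + 2) < T / real m / 1"
      using D by (intro divide_strict_left_mono) auto
    then show "T / real m / real (j + 2) < T / real m"
      by simp
  qed
  have large: "T / real m \<le> real (Suc j) * T / real m" for j
    using T m by (auto simp: field_simps)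
  have "inj u"
  proof (rule injI)
    fix j k assume eq: "u j = u k"
    consider "j < m" "k < m" | "j \<ge> m" "k \<ge> m" | "j < m" "k \<ge> m" | "j \<ge> m" "k < m"
      by linarith
    then show "j = k"
    proof cases
      case 3
      with eq small[of k] large[of j] show ?thesis by (simp add: u_def)
    next
      case 4
      with eq small[of j] large[of k] show ?thesis by (simp add: u_def)
    qed (use eq T m in \<open>auto simp: u_def field_simps\<close>)
  qed
  moreover have "range u \<subseteq> {0..T}"
  proof safe
    fix j
    have "T / real m \<le> T"
      using T m by (simp add: field_simps)
    moreover have "real (Suc j) * T / real m \<le> T" if "j < m"
    proof -
      have "real (Suc j) * T \<le> real m * T"
        using that T by (intro mult_right_mono) auto
      then show ?thesis
        using m by (simp add: field_simps)
    qed
    ultimately show "u j \<in> {0..T}"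
      using small[of j] large[of j] T m by (auto simp: u_def simp del: of_nat_Suc)
  qed
  moreover have "(\<lambda>j. y j * indicator {u j..T} t) sums ?S t" if "t \<in> {0..T}" for t
  proof -
    have "(\<lambda>j. y j * indicator {u j..T} t) sums (\<Sum>j<m. y j * indicator {u j..T} t)"
      by (rule sums_finite) (auto simp: y_def)
    also have "(\<Sum>j<m. y j * indicator {u j..T} t) = ?S t"
      using that by (intro sum.cong) (auto simp: y_def u_def indicator_def)
    finally show ?thesis .
  qed
  moreover have "0 \<le> y j" for j
    using x by (simp add: y_def)
  moreover have "?S \<in> D_up {0..T}"
    by (rule D_upI)
      (intro mono_onI sum_mono mult_left_mono x indicator_atLeast_mono sum_nonneg mult_nonneg_nonneg
        tendsto_sum tendsto_mult tendsto_const tendsto_indicator_right; simp)+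
  ultimately show ?thesis
    unfolding D_jump_def by blast
qed

lemma grid_path_D_jump_drift:
  assumes "0 < T" "0 < m" "\<And>i k. 0 \<le> x i k"
  shows "(\<lambda>t. net_input Q r (grid_path T m \<gamma> x) t $ i)
    \<in> D_jump_drift T ((\<gamma> - reflection_matrix Q *v r) $ i)"
  unfolding D_jump_drift_def
proof (intro CollectI exI conjI)
  show "(\<lambda>t. \<Sum>k<m. x i k * indicator {real (Suc k) * T / real m..} t) \<in> D_jump T"
    using assms by (intro finite_jumps_D_jump)
qed (auto simp: net_input_def grid_path_def algebra_simps)

lemma left_value_eqI:
  assumes "0 < t" "(\<xi> \<longlongrightarrow> l) (at_left t)"
  shows "left_value \<xi> t = l"
  using assms by (simp add: left_value_def tendsto_Lim)

lemma jump_cost_grid_path: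
  assumes T: "0 < T" and m: "0 < m"
  shows "jump_cost T \<alpha> (\<lambda>t. net_input Q r (grid_path T m \<gamma> x) t $ i)
    \<le> ereal (\<Sum>k<m. x i k powr \<alpha>)"
proof -
  define \<xi> where "\<xi> = (\<lambda>t. net_input Q r (grid_path T m \<gamma> x) t $ i)"
  define u where "u k = real (Suc k) * T / real m" for k
  have u_pos: "0 < u k" for k
    using T m by (simp add: u_def)
  have u_inj: "inj u"
    using T m by (auto intro!: injI simp: u_def)
  have \<xi>_eq: "\<xi> t = (\<Sum>k<m. x i k * indicator {u k..} t) + (\<gamma> - reflection_matrix Q *v r) $ i * t" for t
    by (simp add: \<xi>_def net_input_def grid_path_def u_def algebra_simps)
  have jump: "\<xi> t - left_value \<xi> t = (\<Sum>k<m. if u k = t then x i k else 0)" if t: "0 \<le> t" for t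
  proof (cases "t = 0")
    case True
    have "u k \<noteq> 0" "indicator {u k..} 0 = (0 :: real)" for k
      using u_pos[of k] by auto
    with True show ?thesis
      by (simp add: left_value_def \<xi>_eq)
  next
    case False
    \<comment> \<open>Passing to the left limit opens the half-lines at their left end; the
      difference of the two indicators singles out the jumps at t.\<close>
    have "((\<lambda>t. (\<Sum>k<m. x i k * indicator {u k..} t) + (\<gamma> - reflection_matrix Q *v r) $ i * t) \<longlongrightarrow>
        (\<Sum>k<m. x i k * indicator {u k<..} t) + (\<gamma> - reflection_matrix Q *v r) $ i * t) (at_left t)"
      by (intro tendsto_intros tendsto_indicator_left)
    then have "left_value \<xi> t =
        (\<Sum>k<m. x i k * indicator {u k<..} t) + (\<gamma> - reflection_matrix Q *v r) $ i * t"
      using t False by (intro left_value_eqI) (auto simp: \<xi>_eq[abs_def])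
    then have "\<xi> t - left_value \<xi> t =
        (\<Sum>k<m. x i k * indicator {u k..} t - x i k * indicator {u k<..} t)"
      unfolding \<xi>_eq by (simp add: sum_subtractf)
    also have "\<dots> = (\<Sum>k<m. if u k = t then x i k else 0)"
      by (intro sum.cong) (auto simp: indicator_def)
    finally show ?thesis .
  qed
  have jump_u: "\<xi> (u k) - left_value \<xi> (u k) = x i k" if "k < m" for k
  proof -
    have "\<xi> (u k) - left_value \<xi> (u k) = (\<Sum>l<m. if u l = u k then x i l else 0)"
      using u_pos[of k] by (intro jump) simp
    also have "\<dots> = (\<Sum>l<m. if l = k then x i l else 0)"
      using u_inj by (intro sum.cong) (auto dest: injD)
    finally show ?thesis
      using that by simp
  qed
  let ?A = "{t \<in> {0..T}. \<xi> t \<noteq> left_value \<xi> t}"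
  have sub: "?A \<subseteq> u ` {..<m}"
  proof
    fix t assume t: "t \<in> ?A"
    show "t \<in> u ` {..<m}"
    proof (rule ccontr)
      assume "t \<notin> u ` {..<m}"
      then have "(\<Sum>k<m. if u k = t then x i k else 0) = 0"
        by (intro sum.neutral) auto
      with jump[of t] t show False by auto
    qed
  qed
  then have "finite ?A"
    by (rule finite_subset) simp
  then have "jump_cost T \<alpha> \<xi> = (\<Sum>t\<in>?A. ereal ((\<xi> t - left_value \<xi> t) powr \<alpha>))"
    by (simp add: jump_cost_def)
  also have "\<dots> = ereal (\<Sum>t\<in>?A. (\<xi> t - left_value \<xi> t) powr \<alpha>)"
    by simp
  also have "(\<Sum>t\<in>?A. (\<xi> t - left_value \<xi> t) powr \<alpha>)
      \<le> (\<Sum>t\<in>u ` {..<m}. (\<xi> t - left_value \<xi> t) powr \<alpha>)"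
    using sub by (intro sum_mono2) auto
  also have "\<dots> = (\<Sum>k<m. (\<xi> (u k) - left_value \<xi> (u k)) powr \<alpha>)"
    using u_inj by (subst sum.reindex) (auto intro: inj_on_subset)
  also have "\<dots> = (\<Sum>k<m. x i k powr \<alpha>)"
    using jump_u by (intro sum.cong) auto
  finally show ?thesis
    by (simp add: \<xi>_def)
qed

lemma at_within_Icc_left:
  fixes t T :: real
  assumes "0 < t" "t \<le> T"
  shows "at t within ({0..T} \<inter> {..<t}) = at_left t"
  using assms by (intro at_within_nhd[of t "{0<..}"]) auto

text \<open>Every jump belongs to exactly one cell, so d k is the sum of the jumps in cell k, and
  subadditivity compares its cost with theirs. Dropping the value at 0 for k = 0 counts a jump at
  time 0 in the first cell, in line with the convention in \<open>left_value\<close>.\<close>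

lemma jump_cost_ge_increments:
  fixes \<xi> :: "real \<Rightarrow> real"
  assumes \<xi>: "\<xi> \<in> D_jump_drift T \<beta>" and T: "0 < T" and m: "0 < m" and \<alpha>: "0 < \<alpha>" "\<alpha> < 1"
  defines "d \<equiv> \<lambda>k. \<xi> (real (Suc k) * T / real m)
    - (if k = 0 then 0 else \<xi> (real k * T / real m)) - \<beta> * (T / real m)"
  shows "k < m \<Longrightarrow> 0 \<le> d k" and "ereal (\<Sum>k<m. d k powr \<alpha>) \<le> jump_cost T \<alpha> \<xi>"
proof -
  obtain h and x u :: "nat \<Rightarrow> real" where h: "h \<in> D_up {0..T}" and \<xi>_eq: "\<xi> = (\<lambda>t. h t + \<beta> * t)"
    and x: "\<And>j. 0 \<le> x j" and u: "inj u" "range u \<subseteq> {0..T}"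
    and sums: "\<And>t. t \<in> {0..T} \<Longrightarrow> (\<lambda>j. x j * indicator {u j..T} t) sums h t"
    using \<xi> unfolding D_jump_drift_def D_jump_def by blast
  have grid: "real k * T / real m \<in> {0..T}" if "k \<le> m" for k
  proof -
    have "real k * T \<le> real m * T"
      using that T by (intro mult_right_mono) auto
    then show ?thesis
      using T m by (simp add: field_simps)
  qed
  \<comment> \<open>g records whether jump j has occurred by grid time k, with 0 for k = 0 so that a
    jump at time 0 falls into the first cell; c then marks the cell of jump j.\<close>
  define g where "g j k = (if k = 0 then 0 else indicator {u j..T} (real k * T / real m) :: real)" for j k
  define c where "c j k = g j (Suc k) - g j k" for j k
  have uT: "0 \<le> u j" "u j \<le> T" for j
    using subsetD[OF u(2) rangeI[of u j]] by auto
  have c01: "c j k \<in> {0, 1}" if "k < m" for j k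
    using grid[of k] grid[of "Suc k"] that T m uT[of j]
    by (auto simp: c_def g_def indicator_def field_simps)
  have c_nonneg: "0 \<le> c j k" if "k < m" for j k
    using c01[OF that, of j] by auto
  have c_sum: "(\<Sum>k<m. c j k) = 1" for j
  proof -
    have "(\<Sum>k<m. c j k) = g j m - g j 0"
      unfolding c_def by (rule sum_lessThan_telescope)
    then show ?thesis
      using m uT[of j] by (simp add: g_def indicator_def)
  qed
  have d_lim: "(\<lambda>n. \<Sum>j<n. x j * c j k) \<longlonglongrightarrow> d k" if k: "k < m" for k
  proof -
    have "(\<lambda>j. x j * indicator {u j..T} (real (Suc k) * T / real m)) sums h (real (Suc k) * T / real m)"
      using k by (intro sums grid) auto
    moreover have "(\<lambda>j. x j * g j k) sums (if k = 0 then 0 else h (real k * T / real m))"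
      using sums[OF grid[of k]] k by (auto simp: g_def)
    ultimately have "(\<lambda>j. x j * indicator {u j..T} (real (Suc k) * T / real m) - x j * g j k) sums
      (h (real (Suc k) * T / real m) - (if k = 0 then 0 else h (real k * T / real m)))"
      by (rule sums_diff)
    also have "(h (real (Suc k) * T / real m) - (if k = 0 then 0 else h (real k * T / real m))) = d k"
      by (simp add: d_def \<xi>_eq algebra_simps add_divide_distrib)
    also have "(\<lambda>j. x j * indicator {u j..T} (real (Suc k) * T / real m) - x j * g j k) =
        (\<lambda>j. x j * c j k)"
      by (simp add: c_def g_def right_diff_distrib)
    finally show ?thesis
      by (simp add: sums_def)
  qed
  have nonneg: "0 \<le> (\<Sum>j<n. x j * c j k)" if "k < m" for n k
    using c_nonneg[OF that] x by (intro sum_nonneg mult_nonneg_nonneg) auto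
  show "0 \<le> d k" if "k < m" for k
    using d_lim[OF that] nonneg[OF that] by (intro LIMSEQ_le_const[OF d_lim[OF that]]) auto
  \<comment> \<open>All terms are nonnegative, so it suffices to keep term j: up to the drift, the
    path before \<open>u j\<close> stays at least \<open>x j\<close> below its value there.\<close>
  have jump: "x j \<le> \<xi> (u j) - left_value \<xi> (u j)" for j
  proof (cases "u j = 0")
    case True
    have "sum (\<lambda>i. x i * indicator {u i..T} 0) {j} \<le> h 0"
      using sums[of 0] T x sum_le_suminf[of "\<lambda>i. x i * indicator {u i..T} 0" "{j}"]
      by (auto simp: sums_iff)
    with True T show ?thesis
      by (simp add: left_value_def \<xi>_eq)
  next
    case False
    then have uj: "0 < u j" "u j \<le> T"
      using uT[of j] by auto
    have "\<exists>l. (h \<longlongrightarrow> l) (at (u j) within ({0..T} \<inter> {..<u j}))"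
      using h uj by (simp add: D_up_def cadlag_on_def)
    then obtain l where "(h \<longlongrightarrow> l) (at_left (u j))"
      unfolding at_within_Icc_left[OF uj] by blast
    then have lim: "(\<xi> \<longlongrightarrow> l + \<beta> * u j) (at_left (u j))"
      unfolding \<xi>_eq by (intro tendsto_intros)
    have le: "h s \<le> h (u j) - x j" if s: "0 \<le> s" "s < u j" for s
    proof -
      have "(\<lambda>i. x i * indicator {u i..T} (u j) - x i * indicator {u i..T} s) sums (h (u j) - h s)"
        using s uj by (intro sums_diff sums) auto
      moreover have "0 \<le> x i * indicator {u i..T} (u j) - x i * indicator {u i..T} s" for i
        using s uj x by (auto simp: indicator_def)
      ultimately have "sum (\<lambda>i. x i * indicator {u i..T} (u j) - x i * indicator {u i..T} s) {j}
          \<le> h (u j) - h s"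
        unfolding sums_iff
        using sum_le_suminf[of "\<lambda>i. x i * indicator {u i..T} (u j) - x i * indicator {u i..T} s" "{j}"]
        by simp
      with s uj show ?thesis
        by (simp add: indicator_def)
    qed
    have "l + \<beta> * u j \<le> h (u j) - x j + \<beta> * u j"
    proof (rule tendsto_le[OF _ _ lim])
      show "((\<lambda>s. h (u j) - x j + \<beta> * s) \<longlongrightarrow> h (u j) - x j + \<beta> * u j) (at_left (u j))"
        by (intro tendsto_intros)
      show "\<forall>\<^sub>F s in at_left (u j). \<xi> s \<le> h (u j) - x j + \<beta> * s"
        unfolding eventually_at_filter
        using eventually_nhds_in_open[of "{0<..}" "u j"] uj le
        by (auto elim!: eventually_mono simp: \<xi>_eq)
    qed simp
    with left_value_eqI[OF uj(1) lim] show ?thesis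
      by (simp add: \<xi>_eq)
  qed
  have partial: "ereal (\<Sum>j<n. x j powr \<alpha>) \<le> jump_cost T \<alpha> \<xi>" for n
  proof -
    let ?A = "{t \<in> {0..T}. \<xi> t \<noteq> left_value \<xi> t}"
    \<comment> \<open>Terms of size 0 are discarded, since their times need not be discontinuities
      of \<xi>.\<close>
    let ?B = "{j. j < n \<and> 0 < x j}"
    have sub: "u ` ?B \<subseteq> ?A"
    proof safe
      fix j assume "0 < x j"
      with jump[of j] show "u j \<in> {0..T}" "\<xi> (u j) = left_value \<xi> (u j) \<Longrightarrow> False"
        using uT[of j] by auto
    qed
    have "(\<Sum>j<n. x j powr \<alpha>) = (\<Sum>j\<in>?B. x j powr \<alpha>)"
      using x by (intro sum.mono_neutral_right) (auto simp: order_less_le)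
    also have "\<dots> \<le> (\<Sum>j\<in>?B. (\<xi> (u j) - left_value \<xi> (u j)) powr \<alpha>)"
      using jump x \<alpha> by (intro sum_mono powr_mono2) auto
    also have "\<dots> = (\<Sum>t\<in>u ` ?B. (\<xi> t - left_value \<xi> t) powr \<alpha>)"
      using u(1) by (subst sum.reindex) (auto intro: inj_on_subset)
    finally have "ereal (\<Sum>j<n. x j powr \<alpha>) \<le> (\<Sum>t\<in>u ` ?B. ereal ((\<xi> t - left_value \<xi> t) powr \<alpha>))"
      by simp
    also have "\<dots> \<le> jump_cost T \<alpha> \<xi>"
      unfolding jump_cost_def
      by (subst nonneg_infsum_complete) (use sub in \<open>auto intro!: SUP_upper\<close>)
    finally show ?thesis .
  qed
  show "ereal (\<Sum>k<m. d k powr \<alpha>) \<le> jump_cost T \<alpha> \<xi>"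
  \<comment> \<open>Subadditivity is applied to finite partial sums and then passed to the limit,
    with a finite real bound; an infinite cost is trivial.\<close>
  proof (cases "jump_cost T \<alpha> \<xi>")
    case (real C)
    have "(\<Sum>k<m. d k powr \<alpha>) \<le> C"
    proof (rule LIMSEQ_le_const2)
      show "(\<lambda>n. \<Sum>k<m. (\<Sum>j<n. x j * c j k) powr \<alpha>) \<longlonglongrightarrow> (\<Sum>k<m. d k powr \<alpha>)"
        using \<alpha> d_lim nonneg by (intro tendsto_sum tendsto_powr') auto
      have "(\<Sum>k<m. (\<Sum>j<n. x j * c j k) powr \<alpha>) \<le> C" for n
      proof -
        have "(\<Sum>k<m. (\<Sum>j<n. x j * c j k) powr \<alpha>) \<le> (\<Sum>k<m. \<Sum>j<n. (x j * c j k) powr \<alpha>)"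
          using c_nonneg x \<alpha> by (intro sum_mono powr_sum_subadditive mult_nonneg_nonneg) auto
        also have "\<dots> = (\<Sum>k<m. \<Sum>j<n. x j powr \<alpha> * c j k)"
        proof (intro sum.cong refl)
          fix k j assume "k \<in> {..<m}"
          then have "c j k = 0 \<or> c j k = 1"
            using c01[of k j] by auto
          then show "(x j * c j k) powr \<alpha> = x j powr \<alpha> * c j k"
            by auto
        qed
        also have "\<dots> = (\<Sum>j<n. x j powr \<alpha> * (\<Sum>k<m. c j k))"
          by (subst sum.swap) (simp add: sum_distrib_left)
        also have "\<dots> \<le> C"
          using partial[of n] real by (simp add: c_sum)
        finally show ?thesis .
      qed
      then show "\<exists>N. \<forall>n\<ge>N. (\<Sum>k<m. (\<Sum>j<n. x j * c j k) powr \<alpha>) \<le> C"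
        by blast
    qed
    with real show ?thesis by simp
  next
    case MInf
    with partial[of 0] show ?thesis by simp
  qed simp
qed

section \<open>Semiexponential rates\<close>

text \<open>Elementary substitute for the Potter bounds of regular variation: n doublings multiply f
  by at least \<rho>^n, which is a power of x with exponent \<open>log 2 \<rho>\<close>. The
  denominator of C covers the base interval from x1 to 2 x1.\<close>

lemma doubling_growth:
  fixes f :: "real \<Rightarrow> real"
  assumes x1: "0 < x1" and \<rho>: "1 < \<rho>" and pos: "\<And>x. x1 \<le> x \<Longrightarrow> 0 < f x"
    and mono: "\<And>x y. x1 \<le> x \<Longrightarrow> x \<le> y \<Longrightarrow> f x \<le> f y"
    and doubling: "\<And>x. x1 \<le> x \<Longrightarrow> \<rho> * f x \<le> f (2 * x)"
  obtains C \<beta> where "0 < C" "0 < \<beta>" "\<And>x. x1 \<le> x \<Longrightarrow> C * x powr \<beta> \<le> f x"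
proof -
  define \<beta> where "\<beta> = log 2 \<rho>"
  define C where "C = f x1 / (2 * x1) powr \<beta>"
  have \<beta>: "0 < \<beta>" "2 powr \<beta> = \<rho>"
    using \<rho> by (simp_all add: \<beta>_def)
  have C: "0 < C"
    using pos[of x1] x1 by (simp add: C_def)
  have base: "C * x powr \<beta> \<le> f x" if x: "x1 \<le> x" "x \<le> 2 * x1" for x
  proof -
    have "C * x powr \<beta> \<le> C * (2 * x1) powr \<beta>"
      using C \<beta> x x1 by (intro mult_left_mono powr_mono2) auto
    also have "\<dots> = f x1"
      using x1 by (simp add: C_def)
    also have "\<dots> \<le> f x"
      using x by (intro mono) auto
    finally show ?thesis .
  qed
  have "C * x powr \<beta> \<le> f x" if "x1 \<le> x" "x \<le> 2 ^ n * x1" for n x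
    using that
  proof (induction n arbitrary: x)
    case 0
    then show ?case using base[of x] x1 by simp
  next
    case (Suc n)
    show ?case
    proof (cases "x \<le> 2 * x1")
      case False
      have "C * x powr \<beta> = \<rho> * (C * (x / 2) powr \<beta>)"
        using x1 Suc.prems by (simp add: powr_divide \<beta>(2)) (use \<rho> in simp)
      also have "\<dots> \<le> \<rho> * f (x / 2)"
        using False Suc.prems \<rho> by (intro mult_left_mono Suc.IH) auto
      also have "\<dots> \<le> f x"
        using doubling[of "x / 2"] False by simp
      finally show ?thesis .
    qed (use base Suc in auto)
  qed
  moreover have "\<exists>n. x \<le> 2 ^ n * x1" for x
  proof -
    obtain n where "x / x1 < 2 ^ n"
      using real_arch_pow[of 2 "x / x1"] by auto
    then show ?thesis
      using x1 by (intro exI[of _ n]) (simp add: field_simps)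
  qed
  ultimately show thesis
    using C \<beta> by (intro that[of C \<beta>]) blast+
qed

text \<open>q abstracts L(x) x^\<alpha>. Slow variation and the power appear jointly as
  \<open>q_scale\<close>; monotonicity and nonnegativity on the whole half-line come from the jump
  tail, of which q is minus the logarithm up to a factor.\<close>

locale semiexponential_rate =
  fixes q :: "real \<Rightarrow> real" and \<alpha> :: real
  assumes \<alpha>: "0 < \<alpha>" "\<alpha> < 1"
    and q_mono: "0 \<le> x \<Longrightarrow> x \<le> y \<Longrightarrow> q x \<le> q y"
    and q_nonneg: "0 \<le> x \<Longrightarrow> 0 \<le> q x"
    and q_pos: "\<forall>\<^sub>F x in at_top. 0 < q x"
    and q_ratio_antimono: "\<exists>x0>0. \<forall>x y. x0 \<le> x \<longrightarrow> x \<le> y \<longrightarrow> q y / y \<le> q x / x"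
    and q_scale: "0 < a \<Longrightarrow> ((\<lambda>x. q (a * x) / q x) \<longlongrightarrow> a powr \<alpha>) at_top"
begin

lemma q_growth:
  obtains C \<beta> x1 where "0 < C" "0 < \<beta>" "0 < x1" "\<And>x. x1 \<le> x \<Longrightarrow> C * x powr \<beta> \<le> q x"
proof -
  define \<rho> where "\<rho> = (1 + 2 powr \<alpha>) / 2"
  have \<rho>: "1 < \<rho>" "\<rho> < 2 powr \<alpha>"
    using \<alpha> by (simp_all add: \<rho>_def)
  have "\<forall>\<^sub>F x in at_top. \<rho> < q (2 * x) / q x \<and> 0 < q x \<and> 0 < x"
    using \<rho>(2) q_pos by (intro eventually_conj order_tendstoD(1)[OF q_scale] eventually_gt_at_top) auto
  then obtain x1 where x1: "\<And>x. x1 \<le> x \<Longrightarrow> \<rho> < q (2 * x) / q x \<and> 0 < q x \<and> 0 < x"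
    by (auto simp: eventually_at_top_linorder)
  have "\<rho> * q x \<le> q (2 * x)" if "x1 \<le> x" for x
    using x1[OF that] pos_less_divide_eq[of "q x" \<rho> "q (2 * x)"] by linarith
  moreover have "q x \<le> q y" if "x1 \<le> x" "x \<le> y" for x y
    using x1[OF that(1)] that by (intro q_mono) auto
  ultimately obtain C \<beta> where "0 < C" "0 < \<beta>" "\<And>x. x1 \<le> x \<Longrightarrow> C * x powr \<beta> \<le> q x"
    using x1 \<rho> by (elim doubling_growth[of x1 \<rho> q, rotated -1]) auto
  then show thesis
    using x1[of x1] by (intro that[of C \<beta> x1]) auto
qed

text \<open>x / q x gains in the limit a factor 2^(1-\<alpha>) > 1 per doubling and is eventually
  nondecreasing by \<open>q_ratio_antimono\<close>, so the doubling argument applies to it as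
  well.\<close>

lemma q_sublinear_growth:
  obtains C \<beta> x1 where "0 < C" "0 < \<beta>" "0 < x1" "\<And>x. x1 \<le> x \<Longrightarrow> C * x powr \<beta> \<le> x / q x"
proof -
  define \<rho> where "\<rho> = (1 + 2 powr (1 - \<alpha>)) / 2"
  have \<rho>: "1 < \<rho>" "\<rho> < 2 powr (1 - \<alpha>)"
    using \<alpha> by (simp_all add: \<rho>_def)
  then have "2 / \<rho> > 2 powr \<alpha>"
    by (simp add: field_simps powr_diff)
  then have "\<forall>\<^sub>F x in at_top. q (2 * x) / q x < 2 / \<rho>"
    using q_scale[of 2] by (intro order_tendstoD(2)) auto
  moreover obtain x0 where x0: "0 < x0" "\<And>x y. x0 \<le> x \<Longrightarrow> x \<le> y \<Longrightarrow> q y / y \<le> q x / x"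
    using q_ratio_antimono by blast
  ultimately have "\<forall>\<^sub>F x in at_top. q (2 * x) / q x < 2 / \<rho> \<and> 0 < q x \<and> x0 \<le> x"
    using q_pos by (intro eventually_conj eventually_ge_at_top) auto
  then obtain x1 where x1: "\<And>x. x1 \<le> x \<Longrightarrow> q (2 * x) / q x < 2 / \<rho> \<and> 0 < q x \<and> x0 \<le> x"
    by (auto simp: eventually_at_top_linorder)
  have x1_pos: "0 < x1"
    using x0 x1[of x1] by auto
  have "\<rho> * (x / q x) \<le> (2 * x) / q (2 * x)" if x: "x1 \<le> x" for x
  proof -
    have "0 < q (2 * x)" "0 < q x" "q (2 * x) / q x < 2 / \<rho>"
      using x1[of x] x1[of "2 * x"] x x1_pos by auto
    then show ?thesis
      using x x1_pos \<rho> by (simp add: field_simps)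
  qed
  moreover have "x / q x \<le> y / q y" if "x1 \<le> x" "x \<le> y" for x y
    using x1[of x] x1[of y] x0(2)[of x y] that x1_pos by (simp add: field_simps)
  moreover have "0 < x / q x" if "x1 \<le> x" for x
    using x1[of x] that x1_pos by simp
  ultimately obtain C \<beta> where "0 < C" "0 < \<beta>" "\<And>x. x1 \<le> x \<Longrightarrow> C * x powr \<beta> \<le> x / q x"
    using x1_pos \<rho> by (elim doubling_growth[of x1 \<rho> "\<lambda>x. x / q x", rotated -1]) auto
  then show thesis
    using x1_pos by (intro that[of C \<beta> x1]) auto
qed

text \<open>The logarithm stands for the number of jumps up to a time of order n, which is thereby
  harmless on the scale q. The same comparison absorbs a factor Y into a weight exp(b c
  q(Y)).\<close>

lemma filterlim_q_over_ln: "filterlim (\<lambda>x. q x / ln x) at_top at_top"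
proof -
  obtain C \<beta> x1 where *: "0 < C" "0 < \<beta>" "0 < x1" "\<And>x. x1 \<le> x \<Longrightarrow> C * x powr \<beta> \<le> q x"
    using q_growth by blast
  have "filterlim (\<lambda>x. C * x powr \<beta> / ln x) at_top at_top"
    using * by real_asymp
  moreover have "\<forall>\<^sub>F x in at_top. C * x powr \<beta> / ln x \<le> q x / ln x"
    using eventually_gt_at_top[of 1] eventually_ge_at_top[of x1]
    by eventually_elim (auto intro!: divide_right_mono *)
  ultimately show ?thesis
    by (rule filterlim_at_top_mono)
qed

lemma filterlim_q: "filterlim q at_top at_top"
proof -
  obtain C \<beta> x1 where *: "0 < C" "0 < \<beta>" "0 < x1" "\<And>x. x1 \<le> x \<Longrightarrow> C * x powr \<beta> \<le> q x"
    using q_growth by blast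
  have "filterlim (\<lambda>x. C * x powr \<beta>) at_top at_top"
    using * by real_asymp
  moreover have "\<forall>\<^sub>F x in at_top. C * x powr \<beta> \<le> q x"
    using eventually_ge_at_top[of x1] by eventually_elim (auto intro!: *)
  ultimately show ?thesis
    by (rule filterlim_at_top_mono)
qed

text \<open>Events whose probability decays exponentially in n are negligible on the scale q, and
  the Chernoff parameters q(B) / B tend to 0.\<close>

lemma filterlim_over_q: "filterlim (\<lambda>x. x / q x) at_top at_top"
proof -
  obtain C \<beta> x1 where *: "0 < C" "0 < \<beta>" "0 < x1" "\<And>x. x1 \<le> x \<Longrightarrow> C * x powr \<beta> \<le> x / q x"
    using q_sublinear_growth by blast
  have "filterlim (\<lambda>x. C * x powr \<beta>) at_top at_top"
    using * by real_asymp
  moreover have "\<forall>\<^sub>F x in at_top. C * x powr \<beta> \<le> x / q x"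
    using eventually_ge_at_top[of x1] by eventually_elim (auto intro!: *)
  ultimately show ?thesis
    by (rule filterlim_at_top_mono)
qed

end

section \<open>Compound Poisson processes\<close>

text \<open>Conditioning on X, written as Fubini on a single space: the second copy \<omega>'
  integrates Y with X frozen.\<close>

lemma (in prob_space) indep_var_nn_integral_iterated:
  assumes indep: "indep_var S X T Y" and [measurable]: "g \<in> borel_measurable (S \<Otimes>\<^sub>M T)"
  shows "(\<integral>\<^sup>+\<omega>. g (X \<omega>, Y \<omega>) \<partial>M) = (\<integral>\<^sup>+\<omega>. (\<integral>\<^sup>+\<omega>'. g (X \<omega>, Y \<omega>') \<partial>M) \<partial>M)"
proof -
  have [measurable]: "X \<in> measurable M S" "Y \<in> measurable M T"
    using indep by (auto dest: indep_var_rv1 indep_var_rv2)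
  interpret DY: prob_space "distr M T Y"
    by (rule prob_space_distr) simp
  have "(\<integral>\<^sup>+\<omega>. g (X \<omega>, Y \<omega>) \<partial>M) = (\<integral>\<^sup>+p. g p \<partial>(distr M S X \<Otimes>\<^sub>M distr M T Y))"
    using indep by (simp add: indep_var_distribution_eq nn_integral_distr)
  also have "\<dots> = (\<integral>\<^sup>+x. (\<integral>\<^sup>+y. g (x, y) \<partial>distr M T Y) \<partial>distr M S X)"
    by (rule DY.nn_integral_fst[symmetric]) simp
  also have "\<dots> = (\<integral>\<^sup>+\<omega>. (\<integral>\<^sup>+y. g (X \<omega>, y) \<partial>distr M T Y) \<partial>M)"
    by (rule nn_integral_distr) simp_all
  also have "\<dots> = (\<integral>\<^sup>+\<omega>. (\<integral>\<^sup>+\<omega>'. g (X \<omega>, Y \<omega>') \<partial>M) \<partial>M)"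
    by (intro nn_integral_cong nn_integral_distr) (auto dest: measurable_space[of X M S])
  finally show ?thesis .
qed

lemma nn_integral_power_poisson_pmf:
  assumes "0 < t" "0 \<le> a"
  shows "(\<integral>\<^sup>+l. ennreal (a ^ l) \<partial>measure_pmf (poisson_pmf t)) = ennreal (exp (t * (a - 1)))"
proof -
  have "(\<lambda>l. (t * a) ^ l /\<^sub>R fact l) sums exp (t * a)"
    by (rule exp_converges)
  then have "(\<lambda>l. (t * a) ^ l /\<^sub>R fact l * exp (- t)) sums (exp (t * a) * exp (- t))"
    by (rule sums_mult2)
  also have "exp (t * a) * exp (- t) = exp (t * (a - 1))"
    by (simp add: right_diff_distrib flip: exp_add)
  also have "(\<lambda>l. (t * a) ^ l /\<^sub>R fact l * exp (- t)) = (\<lambda>l. pmf (poisson_pmf t) l * a ^ l)"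
    using assms by (intro ext) (simp add: power_mult_distrib divide_inverse mult_ac)
  finally have sums: "(\<lambda>l. pmf (poisson_pmf t) l * a ^ l) sums exp (t * (a - 1))" .
  have "(\<integral>\<^sup>+l. ennreal (a ^ l) \<partial>measure_pmf (poisson_pmf t)) =
      (\<Sum>l. ennreal (pmf (poisson_pmf t) l * a ^ l))"
    using assms by (simp add: nn_integral_measure_pmf nn_integral_count_space_nat ennreal_mult
        del: pmf_poisson)
  also have "\<dots> = ennreal (exp (t * (a - 1)))"
    using sums assms by (subst suminf_ennreal2) (auto simp: sums_iff)
  finally show ?thesis .
qed

locale compound_poisson = prob_space M for M :: "'a measure" +
  fixes N :: "real \<Rightarrow> 'a \<Rightarrow> nat" and Y :: "nat \<Rightarrow> 'a \<Rightarrow> real" and J :: "real \<Rightarrow> 'a \<Rightarrow> real"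
  assumes compound: "compound_poisson_process M 1 N Y J"
    and Y_nonneg: "\<omega> \<in> space M \<Longrightarrow> 0 \<le> Y j \<omega>"
begin

lemma Y_measurable [measurable]: "Y j \<in> borel_measurable M"
  using compound by (auto simp: compound_poisson_process_def indep_vars_def)

lemma N_measurable [measurable]: "0 \<le> t \<Longrightarrow> N t \<in> measurable M (count_space UNIV)"
  using compound by (auto simp: compound_poisson_process_def poisson_process_def)

lemma N_0: "\<omega> \<in> space M \<Longrightarrow> N 0 \<omega> = 0"
  using compound by (auto simp: compound_poisson_process_def poisson_process_def)

lemma N_mono: "\<omega> \<in> space M \<Longrightarrow> 0 \<le> s \<Longrightarrow> s \<le> t \<Longrightarrow> N s \<omega> \<le> N t \<omega>"
  using compound unfolding compound_poisson_process_def poisson_process_def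
  by (auto intro: mono_onD[where A = "{0..}" and f = "\<lambda>t. N t \<omega>"])

lemma J_eq: "\<omega> \<in> space M \<Longrightarrow> 0 \<le> t \<Longrightarrow> J t \<omega> = (\<Sum>j<N t \<omega>. Y j \<omega>)"
  using compound by (auto simp: compound_poisson_process_def)

lemma J_measurable [measurable]:
  assumes "0 \<le> t"
  shows "J t \<in> borel_measurable M"
proof -
  have "(\<lambda>\<omega>. \<Sum>j<N t \<omega>. Y j \<omega>) \<in> borel_measurable M"
    by (rule measurable_compose_countable[where f = "\<lambda>n \<omega>. \<Sum>j<n. Y j \<omega>" and g = "N t"])
      (use assms in measurable)
  then show ?thesis
    using assms by (subst measurable_cong[OF J_eq]) auto
qed

lemma J_0: "\<omega> \<in> space M \<Longrightarrow> J 0 \<omega> = 0"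
  by (simp add: J_eq N_0)

lemma J_diff:
  assumes "\<omega> \<in> space M" "0 \<le> s" "s \<le> t"
  shows "J t \<omega> - J s \<omega> = (\<Sum>j\<in>{N s \<omega>..<N t \<omega>}. Y j \<omega>)"
  using assms sum_diff_nat_ivl[of 0 "N s \<omega>" "N t \<omega>" "\<lambda>j. Y j \<omega>"] N_mono[of \<omega> s t]
  by (simp add: J_eq lessThan_atLeast0)

lemma J_mono: "\<omega> \<in> space M \<Longrightarrow> 0 \<le> s \<Longrightarrow> s \<le> t \<Longrightarrow> J s \<omega> \<le> J t \<omega>"
  using J_diff[of \<omega> s t] by (simp add: sum_nonneg Y_nonneg algebra_simps)

lemma indep_Y: "indep_vars (\<lambda>_. borel) Y UNIV"
  using compound by (auto simp: compound_poisson_process_def)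

lemma distr_Y: "distr M borel (Y j) = distr M borel (Y 0)"
  using compound by (auto simp: compound_poisson_process_def)

text \<open>Once the counts are fixed, the jump sizes of each time cell form a block with its own
  starting index; only the length of the block matters for its law.\<close>

lemma distr_sum_Y:
  "distr M borel (\<lambda>\<omega>. \<Sum>j\<in>{a..<a + l}. Y j \<omega>) = distr M borel (\<lambda>\<omega>. \<Sum>j<l. Y j \<omega>)"
proof (induction l)
  case (Suc l)
  have step: "distr M borel (\<lambda>\<omega>. \<Sum>j\<in>{a..<a + Suc l}. Y j \<omega>) =
      convolution (distr M borel (Y 0)) (distr M borel (\<lambda>\<omega>. \<Sum>j\<in>{a..<a + l}. Y j \<omega>))" for a
  proof -
    have "indep_var borel (Y (a + l)) borel (\<lambda>\<omega>. \<Sum>j\<in>{a..<a + l}. Y j \<omega>)"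
      by (intro indep_vars_sum indep_vars_subset[OF indep_Y]) auto
    then have "distr M borel (\<lambda>\<omega>. Y (a + l) \<omega> + (\<Sum>j\<in>{a..<a + l}. Y j \<omega>)) =
        convolution (distr M borel (Y (a + l))) (distr M borel (\<lambda>\<omega>. \<Sum>j\<in>{a..<a + l}. Y j \<omega>))"
      by (intro sum_indep_random_variable) auto
    then show ?thesis
      by (simp add: distr_Y[of "a + l"] add.commute)
  qed
  show ?case
    using step[of a] step[of 0] Suc.IH by (simp add: lessThan_atLeast0)
qed (simp add: lessThan_atLeast0)

lemma prob_sum_Y:
  assumes [measurable]: "A \<in> sets borel"
  shows "prob {\<omega> \<in> space M. (\<Sum>j\<in>{a..<a + l}. Y j \<omega>) \<in> A} = prob {\<omega> \<in> space M. (\<Sum>j<l. Y j \<omega>) \<in> A}"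
proof -
  have "measure (distr M borel (\<lambda>\<omega>. \<Sum>j\<in>{a..<a + l}. Y j \<omega>)) A =
      measure (distr M borel (\<lambda>\<omega>. \<Sum>j<l. Y j \<omega>)) A"
    by (simp add: distr_sum_Y)
  then show ?thesis
    by (simp add: measure_distr vimage_def Int_def conj_commute)
qed

text \<open>
  In \<^const>\<open>compound_poisson_process\<close> the two arguments of \<open>indep_var\<close> have the same type, so the
  counting path is coerced to its sequence of values at the integer times: only these are assumed
  to be independent of the jump sizes.
\<close>

abbreviation N_space :: "(nat \<Rightarrow> real) measure" where
  "N_space \<equiv> Pi\<^sub>M {0..} (\<lambda>_. count_space UNIV)"

abbreviation Y_space :: "(nat \<Rightarrow> real) measure" where
  "Y_space \<equiv> Pi\<^sub>M UNIV (\<lambda>_. borel)"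

lemma nn_integral_condition:
  assumes "g \<in> borel_measurable (N_space \<Otimes>\<^sub>M Y_space)"
  shows "(\<integral>\<^sup>+\<omega>. g (\<lambda>k. real (N (real k) \<omega>), \<lambda>j. Y j \<omega>) \<partial>M) =
    (\<integral>\<^sup>+\<omega>. (\<integral>\<^sup>+\<omega>'. g (\<lambda>k. real (N (real k) \<omega>), \<lambda>j. Y j \<omega>') \<partial>M) \<partial>M)"
proof -
  have "indep_var N_space (\<lambda>\<omega> k. real (N (real k) \<omega>)) Y_space (\<lambda>\<omega> j. Y j \<omega>)"
    using compound by (simp add: compound_poisson_process_def)
  then show ?thesis
    using assms by (rule indep_var_nn_integral_iterated)
qed

lemma N_increment:
  assumes "0 \<le> s" "s < t"
  shows "distr M (count_space UNIV) (\<lambda>\<omega>. N t \<omega> - N s \<omega>) = measure_pmf (poisson_pmf (t - s))"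
proof -
  have "\<forall>s t. 0 \<le> s \<and> s < t \<longrightarrow> distr M (count_space UNIV) (\<lambda>\<omega>. N t \<omega> - N s \<omega>) =
      measure_pmf (poisson_pmf (1 * (t - s)))"
    using compound unfolding compound_poisson_process_def poisson_process_def by blast
  with assms show ?thesis by simp
qed

lemma nn_integral_N_increment:
  fixes f :: "nat \<Rightarrow> ennreal"
  assumes "0 \<le> s" "s < t"
  shows "(\<integral>\<^sup>+\<omega>. f (N t \<omega> - N s \<omega>) \<partial>M) = (\<integral>\<^sup>+l. f l \<partial>measure_pmf (poisson_pmf (t - s)))"
proof -
  have [measurable]: "N s \<in> measurable M (count_space UNIV)" "N t \<in> measurable M (count_space UNIV)"
    using assms by simp_all
  show ?thesis
    unfolding N_increment[OF assms, symmetric] by (subst nn_integral_distr) auto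
qed

lemma nn_integral_N:
  fixes f :: "nat \<Rightarrow> ennreal"
  assumes "0 < t"
  shows "(\<integral>\<^sup>+\<omega>. f (N t \<omega>) \<partial>M) = (\<integral>\<^sup>+l. f l \<partial>measure_pmf (poisson_pmf t))"
proof -
  have "(\<integral>\<^sup>+\<omega>. f (N t \<omega>) \<partial>M) = (\<integral>\<^sup>+\<omega>. f (N t \<omega> - N 0 \<omega>) \<partial>M)"
    by (intro nn_integral_cong) (simp add: N_0)
  then show ?thesis
    using nn_integral_N_increment[of 0 t f] assms by simp
qed

text \<open>\<open>N_space\<close> carries real values, so a count is recovered by rounding
  down.\<close>

lemma N_space_component [measurable]:
  "(\<lambda>p. nat \<lfloor>fst p s\<rfloor>) \<in> measurable (N_space \<Otimes>\<^sub>M Y_space) (count_space UNIV)"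
proof -
  have "(\<lambda>p. fst p s) \<in> measurable (N_space \<Otimes>\<^sub>M Y_space) (count_space UNIV)"
    by (intro measurable_compose[OF measurable_fst measurable_component_singleton]) auto
  then show ?thesis
    by (rule measurable_compose) simp
qed

lemma Y_space_component [measurable]:
  "(\<lambda>p. snd p j) \<in> borel_measurable (N_space \<Otimes>\<^sub>M Y_space)"
  by (intro measurable_compose[OF measurable_snd measurable_component_singleton]) auto

lemma sum_range_measurable [measurable]:
  "(\<lambda>p. \<Sum>j\<in>{nat \<lfloor>fst p s\<rfloor>..<nat \<lfloor>fst p t\<rfloor>}. snd p j) \<in> borel_measurable (N_space \<Otimes>\<^sub>M Y_space)"
proof -
  have "(\<lambda>p. \<Sum>j\<in>{a..<nat \<lfloor>fst p t\<rfloor>}. snd p j) \<in> borel_measurable (N_space \<Otimes>\<^sub>M Y_space)" for a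
    by (rule measurable_compose_countable[where f = "\<lambda>b p. \<Sum>j\<in>{a..<b}. snd p j",
          OF _ N_space_component]) measurable
  then show ?thesis
    by (rule measurable_compose_countable[where f = "\<lambda>a p. \<Sum>j\<in>{a..<nat \<lfloor>fst p t\<rfloor>}. snd p j",
          OF _ N_space_component])
qed

lemma prob_sum_blocks:
  fixes n :: "nat \<Rightarrow> nat"
  assumes n: "\<And>k. n k \<le> n (Suc k)" and A: "\<And>k. A k \<in> sets borel"
  shows "prob {\<omega> \<in> space M. \<forall>k<m. (\<Sum>j\<in>{n k..<n (Suc k)}. Y j \<omega>) \<in> A k} =
    (\<Prod>k<m. prob {\<omega> \<in> space M. (\<Sum>j<n (Suc k) - n k. Y j \<omega>) \<in> A k})"
\<comment> \<open>The product rule for independent variables asks for a nonempty index set.\<close>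
proof (cases "m = 0")
  case True
  then show ?thesis by (simp add: prob_space)
next
  case False
  have mono: "n i \<le> n k" if "i \<le> k" for i k
    using n that by (rule lift_Suc_mono_le)
  have disj: "disjoint_family_on (\<lambda>k. {n k..<n (Suc k)}) {..<m}"
  proof -
    have "{n i..<n (Suc i)} \<inter> {n k..<n (Suc k)} = {}" if "i < k" for i k
      using mono[of "Suc i" k] that by auto
    then show ?thesis
      unfolding disjoint_family_on_def by (metis Int_commute linorder_neqE_nat)
  qed
  have "indep_vars (\<lambda>k. borel) (\<lambda>k \<omega>. (\<Sum>j\<in>{n k..<n (Suc k)}. restrict (\<lambda>j. Y j \<omega>) {n k..<n (Suc k)} j)) {..<m}"
    by (rule indep_vars_compose2[OF indep_vars_restrict[OF indep_Y _ disj]]) auto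
  then have ind: "indep_vars (\<lambda>k. borel) (\<lambda>k \<omega>. (\<Sum>j\<in>{n k..<n (Suc k)}. Y j \<omega>)) {..<m}"
    by simp
  have "{\<omega> \<in> space M. \<forall>k<m. (\<Sum>j\<in>{n k..<n (Suc k)}. Y j \<omega>) \<in> A k} =
      (\<Inter>k\<in>{..<m}. (\<lambda>\<omega>. \<Sum>j\<in>{n k..<n (Suc k)}. Y j \<omega>) -` A k \<inter> space M)"
    using False by auto
  also have "prob \<dots> = (\<Prod>k<m. prob ((\<lambda>\<omega>. \<Sum>j\<in>{n k..<n (Suc k)}. Y j \<omega>) -` A k \<inter> space M))"
    using False A by (intro indep_varsD_finite[OF ind]) (auto intro: exI[of _ 0])
  also have "\<dots> = (\<Prod>k<m. prob {\<omega> \<in> space M. (\<Sum>j<n (Suc k) - n k. Y j \<omega>) \<in> A k})"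
  proof (rule prod.cong[OF refl])
    fix k
    have "prob {\<omega> \<in> space M. (\<Sum>j\<in>{n k..<n k + (n (Suc k) - n k)}. Y j \<omega>) \<in> A k} =
        prob {\<omega> \<in> space M. (\<Sum>j<n (Suc k) - n k. Y j \<omega>) \<in> A k}"
      using A by (rule prob_sum_Y)
    then show "prob ((\<lambda>\<omega>. \<Sum>j\<in>{n k..<n (Suc k)}. Y j \<omega>) -` A k \<inter> space M) =
        prob {\<omega> \<in> space M. (\<Sum>j<n (Suc k) - n k. Y j \<omega>) \<in> A k}"
      using n[of k] by (simp add: vimage_def Int_def conj_commute)
  qed
  finally show ?thesis .
qed

text \<open>Given the counts, the jump sizes form disjoint i.i.d. blocks, which yields a product of
  functions of the count increments; independence of these increments then factorises the outer
  integral. Strict monotonicity of \<tau> matches the increment law, which is stated for s <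
  t.\<close>

lemma prob_increments_N:
  fixes \<tau> :: "nat \<Rightarrow> nat"
  assumes \<tau>: "strict_mono \<tau>" and A[measurable]: "\<And>k. A k \<in> sets borel"
  shows "ennreal (prob {\<omega> \<in> space M. \<forall>k<m. J (\<tau> (Suc k)) \<omega> - J (\<tau> k) \<omega> \<in> A k}) =
    (\<Prod>k<m. \<integral>\<^sup>+l. ennreal (prob {\<omega> \<in> space M. (\<Sum>j<l. Y j \<omega>) \<in> A k})
      \<partial>measure_pmf (poisson_pmf (\<tau> (Suc k) - \<tau> k)))"
proof -
  have \<tau>_less: "\<tau> k < \<tau> (Suc k)" for k
    using \<tau> by (simp add: strict_mono_Suc_iff)
  let ?E = "{p \<in> space (N_space \<Otimes>\<^sub>M Y_space).
      \<forall>k\<in>{..<m}. (\<Sum>j\<in>{nat \<lfloor>fst p (\<tau> k)\<rfloor>..<nat \<lfloor>fst p (\<tau> (Suc k))\<rfloor>}. snd p j) \<in> A k}"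
  have E: "?E \<in> sets (N_space \<Otimes>\<^sub>M Y_space)"
    by measurable
  define p where "p k l = prob {\<omega> \<in> space M. (\<Sum>j<l. Y j \<omega>) \<in> A k}" for k l
  have in_space: "(\<lambda>k. real (N (real k) \<omega>), \<lambda>j. Y j \<omega>') \<in> space (N_space \<Otimes>\<^sub>M Y_space)" for \<omega> \<omega>'
    by (simp add: space_pair_measure space_PiM)
  have meas: "{\<omega> \<in> space M. \<forall>k<m. J (\<tau> (Suc k)) \<omega> - J (\<tau> k) \<omega> \<in> A k} \<in> sets M"
    by measurable
  have "ennreal (prob {\<omega> \<in> space M. \<forall>k<m. J (\<tau> (Suc k)) \<omega> - J (\<tau> k) \<omega> \<in> A k}) =
      (\<integral>\<^sup>+\<omega>. indicator {\<omega> \<in> space M. \<forall>k<m. J (\<tau> (Suc k)) \<omega> - J (\<tau> k) \<omega> \<in> A k} \<omega> \<partial>M)"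
    using meas by (simp add: emeasure_eq_measure)
  also have "\<dots> = (\<integral>\<^sup>+\<omega>. indicator ?E (\<lambda>k. real (N (real k) \<omega>), \<lambda>j. Y j \<omega>) \<partial>M)"
  proof (rule nn_integral_cong)
    fix \<omega> assume \<omega>: "\<omega> \<in> space M"
    have "J (\<tau> (Suc k)) \<omega> - J (\<tau> k) \<omega> = (\<Sum>j\<in>{N (\<tau> k) \<omega>..<N (\<tau> (Suc k)) \<omega>}. Y j \<omega>)" for k
      using \<omega> \<tau>_less by (intro J_diff) (auto intro: less_imp_le)
    then show "indicator {\<omega> \<in> space M. \<forall>k<m. J (\<tau> (Suc k)) \<omega> - J (\<tau> k) \<omega> \<in> A k} \<omega> =
        (indicator ?E (\<lambda>k. real (N (real k) \<omega>), \<lambda>j. Y j \<omega>) :: ennreal)"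
      using \<omega> in_space by (auto simp: indicator_def)
  qed
  also have "\<dots> = (\<integral>\<^sup>+\<omega>. (\<integral>\<^sup>+\<omega>'. indicator ?E (\<lambda>k. real (N (real k) \<omega>), \<lambda>j. Y j \<omega>') \<partial>M) \<partial>M)"
    using E by (intro nn_integral_condition) simp
  also have "\<dots> = (\<integral>\<^sup>+\<omega>. (\<Prod>k<m. ennreal (p k (N (\<tau> (Suc k)) \<omega> - N (\<tau> k) \<omega>))) \<partial>M)"
  proof (rule nn_integral_cong)
    fix \<omega> assume \<omega>: "\<omega> \<in> space M"
    have "(\<integral>\<^sup>+\<omega>'. indicator ?E (\<lambda>k. real (N (real k) \<omega>), \<lambda>j. Y j \<omega>') \<partial>M) =
        (\<integral>\<^sup>+\<omega>'. indicator {\<omega>' \<in> space M. \<forall>k<m. (\<Sum>j\<in>{N (\<tau> k) \<omega>..<N (\<tau> (Suc k)) \<omega>}. Y j \<omega>') \<in> A k} \<omega>' \<partial>M)"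
      using in_space by (intro nn_integral_cong) (auto simp: indicator_def)
    also have "\<dots> = ennreal (prob {\<omega>' \<in> space M. \<forall>k<m. (\<Sum>j\<in>{N (\<tau> k) \<omega>..<N (\<tau> (Suc k)) \<omega>}. Y j \<omega>') \<in> A k})"
      by (subst nn_integral_indicator) (simp_all add: emeasure_eq_measure)
    also have "\<dots> = ennreal (\<Prod>k<m. p k (N (\<tau> (Suc k)) \<omega> - N (\<tau> k) \<omega>))"
      unfolding p_def using \<omega> \<tau>_less
      by (subst prob_sum_blocks) (auto intro!: N_mono intro: less_imp_le)
    finally show "(\<integral>\<^sup>+\<omega>'. indicator ?E (\<lambda>k. real (N (real k) \<omega>), \<lambda>j. Y j \<omega>') \<partial>M) =
        (\<Prod>k<m. ennreal (p k (N (\<tau> (Suc k)) \<omega> - N (\<tau> k) \<omega>)))"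
      by (simp add: prod_ennreal p_def)
  qed
  also have "\<dots> = (\<Prod>k<m. \<integral>\<^sup>+\<omega>. ennreal (p k (N (\<tau> (Suc k)) \<omega> - N (\<tau> k) \<omega>)) \<partial>M)"
  proof (rule indep_vars_nn_integral)
    have "\<forall>(\<tau>::nat \<Rightarrow> real) m. mono \<tau> \<and> 0 \<le> \<tau> 0 \<longrightarrow>
        indep_vars (\<lambda>_. count_space UNIV) (\<lambda>k \<omega>. N (\<tau> (Suc k)) \<omega> - N (\<tau> k) \<omega>) {..<m}"
      using compound unfolding compound_poisson_process_def poisson_process_def by blast
    moreover have "mono (\<lambda>k. real (\<tau> k))"
      using strict_mono_mono[OF \<tau>] by (auto simp: mono_def)
    ultimately have "indep_vars (\<lambda>_. count_space UNIV) (\<lambda>k \<omega>. N (\<tau> (Suc k)) \<omega> - N (\<tau> k) \<omega>) {..<m}"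
      by auto
    then show "indep_vars (\<lambda>_. borel) (\<lambda>k \<omega>. ennreal (p k (N (\<tau> (Suc k)) \<omega> - N (\<tau> k) \<omega>))) {..<m}"
      by (rule indep_vars_compose2[where Y = "\<lambda>k l. ennreal (p k l)"]) simp
  qed auto
  also have "\<dots> = (\<Prod>k<m. \<integral>\<^sup>+l. ennreal (p k l) \<partial>measure_pmf (poisson_pmf (\<tau> (Suc k) - \<tau> k)))"
  proof (rule prod.cong[OF refl])
    fix k
    show "(\<integral>\<^sup>+\<omega>. ennreal (p k (N (\<tau> (Suc k)) \<omega> - N (\<tau> k) \<omega>)) \<partial>M) =
        (\<integral>\<^sup>+l. ennreal (p k l) \<partial>measure_pmf (poisson_pmf (real (\<tau> (Suc k) - \<tau> k))))"
      using \<tau>_less[of k] nn_integral_N_increment[of "real (\<tau> k)" "real (\<tau> (Suc k))" "\<lambda>l. ennreal (p k l)"]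
      by (simp add: of_nat_diff less_imp_le)
  qed
  finally show ?thesis
    by (simp add: p_def)
qed

lemma prob_J:
  assumes "0 < h" and A: "A \<in> sets borel"
  shows "ennreal (prob {\<omega> \<in> space M. J (real h) \<omega> \<in> A}) =
    (\<integral>\<^sup>+l. ennreal (prob {\<omega> \<in> space M. (\<Sum>j<l. Y j \<omega>) \<in> A}) \<partial>measure_pmf (poisson_pmf h))"
proof -
  have "{\<omega> \<in> space M. \<forall>i<1. J (real (Suc i * h)) \<omega> - J (real (i * h)) \<omega> \<in> A} =
      {\<omega> \<in> space M. J (real h) \<omega> \<in> A}"
    by (auto simp: J_0)
  then show ?thesis
    using prob_increments_N[of "\<lambda>k. k * h" "\<lambda>_. A" 1] assms by (simp add: strict_mono_Suc_iff)
qed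

text \<open>Each factor in \<open>prob_increments_N\<close> is the Poisson mixture that
  \<open>prob_J\<close> identifies with the law of J at the block length: increments over integer
  blocks are independent and stationary.\<close>

lemma prob_increments:
  fixes \<tau> :: "nat \<Rightarrow> nat"
  assumes \<tau>: "strict_mono \<tau>" and A: "\<And>k. A k \<in> sets borel"
  shows "prob {\<omega> \<in> space M. \<forall>k<m. J (\<tau> (Suc k)) \<omega> - J (\<tau> k) \<omega> \<in> A k} =
    (\<Prod>k<m. prob {\<omega> \<in> space M. J (real (\<tau> (Suc k) - \<tau> k)) \<omega> \<in> A k})"
proof -
  have \<tau>_less: "\<tau> k < \<tau> (Suc k)" for k
    using \<tau> by (simp add: strict_mono_Suc_iff)
  have "ennreal (prob {\<omega> \<in> space M. \<forall>k<m. J (\<tau> (Suc k)) \<omega> - J (\<tau> k) \<omega> \<in> A k}) =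
      (\<Prod>k<m. ennreal (prob {\<omega> \<in> space M. J (real (\<tau> (Suc k) - \<tau> k)) \<omega> \<in> A k}))"
    unfolding prob_increments_N[OF \<tau> A]
  proof (rule prod.cong[OF refl])
    fix k
    show "(\<integral>\<^sup>+l. ennreal (prob {\<omega> \<in> space M. (\<Sum>j<l. Y j \<omega>) \<in> A k})
          \<partial>measure_pmf (poisson_pmf (real (\<tau> (Suc k) - \<tau> k)))) =
        ennreal (prob {\<omega> \<in> space M. J (real (\<tau> (Suc k) - \<tau> k)) \<omega> \<in> A k})"
      using \<tau>_less[of k] A by (intro prob_J[symmetric]) auto
  qed
  also have "\<dots> = ennreal (\<Prod>k<m. prob {\<omega> \<in> space M. J (real (\<tau> (Suc k) - \<tau> k)) \<omega> \<in> A k})"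
    by (simp add: prod_ennreal)
  finally show ?thesis
    by (simp add: prod_nonneg)
qed

lemma nn_integral_prod_Y:
  fixes f :: "real \<Rightarrow> ennreal"
  assumes [measurable]: "f \<in> borel_measurable borel"
  shows "(\<integral>\<^sup>+\<omega>. (\<Prod>j<l. f (Y j \<omega>)) \<partial>M) = (\<integral>\<^sup>+\<omega>. f (Y 0 \<omega>) \<partial>M) ^ l"
proof -
  have eq: "(\<integral>\<^sup>+\<omega>. f (Y j \<omega>) \<partial>M) = (\<integral>\<^sup>+\<omega>. f (Y 0 \<omega>) \<partial>M)" for j
    using nn_integral_distr[of "Y j" M borel f] nn_integral_distr[of "Y 0" M borel f]
    by (simp add: distr_Y[of j])
  have "(\<integral>\<^sup>+\<omega>. (\<Prod>j<l. f (Y j \<omega>)) \<partial>M) = (\<Prod>j<l. \<integral>\<^sup>+\<omega>. f (Y j \<omega>) \<partial>M)"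
    by (intro indep_vars_nn_integral indep_vars_compose2[OF indep_vars_subset[OF indep_Y]]) auto
  also have "\<dots> = (\<Prod>j<l. \<integral>\<^sup>+\<omega>. f (Y 0 \<omega>) \<partial>M)"
    by (rule prod.cong[OF refl eq])
  finally show ?thesis
    by simp
qed

text \<open>The Poisson generating function at a, the mean weight of one jump. An indicator as f
  gives the probability of no large jump, a truncated exponential the upper Chernoff bound, a
  decreasing exponential the lower one.\<close>

lemma nn_integral_prod_N_Y:
  fixes f :: "real \<Rightarrow> ennreal"
  assumes f[measurable]: "f \<in> borel_measurable borel" and h: "0 < h" and a: "0 \<le> a"
    and fa: "(\<integral>\<^sup>+\<omega>. f (Y 0 \<omega>) \<partial>M) = ennreal a"
  shows "(\<integral>\<^sup>+\<omega>. (\<Prod>j<N (real h) \<omega>. f (Y j \<omega>)) \<partial>M) = ennreal (exp (real h * (a - 1)))"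
proof -
  have "(\<lambda>p. \<Prod>j<nat \<lfloor>fst p h\<rfloor>. f (snd p j)) \<in> borel_measurable (N_space \<Otimes>\<^sub>M Y_space)"
    by (rule measurable_compose_countable[where f = "\<lambda>n p. \<Prod>j<n. f (snd p j)",
          OF _ N_space_component]) measurable
  from nn_integral_condition[OF this]
  have "(\<integral>\<^sup>+\<omega>. (\<Prod>j<N (real h) \<omega>. f (Y j \<omega>)) \<partial>M) =
      (\<integral>\<^sup>+\<omega>. (\<integral>\<^sup>+\<omega>'. (\<Prod>j<N (real h) \<omega>. f (Y j \<omega>')) \<partial>M) \<partial>M)"
    by simp
  also have "\<dots> = (\<integral>\<^sup>+\<omega>. ennreal (a ^ N (real h) \<omega>) \<partial>M)"
    using a by (simp add: nn_integral_prod_Y fa ennreal_power)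
  also have "\<dots> = ennreal (exp (real h * (a - 1)))"
    using nn_integral_N[of "real h" "\<lambda>l. ennreal (a ^ l)"] nn_integral_power_poisson_pmf[of "real h" a] h a
    by simp
  finally show ?thesis .
qed

end

section \<open>Tail bounds for semiexponential jumps\<close>

locale semiexponential_compound_poisson =
  compound_poisson M N Y J + semiexponential_rate q \<alpha>
  for M :: "'a measure" and N Y J q \<alpha> +
  fixes c \<gamma> :: real
  assumes c_pos: "0 < c"
    and tail: "0 \<le> x \<Longrightarrow> prob {\<omega> \<in> space M. x \<le> Y 0 \<omega>} = exp (- c * q x)"
    and Y_integrable: "integrable M (Y 0)"
    and Y_mean: "expectation (Y 0) = \<gamma>"
begin

lemma \<gamma>_nonneg: "0 \<le> \<gamma>"
  unfolding Y_mean[symmetric] by (intro integral_nonneg_AE) (simp add: Y_nonneg)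

lemma q_Y_measurable [measurable]: "(\<lambda>\<omega>. q (Y 0 \<omega>)) \<in> borel_measurable M"
proof -
  \<comment> \<open>q is only known to be monotone on the half-line, hence the truncation at
    0.\<close>
  have "mono (\<lambda>y. q (max 0 y))"
    by (intro monoI q_mono) auto
  then have [measurable]: "(\<lambda>y. q (max 0 y)) \<in> borel_measurable borel"
    by (rule borel_measurable_mono)
  have "(\<lambda>\<omega>. q (max 0 (Y 0 \<omega>))) \<in> borel_measurable M"
    by measurable
  then show ?thesis
    by (rule measurable_cong[THEN iffD1, rotated]) (simp add: Y_nonneg max_absorb2)
qed

text \<open>The tail function evaluated at \<open>Y\<close> is stochastically larger than a uniform variable.\<close>

lemma prob_q_Y_ge: "prob {\<omega> \<in> space M. k \<le> c * q (Y 0 \<omega>)} \<le> exp (- k)"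
proof (cases "\<exists>y\<ge>0. k \<le> c * q y")
  case False
  then have "{\<omega> \<in> space M. k \<le> c * q (Y 0 \<omega>)} = {}"
    using Y_nonneg by auto
  then show ?thesis
    by (simp only: measure_empty) simp
next
  case True
  \<comment> \<open>S is an upper set: a half-line from t, closed or open. No continuity of q is at
    hand, so the open case is exhausted by the closed half-lines from t + 1/(n + 1).\<close>
  define S where "S = {y. 0 \<le> y \<and> k \<le> c * q y}"
  define t where "t = Inf S"
  have S: "S \<noteq> {}" "bdd_below S"
    using True by (auto simp: S_def intro: bdd_belowI[of _ 0])
  have t: "0 \<le> t"
    unfolding t_def using S(1) by (rule cInf_greatest) (simp add: S_def)
  have up: "y \<in> S" if "t < y" for y
  proof -
    have "\<exists>z\<in>S. z < y"
      using that cInf_less_iff[OF S, of y] by (simp only: t_def)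
    then obtain z where z: "z \<in> S" "z < y"
      by blast
    then have "c * q z \<le> c * q y"
      using c_pos by (intro mult_left_mono q_mono) (auto simp: S_def)
    with z show ?thesis by (auto simp: S_def)
  qed
  have le: "prob {\<omega> \<in> space M. y \<le> Y 0 \<omega>} \<le> exp (- k)" if "y \<in> S" for y
    using that by (simp add: tail S_def)
  have down: "t \<le> y" if "y \<in> S" for y
    unfolding t_def using that S(2) by (rule cInf_lower)
  show ?thesis
  proof (cases "t \<in> S")
    case True
    have "{\<omega> \<in> space M. k \<le> c * q (Y 0 \<omega>)} \<subseteq> {\<omega> \<in> space M. t \<le> Y 0 \<omega>}"
      using down Y_nonneg by (auto simp: S_def)
    then have "prob {\<omega> \<in> space M. k \<le> c * q (Y 0 \<omega>)} \<le> prob {\<omega> \<in> space M. t \<le> Y 0 \<omega>}"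
      by (intro finite_measure_mono) auto
    with le[OF True] show ?thesis by linarith
  next
    case False
    define E where "E n = {\<omega> \<in> space M. t + 1 / real (Suc n) \<le> Y 0 \<omega>}" for n
    have E_sets: "range E \<subseteq> sets M"
      by (auto simp: E_def)
    have "incseq E"
    proof (rule incseq_SucI)
      fix n
      have "1 / real (Suc (Suc n)) \<le> 1 / real (Suc n)"
        by (simp add: field_simps)
      then show "E n \<subseteq> E (Suc n)"
        by (auto simp: E_def)
    qed
    then have "(\<lambda>n. prob (E n)) \<longlonglongrightarrow> prob (\<Union>n. E n)"
      by (intro finite_Lim_measure_incseq E_sets)
    moreover have "prob (E n) \<le> exp (- k)" for n
      unfolding E_def by (intro le up) simp
    ultimately have "prob (\<Union>n. E n) \<le> exp (- k)"
      by (intro LIMSEQ_le_const2) auto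
    moreover have "{\<omega> \<in> space M. k \<le> c * q (Y 0 \<omega>)} \<subseteq> (\<Union>n. E n)"
    proof
      fix \<omega> assume \<omega>: "\<omega> \<in> {\<omega> \<in> space M. k \<le> c * q (Y 0 \<omega>)}"
      then have "Y 0 \<omega> \<in> S"
        using Y_nonneg by (auto simp: S_def)
      then have "t < Y 0 \<omega>"
        using down[of "Y 0 \<omega>"] False by (cases "t = Y 0 \<omega>") auto
      then obtain n where "1 / real (Suc n) < Y 0 \<omega> - t"
        using reals_Archimedean[of "Y 0 \<omega> - t"] by (auto simp: inverse_eq_divide)
      with \<omega> show "\<omega> \<in> (\<Union>n. E n)"
        by (auto simp: E_def intro!: exI[of _ n])
    qed
    then have "prob {\<omega> \<in> space M. k \<le> c * q (Y 0 \<omega>)} \<le> prob (\<Union>n. E n)"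
      by (intro finite_measure_mono) (auto simp: E_def)
    ultimately show ?thesis by linarith
  qed
qed

text \<open>On the layer k \<le> c q(Y) \<le> k + 1 the integrand is at most exp(a (k + 1)), and the
  layer has probability at most exp(-k); a < 1 makes the sum geometric.\<close>

lemma integrable_exp_q_Y:
  assumes a: "0 \<le> a" "a < 1"
  shows "integrable M (\<lambda>\<omega>. exp (a * (c * q (Y 0 \<omega>))))"
proof (rule integrableI_bounded)
  let ?f = "\<lambda>k \<omega>. ennreal (exp (a * (real k + 1))) * indicator {\<omega> \<in> space M. real k \<le> c * q (Y 0 \<omega>)} \<omega>"
  have "(\<integral>\<^sup>+\<omega>. ennreal (norm (exp (a * (c * q (Y 0 \<omega>))))) \<partial>M) \<le> (\<integral>\<^sup>+\<omega>. (\<Sum>k. ?f k \<omega>) \<partial>M)"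
  proof (rule nn_integral_mono)
    fix \<omega> assume \<omega>: "\<omega> \<in> space M"
    define k where "k = nat \<lfloor>c * q (Y 0 \<omega>)\<rfloor>"
    have "0 \<le> c * q (Y 0 \<omega>)"
      using c_pos q_nonneg Y_nonneg[OF \<omega>] by simp
    then have k: "real k \<le> c * q (Y 0 \<omega>)" "c * q (Y 0 \<omega>) \<le> real k + 1"
      unfolding k_def by linarith+
    have "a * (c * q (Y 0 \<omega>)) \<le> a * (real k + 1)"
      by (intro mult_left_mono k a)
    then have "ennreal (norm (exp (a * (c * q (Y 0 \<omega>))))) \<le> ?f k \<omega>"
      using k \<omega> by (simp add: ennreal_leI)
    also have "?f k \<omega> \<le> (\<Sum>k. ?f k \<omega>)"
      using sum_le_suminf[of "\<lambda>k. ?f k \<omega>" "{k}"] by (simp del: sum_mult_indicator sum_indicator_mult)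
    finally show "ennreal (norm (exp (a * (c * q (Y 0 \<omega>))))) \<le> (\<Sum>k. ?f k \<omega>)" .
  qed
  also have "\<dots> = (\<Sum>k. \<integral>\<^sup>+\<omega>. ?f k \<omega> \<partial>M)"
    by (intro nn_integral_suminf) measurable
  also have "\<dots> \<le> (\<Sum>k. ennreal (exp a * exp (a - 1) ^ k))"
  proof (intro suminf_le summableI)
    fix k
    have "(\<integral>\<^sup>+\<omega>. ?f k \<omega> \<partial>M) =
        ennreal (exp (a * (real k + 1)) * prob {\<omega> \<in> space M. real k \<le> c * q (Y 0 \<omega>)})"
      by (subst nn_integral_cmult_indicator) (simp_all add: emeasure_eq_measure ennreal_mult)
    also have "\<dots> \<le> ennreal (exp (a * (real k + 1)) * exp (- real k))"
      by (intro ennreal_leI mult_left_mono prob_q_Y_ge) simp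
    also have "exp (a * (real k + 1)) * exp (- real k) = exp a * exp (a - 1) ^ k"
      by (simp add: exp_of_nat_mult[symmetric] algebra_simps flip: exp_add)
    finally show "(\<integral>\<^sup>+\<omega>. ?f k \<omega> \<partial>M) \<le> ennreal (exp a * exp (a - 1) ^ k)" .
  qed
  also have "\<dots> < \<infinity>"
  proof -
    have "summable (\<lambda>k. exp a * exp (a - 1) ^ k)"
      using a by (intro summable_mult summable_geometric) simp
    then have "(\<Sum>k. ennreal (exp a * exp (a - 1) ^ k)) = ennreal (\<Sum>k. exp a * exp (a - 1) ^ k)"
      by (intro suminf_ennreal2) auto
    then show ?thesis by simp
  qed
  finally show "(\<integral>\<^sup>+\<omega>. ennreal (norm (exp (a * (c * q (Y 0 \<omega>))))) \<partial>M) < \<infinity>" .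
qed simp

lemma integrable_Y_exp_q_Y:
  assumes a: "0 \<le> a" "a < 1"
  shows "integrable M (\<lambda>\<omega>. Y 0 \<omega> * exp (a * (c * q (Y 0 \<omega>))))"
proof -
  \<comment> \<open>Half of the room between a and 1: q outgrows ln, so for large Y the factor Y
    costs at most an extra b in the exponent, and a + b stays below 1.\<close>
  define b where "b = (1 - a) / 2"
  have b: "0 < b" "a + b < 1"
    using a by (auto simp: b_def field_simps)
  have "\<forall>\<^sub>F y in at_top. 1 / (b * c) \<le> q y / ln y"
    using filterlim_q_over_ln by (simp add: filterlim_at_top)
  then obtain x1 where x1: "\<And>y. x1 \<le> y \<Longrightarrow> 1 / (b * c) \<le> q y / ln y"
    by (auto simp: eventually_at_top_linorder)
  define x2 where "x2 = max x1 2"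
  have ge: "y \<le> x2 + exp (b * (c * q y))" if "0 \<le> y" for y
  proof (cases "y \<le> x2")
    case False
    then have "1 / (b * c) \<le> q y / ln y" "0 < ln y" "0 < y"
      using x1[of y] by (auto simp: x2_def)
    then have "ln y \<le> b * (c * q y)"
      using b c_pos by (simp add: field_simps)
    then have "exp (ln y) \<le> exp (b * (c * q y))"
      by simp
    with \<open>0 < y\<close> show ?thesis by (simp add: x2_def)
  qed (simp add: add_increasing2)
  show ?thesis
  proof (rule Bochner_Integration.integrable_bound)
    show "integrable M (\<lambda>\<omega>. x2 * exp (a * (c * q (Y 0 \<omega>))) + exp ((a + b) * (c * q (Y 0 \<omega>))))"
      using a b by (intro Bochner_Integration.integrable_add integrable_mult_right integrable_exp_q_Y) auto
    show "AE \<omega> in M. norm (Y 0 \<omega> * exp (a * (c * q (Y 0 \<omega>))))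
        \<le> norm (x2 * exp (a * (c * q (Y 0 \<omega>))) + exp ((a + b) * (c * q (Y 0 \<omega>))))"
    proof (rule AE_I2)
      fix \<omega> assume \<omega>: "\<omega> \<in> space M"
      have "norm (Y 0 \<omega> * exp (a * (c * q (Y 0 \<omega>)))) = Y 0 \<omega> * exp (a * (c * q (Y 0 \<omega>)))"
        using Y_nonneg[OF \<omega>] by simp
      also have "\<dots> \<le> (x2 + exp (b * (c * q (Y 0 \<omega>)))) * exp (a * (c * q (Y 0 \<omega>)))"
        by (intro mult_right_mono ge Y_nonneg[OF \<omega>]) simp
      also have "\<dots> = x2 * exp (a * (c * q (Y 0 \<omega>))) + exp ((a + b) * (c * q (Y 0 \<omega>)))"
        by (simp add: algebra_simps flip: exp_add)
      finally show "norm (Y 0 \<omega> * exp (a * (c * q (Y 0 \<omega>))))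
          \<le> norm (x2 * exp (a * (c * q (Y 0 \<omega>))) + exp ((a + b) * (c * q (Y 0 \<omega>))))"
        by simp
    qed
  qed simp
qed

lemma q_seq_at_top: "0 < x \<Longrightarrow> filterlim (\<lambda>n. q (real n * x)) at_top sequentially"
  by (intro filterlim_compose[OF filterlim_q] filterlim_at_top_mult_tendsto_pos[OF tendsto_const]
      filterlim_real_sequentially) auto

lemma real_mult_at_top: "0 < x \<Longrightarrow> filterlim (\<lambda>n. real n * x) at_top sequentially"
  by (intro filterlim_at_top_mult_tendsto_pos[OF tendsto_const] filterlim_real_sequentially) auto

lemma q_ratio_seq:
  assumes "0 < x"
  shows "(\<lambda>n. q (real n * x) / q (real n)) \<longlonglongrightarrow> x powr \<alpha>"
  using filterlim_compose[OF q_scale[OF assms] filterlim_real_sequentially]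
  by (simp add: mult.commute)

text \<open>The Chernoff parameter at which a jump of the truncation size B weighs exp(a c q(B));
  for a slightly below 1 this falls just short of cancelling its tail probability.\<close>

definition tilt :: "real \<Rightarrow> real \<Rightarrow> real" where
  "tilt a B = a * c * q B / B"

text \<open>
  Because \<open>q y / y\<close> is eventually non-increasing, the tilted weight \<open>exp (tilt a B * Y)\<close> is dominated
  on \<open>Y < B\<close> by \<open>exp (a c q Y)\<close>, which is integrable since \<open>a < 1\<close>.
\<close>

lemma truncated_tilt_limit:
  assumes a: "0 < a" "a < 1" and x: "0 < x"
  shows "(\<lambda>n. expectation (\<lambda>\<omega>. (if Y 0 \<omega> < real n * x
      then (exp (tilt a (real n * x) * Y 0 \<omega>) - 1) / tilt a (real n * x) else 0))) \<longlonglongrightarrow> \<gamma>"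
proof -
  let ?B = "\<lambda>n. real n * x"
  let ?s = "\<lambda>n. tilt a (real n * x)"
  let ?f = "\<lambda>n \<omega>. if Y 0 \<omega> < ?B n then (exp (?s n * Y 0 \<omega>) - 1) / ?s n else 0"
  obtain x0 where x0: "0 < x0" "\<And>u v. x0 \<le> u \<Longrightarrow> u \<le> v \<Longrightarrow> q v / v \<le> q u / u"
    using q_ratio_antimono by blast
  have "\<forall>\<^sub>F n in sequentially. x0 \<le> ?B n \<and> 0 < q (?B n)"
    using filterlim_at_top[THEN iffD1, OF real_mult_at_top[OF x]]
      filterlim_at_top_dense[THEN iffD1, OF q_seq_at_top[OF x]]
    by (intro eventually_conj) auto
  then obtain n0 where n0: "\<And>n. n0 \<le> n \<Longrightarrow> x0 \<le> ?B n" "\<And>n. n0 \<le> n \<Longrightarrow> 0 < q (?B n)"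
    by (auto simp: eventually_sequentially)
  have s_pos: "0 < ?s n" if "n0 \<le> n" for n
    using n0[OF that] x0(1) a c_pos by (simp add: tilt_def)
  have s0: "?s \<longlonglongrightarrow> 0"
  proof -
    have "(\<lambda>n. inverse (?B n / q (?B n))) \<longlonglongrightarrow> 0"
      by (intro tendsto_inverse_0_at_top filterlim_compose[OF filterlim_over_q] real_mult_at_top x)
    then have "(\<lambda>n. a * c * inverse (?B n / q (?B n))) \<longlonglongrightarrow> a * c * 0"
      by (intro tendsto_intros)
    then show ?thesis
      by (simp add: tilt_def divide_inverse mult_ac)
  qed
  define K where "K = exp (a * (c * q x0))"
  have bound: "\<bar>?f (n + n0) \<omega>\<bar> \<le> Y 0 \<omega> * K + Y 0 \<omega> * exp (a * (c * q (Y 0 \<omega>)))"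
    if \<omega>: "\<omega> \<in> space M" for n \<omega>
  proof (cases "Y 0 \<omega> < ?B (n + n0)")
    case True
    let ?n = "n + n0" and ?y = "Y 0 \<omega>"
    have y: "0 \<le> ?y"
      using \<omega> by (rule Y_nonneg)
    have s: "0 < ?s ?n"
      by (rule s_pos) simp
    have B: "x0 \<le> ?B ?n"
      by (rule n0) simp
    have sy: "?s ?n * ?y \<le> a * (c * q (max x0 ?y))"
    proof -
      have "?s ?n * ?y \<le> ?s ?n * max x0 ?y"
        using s by (intro mult_left_mono) auto
      also have "\<dots> = a * c * (q (?B ?n) / ?B ?n) * max x0 ?y"
        by (simp add: tilt_def)
      also have "\<dots> \<le> a * c * (q (max x0 ?y) / max x0 ?y) * max x0 ?y"
        using B True x0 a c_pos by (intro mult_left_mono mult_right_mono x0(2)) auto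
      also have "\<dots> = a * (c * q (max x0 ?y))"
        using x0(1) by (simp add: max_def)
      finally show ?thesis .
    qed
    \<comment> \<open>exp u - 1 \<le> u exp u cancels the division by the tilt, which tends to
      0.\<close>
    have "exp (?s ?n * ?y) - 1 \<le> ?s ?n * ?y * exp (?s ?n * ?y)"
    proof -
      have "1 - ?s ?n * ?y \<le> exp (- (?s ?n * ?y))"
        using exp_ge_add_one_self[of "- (?s ?n * ?y)"] by simp
      then have "(1 - ?s ?n * ?y) * exp (?s ?n * ?y) \<le> exp (- (?s ?n * ?y)) * exp (?s ?n * ?y)"
        by (intro mult_right_mono) auto
      then show ?thesis
        by (simp add: algebra_simps flip: exp_add)
    qed
    then have "?f ?n \<omega> \<le> ?y * exp (?s ?n * ?y)"
      using True s by (simp add: pos_divide_le_eq mult_ac)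
    also have "\<dots> \<le> ?y * exp (a * (c * q (max x0 ?y)))"
      using y sy by (intro mult_left_mono) auto
    also have "\<dots> \<le> ?y * (K + exp (a * (c * q ?y)))"
      using y by (intro mult_left_mono) (auto simp: K_def max_def)
    finally have "?f ?n \<omega> \<le> ?y * K + ?y * exp (a * (c * q ?y))"
      by (simp add: distrib_left)
    moreover have "0 \<le> ?f ?n \<omega>"
      using s y by simp
    ultimately show ?thesis by simp
  next
    case False
    then show ?thesis
      using Y_nonneg[OF \<omega>] by (simp add: K_def)
  qed
  have lim: "(\<lambda>n. ?f n \<omega>) \<longlonglongrightarrow> Y 0 \<omega>" for \<omega>
  proof -
    have "((\<lambda>s::real. (exp (s * Y 0 \<omega>) - 1) / s) \<longlongrightarrow> Y 0 \<omega>) (at 0)"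
    proof -
      have "((\<lambda>s::real. exp (s * Y 0 \<omega>)) has_real_derivative Y 0 \<omega>) (at 0)"
        by (auto intro!: derivative_eq_intros)
      then show ?thesis
        by (simp add: DERIV_def)
    qed
    moreover have "filterlim ?s (at 0) sequentially"
    proof -
      have "\<forall>\<^sub>F n in sequentially. ?s n \<noteq> 0"
        using eventually_ge_at_top[of n0]
      proof eventually_elim
        case (elim n)
        show ?case
          using s_pos[OF elim] by simp
      qed
      with s0 show ?thesis
        by (simp add: filterlim_at)
    qed
    ultimately have "(\<lambda>n. (exp (?s n * Y 0 \<omega>) - 1) / ?s n) \<longlonglongrightarrow> Y 0 \<omega>"
      by (rule filterlim_compose)
    moreover have "\<forall>\<^sub>F n in sequentially. Y 0 \<omega> < ?B n"
      using filterlim_at_top_dense[THEN iffD1, OF real_mult_at_top[OF x]] by blast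
    then have "\<forall>\<^sub>F n in sequentially. (exp (?s n * Y 0 \<omega>) - 1) / ?s n = ?f n \<omega>"
      by eventually_elim simp
    ultimately show ?thesis
      by (rule Lim_transform_eventually)
  qed
  have "(\<lambda>n. expectation (?f (n + n0))) \<longlonglongrightarrow> expectation (Y 0)"
  proof (rule integral_dominated_convergence)
    show "integrable M (\<lambda>\<omega>. Y 0 \<omega> * K + Y 0 \<omega> * exp (a * (c * q (Y 0 \<omega>))))"
      using a Y_integrable by (intro Bochner_Integration.integrable_add integrable_Y_exp_q_Y) auto
    show "AE \<omega> in M. (\<lambda>n. ?f (n + n0) \<omega>) \<longlonglongrightarrow> Y 0 \<omega>"
      using lim by (intro AE_I2 LIMSEQ_ignore_initial_segment)
    show "AE \<omega> in M. norm (?f (n + n0) \<omega>) \<le> Y 0 \<omega> * K + Y 0 \<omega> * exp (a * (c * q (Y 0 \<omega>)))" for n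
      using bound by (intro AE_I2) simp
  qed measurable
  then show ?thesis
    unfolding Y_mean by (rule LIMSEQ_offset)
qed

end

section \<open>Tail and window probabilities of a single input\<close>

lemma exp_less_half_eventually:
  fixes q :: "nat \<Rightarrow> real"
  assumes "filterlim q at_top sequentially" "0 < e"
  shows "\<forall>\<^sub>F n in sequentially. exp (- e * q n) \<le> 1 / 2"
proof -
  have "\<forall>\<^sub>F n in sequentially. ln 2 / e \<le> q n"
    using assms(1) by (simp add: filterlim_at_top)
  then show ?thesis
  proof eventually_elim
    case (elim n)
    then have "- e * q n \<le> - ln 2"
      using assms(2) by (simp add: field_simps)
    then have "exp (- e * q n) \<le> exp (- ln 2)"
      by simp
    then show ?case by (simp add: exp_minus)
  qed
qed

context semiexponential_compound_poisson
begin

lemma q_real_at_top: "filterlim (\<lambda>n. q (real n)) at_top sequentially"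
  using q_seq_at_top[of 1] by simp

lemma q_real_pos: "\<forall>\<^sub>F n in sequentially. 0 < q (real n)"
  using q_real_at_top by (simp add: filterlim_at_top_dense)

lemma prob_Y_less: "0 \<le> B \<Longrightarrow> prob {\<omega> \<in> space M. Y 0 \<omega> < B} = 1 - exp (- c * q B)"
proof -
  assume B: "0 \<le> B"
  have "{\<omega> \<in> space M. Y 0 \<omega> < B} = space M - {\<omega> \<in> space M. B \<le> Y 0 \<omega>}"
    by auto
  then show ?thesis
    by (simp add: prob_compl tail[OF B])
qed

text \<open>The number of jumps of size at least B is Poisson with mean h exp(-c q(B)), so at least
  one occurs with probability 1 - exp(-mean), which is at most the mean.\<close>

lemma prob_all_jumps_less:
  assumes h: "0 < h" and B: "0 \<le> B"
  shows "prob {\<omega> \<in> space M. \<not> (\<forall>j<N (real h) \<omega>. Y j \<omega> < B)} \<le> real h * exp (- c * q B)"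
proof -
  let ?f = "\<lambda>y. indicator {..<B} y :: ennreal"
  have meas: "{\<omega> \<in> space M. \<forall>j<N (real h) \<omega>. Y j \<omega> < B} \<in> sets M"
  proof -
    have "Measurable.pred M (\<lambda>\<omega>. \<forall>j<N (real h) \<omega>. Y j \<omega> < B)"
      by (rule measurable_compose_countable[where f = "\<lambda>n \<omega>. \<forall>j<n. Y j \<omega> < B"]) measurable
    then show ?thesis by measurable
  qed
  have "(\<integral>\<^sup>+\<omega>. ?f (Y 0 \<omega>) \<partial>M) = (\<integral>\<^sup>+\<omega>. indicator {\<omega> \<in> space M. Y 0 \<omega> < B} \<omega> \<partial>M)"
    by (intro nn_integral_cong) (auto simp: indicator_def)
  also have "\<dots> = ennreal (1 - exp (- c * q B))"
    by (subst nn_integral_indicator) (simp_all add: emeasure_eq_measure prob_Y_less[OF B])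
  finally have "(\<integral>\<^sup>+\<omega>. (\<Prod>j<N (real h) \<omega>. ?f (Y j \<omega>)) \<partial>M) = ennreal (exp (real h * (- exp (- c * q B))))"
    using c_pos q_nonneg[OF B] by (subst nn_integral_prod_N_Y[OF _ h]) auto
  also have "(\<integral>\<^sup>+\<omega>. (\<Prod>j<N (real h) \<omega>. ?f (Y j \<omega>)) \<partial>M) =
      (\<integral>\<^sup>+\<omega>. indicator {\<omega> \<in> space M. \<forall>j<N (real h) \<omega>. Y j \<omega> < B} \<omega> \<partial>M)"
    by (intro nn_integral_cong) (auto simp: indicator_def)
  also have "\<dots> = ennreal (prob {\<omega> \<in> space M. \<forall>j<N (real h) \<omega>. Y j \<omega> < B})"
    using meas by (simp add: emeasure_eq_measure)
  finally have "prob {\<omega> \<in> space M. \<forall>j<N (real h) \<omega>. Y j \<omega> < B} = exp (- (real h * exp (- c * q B)))"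
    by simp
  moreover have "1 - real h * exp (- c * q B) \<le> exp (- (real h * exp (- c * q B)))"
    using exp_ge_add_one_self[of "- (real h * exp (- c * q B))"] by simp
  moreover have "{\<omega> \<in> space M. \<not> (\<forall>j<N (real h) \<omega>. Y j \<omega> < B)} =
      space M - {\<omega> \<in> space M. \<forall>j<N (real h) \<omega>. Y j \<omega> < B}"
    by auto
  ultimately show ?thesis
    using meas by (simp only: prob_compl)
qed

text \<open>The truncated exponential moment is 1 + s E minus the mass above B, hence at most 1 + s
  E. Writing it through E isolates the mean: along the tilts E tends to \<gamma>, so the exponent is
  close to - s (z - h \<gamma>).\<close>

lemma chernoff_upper:
  fixes B s z :: real
  assumes h: "0 < h" and s: "0 < s"
  defines "E \<equiv> expectation (\<lambda>\<omega>. (if Y 0 \<omega> < B then (exp (s * Y 0 \<omega>) - 1) / s else 0))"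
  shows "prob {\<omega> \<in> space M. (\<forall>j<N (real h) \<omega>. Y j \<omega> < B) \<and> z \<le> J (real h) \<omega>}
    \<le> exp (real h * (s * E) - s * z)"
proof -
  let ?f = "\<lambda>y. indicator {..<B} y * ennreal (exp (s * y))"
  define a where "a = expectation (\<lambda>\<omega>. indicator {..<B} (Y 0 \<omega>) * exp (s * Y 0 \<omega>))"
  have int: "integrable M (\<lambda>\<omega>. indicator {..<B} (Y 0 \<omega>) * exp (s * Y 0 \<omega>))"
    using s by (intro integrable_const_bound[of _ "exp (s * B)"] AE_I2)
      (auto simp: indicator_def)
  have "a \<le> 1 + s * E"
  proof -
    have int1: "integrable M (\<lambda>\<omega>. indicator {..<B} (Y 0 \<omega>) :: real)"
      by (intro integrable_const_bound[of _ 1] AE_I2) (auto simp: indicator_def)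
    have "s * E = expectation (\<lambda>\<omega>. indicator {..<B} (Y 0 \<omega>) * exp (s * Y 0 \<omega>) - indicator {..<B} (Y 0 \<omega>))"
      unfolding E_def integral_mult_right_zero[symmetric]
      using s by (intro Bochner_Integration.integral_cong) (auto simp: indicator_def)
    also have "\<dots> = a - expectation (\<lambda>\<omega>. indicator {..<B} (Y 0 \<omega>) :: real)"
      unfolding a_def by (intro Bochner_Integration.integral_diff int int1)
    also have "\<dots> \<ge> a - expectation (\<lambda>\<omega>. 1)"
      by (intro diff_mono order_refl integral_mono int1) (auto simp: indicator_def)
    finally show ?thesis
      by (simp add: prob_space)
  qed
  have a_nonneg: "0 \<le> a"
    unfolding a_def by (intro integral_nonneg_AE AE_I2) simp
  have "(\<integral>\<^sup>+\<omega>. ?f (Y 0 \<omega>) \<partial>M) = (\<integral>\<^sup>+\<omega>. ennreal (indicator {..<B} (Y 0 \<omega>) * exp (s * Y 0 \<omega>)) \<partial>M)"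
    by (intro nn_integral_cong) (auto simp: indicator_def)
  also have "\<dots> = ennreal a"
    unfolding a_def by (intro nn_integral_eq_integral int AE_I2) simp
  finally have fa: "(\<integral>\<^sup>+\<omega>. ?f (Y 0 \<omega>) \<partial>M) = ennreal a" .
  have meas: "{\<omega> \<in> space M. (\<forall>j<N (real h) \<omega>. Y j \<omega> < B) \<and> z \<le> J (real h) \<omega>} \<in> sets M" (is "?A \<in> _")
  proof -
    have [measurable]: "Measurable.pred M (\<lambda>\<omega>. \<forall>j<N (real h) \<omega>. Y j \<omega> < B)"
      by (rule measurable_compose_countable[where f = "\<lambda>n \<omega>. \<forall>j<n. Y j \<omega> < B"]) measurable
    show ?thesis by measurable
  qed
  have prodmeas: "(\<lambda>\<omega>. \<Prod>j<N (real h) \<omega>. ?f (Y j \<omega>)) \<in> borel_measurable M"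
    by (rule measurable_compose_countable[where f = "\<lambda>n \<omega>. \<Prod>j<n. ?f (Y j \<omega>)"]) measurable
  have "ennreal (prob ?A) = (\<integral>\<^sup>+\<omega>. indicator ?A \<omega> \<partial>M)"
    using meas by (simp add: emeasure_eq_measure)
  also have "\<dots> \<le> (\<integral>\<^sup>+\<omega>. ennreal (exp (- s * z)) * (\<Prod>j<N (real h) \<omega>. ?f (Y j \<omega>)) \<partial>M)"
  proof (rule nn_integral_mono)
    fix \<omega> assume \<omega>: "\<omega> \<in> space M"
    show "indicator ?A \<omega> \<le> ennreal (exp (- s * z)) * (\<Prod>j<N (real h) \<omega>. ?f (Y j \<omega>))"
    proof (cases "\<omega> \<in> ?A")
      case True
      then have "(\<Prod>j<N (real h) \<omega>. ?f (Y j \<omega>)) = (\<Prod>j<N (real h) \<omega>. ennreal (exp (s * Y j \<omega>)))"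
        by (intro prod.cong) auto
      also have "\<dots> = ennreal (exp (s * J (real h) \<omega>))"
        using \<omega> by (simp add: prod_ennreal J_eq sum_distrib_left exp_sum)
      finally have "ennreal (exp (- s * z)) * (\<Prod>j<N (real h) \<omega>. ?f (Y j \<omega>)) =
          ennreal (exp (s * (J (real h) \<omega> - z)))"
        by (simp add: right_diff_distrib flip: ennreal_mult exp_add)
      moreover have "1 \<le> exp (s * (J (real h) \<omega> - z))"
        using True s by simp
      ultimately show ?thesis
        using True by (simp add: ennreal_leI flip: ennreal_1)
    qed simp
  qed
  also have "\<dots> = ennreal (exp (- s * z)) * ennreal (exp (real h * (a - 1)))"
    using prodmeas nn_integral_prod_N_Y[OF _ h a_nonneg fa] by (simp add: nn_integral_cmult)
  also have "\<dots> = ennreal (exp (real h * (a - 1) - s * z))"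
    by (simp add: algebra_simps flip: ennreal_mult exp_add)
  finally have "prob ?A \<le> exp (real h * (a - 1) - s * z)"
    by simp
  also have "\<dots> \<le> exp (real h * (s * E) - s * z)"
    using \<open>a \<le> 1 + s * E\<close> by (simp add: mult_left_mono)
  finally show ?thesis .
qed

text \<open>Truncation at B = n x, the full excess: either some jump reaches B, with exponent c q(n
  x), or none does and the Chernoff bound with \<open>tilt a B\<close> gives nearly the same
  exponent. Regular variation turns q(n x) into x^\<alpha> q(n).\<close>

lemma prob_upper_tail_le:
  assumes h: "(\<lambda>n. real (h n) / real n) \<longlonglongrightarrow> \<delta>" "\<forall>\<^sub>F n in sequentially. 0 < h n"
    and x: "0 < x" and e: "0 < e"
  shows "\<forall>\<^sub>F n in sequentially. prob {\<omega> \<in> space M. real n * (\<gamma> * \<delta> + x) \<le> J (real (h n)) \<omega>}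
    \<le> exp (- (c * x powr \<alpha> - e) * q (real n))"
proof -
  define v where "v = c * x powr \<alpha>"
  have v: "0 < v"
    using c_pos x by (simp add: v_def)
  \<comment> \<open>Close enough to 1 that a v loses less than e / 2; the maximum with 1/2 keeps a
    positive.\<close>
  define a where "a = max (1 / 2) (1 - e / (4 * v))"
  have a: "0 < a" "a < 1" "a * v > v - e / 2"
  proof -
    show "0 < a" "a < 1"
      using v e by (auto simp: a_def)
    have "(1 - e / (4 * v)) * v \<le> a * v"
      using v by (intro mult_right_mono) (auto simp: a_def)
    moreover have "(1 - e / (4 * v)) * v = v - e / 4"
      using v by (simp add: field_simps)
    ultimately show "a * v > v - e / 2"
      using e by linarith
  qed
  define E where "E n = expectation (\<lambda>\<omega>. (if Y 0 \<omega> < real n * x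
      then (exp (tilt a (real n * x) * Y 0 \<omega>) - 1) / tilt a (real n * x) else 0))" for n
  have E: "E \<longlonglongrightarrow> \<gamma>"
    unfolding E_def by (rule truncated_tilt_limit[OF a(1,2) x])
  \<comment> \<open>Minus the Chernoff exponent, divided by q(n). The sequence w below plays the
    same role for jumps of size at least B, where ln (h n) accounts for the mean number of
    jumps.\<close>
  define u where "u n = a * c * (q (real n * x) / q (real n)) *
      (1 - (real (h n) / real n * E n - \<gamma> * \<delta>) / x)" for n
  have "u \<longlonglongrightarrow> a * c * x powr \<alpha> * (1 - (\<delta> * \<gamma> - \<gamma> * \<delta>) / x)"
    unfolding u_def using x by (intro tendsto_intros q_ratio_seq h E) auto
  then have "u \<longlonglongrightarrow> a * v"
    by (simp add: v_def mult_ac)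
  then have u: "\<forall>\<^sub>F n in sequentially. v - e / 2 < u n"
    using a(3) by (rule order_tendstoD)
  define w where "w n = c * (q (real n * x) / q (real n)) - ln (real (h n)) / q (real n)" for n
  have "w \<longlonglongrightarrow> c * x powr \<alpha> - 0"
    unfolding w_def
  proof (intro tendsto_intros q_ratio_seq x)
    have ln_q: "(\<lambda>n. ln (real n) / q (real n)) \<longlonglongrightarrow> 0"
    proof -
      have "(\<lambda>n. inverse (q (real n) / ln (real n))) \<longlonglongrightarrow> 0"
        by (intro tendsto_inverse_0_at_top filterlim_compose[OF filterlim_q_over_ln]
            filterlim_real_sequentially)
      then show ?thesis by simp
    qed
    have up: "\<forall>\<^sub>F n in sequentially. real (h n) / real n < \<delta> + 1"
      using h(1) by (rule order_tendstoD) simp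
    have "\<delta> \<ge> 0"
      using h(1) by (rule LIMSEQ_le_const) auto
    show "(\<lambda>n. ln (real (h n)) / q (real n)) \<longlonglongrightarrow> 0"
    proof (rule tendsto_sandwich)
      show "\<forall>\<^sub>F n in sequentially. 0 \<le> ln (real (h n)) / q (real n)"
        using h(2) q_real_pos by eventually_elim (auto intro!: divide_nonneg_pos ln_ge_zero)
      show "\<forall>\<^sub>F n in sequentially. ln (real (h n)) / q (real n)
          \<le> ln (\<delta> + 1) / q (real n) + ln (real n) / q (real n)"
        using h(2) q_real_pos up eventually_gt_at_top[of 0]
      proof eventually_elim
        case (elim n)
        then have "real (h n) \<le> (\<delta> + 1) * real n"
          by (simp add: field_simps)
        then have "ln (real (h n)) \<le> ln ((\<delta> + 1) * real n)"
          using elim \<open>\<delta> \<ge> 0\<close> by (subst ln_le_cancel_iff) auto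
        also have "\<dots> = ln (\<delta> + 1) + ln (real n)"
          using elim \<open>\<delta> \<ge> 0\<close> by (simp add: ln_mult)
        finally show ?case
          using elim by (simp add: divide_right_mono flip: add_divide_distrib)
      qed
      have "(\<lambda>n. ln (\<delta> + 1) / q (real n) + ln (real n) / q (real n)) \<longlonglongrightarrow> 0 + 0"
        by (intro tendsto_add ln_q tendsto_divide_0[OF tendsto_const]
            filterlim_at_top_imp_at_infinity q_real_at_top)
      then show "(\<lambda>n. ln (\<delta> + 1) / q (real n) + ln (real n) / q (real n)) \<longlonglongrightarrow> 0"
        by simp
    qed simp
  qed
  then have w: "\<forall>\<^sub>F n in sequentially. v - e / 2 < w n"
    using e by (intro order_tendstoD(1)) (auto simp: v_def)
  have qx: "\<forall>\<^sub>F n in sequentially. 0 < q (real n * x)"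
    using q_seq_at_top[OF x] by (simp add: filterlim_at_top_dense)
  have half: "\<forall>\<^sub>F n in sequentially. exp (- (e / 2) * q (real n)) \<le> 1 / 2"
    using e by (intro exp_less_half_eventually q_real_at_top) simp
  show ?thesis
    unfolding v_def[symmetric]
    using u w h(2) q_real_pos qx half eventually_gt_at_top[of 0]
  proof eventually_elim
    case (elim n)
    let ?B = "real n * x" and ?z = "real n * (\<gamma> * \<delta> + x)" and ?s = "tilt a (real n * x)"
    let ?A1 = "{\<omega> \<in> space M. \<not> (\<forall>j<N (real (h n)) \<omega>. Y j \<omega> < ?B)}"
    let ?A2 = "{\<omega> \<in> space M. (\<forall>j<N (real (h n)) \<omega>. Y j \<omega> < ?B) \<and> ?z \<le> J (real (h n)) \<omega>}"
    have [measurable]: "Measurable.pred M (\<lambda>\<omega>. \<forall>j<N (real (h n)) \<omega>. Y j \<omega> < ?B)"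
      by (rule measurable_compose_countable[where f = "\<lambda>k \<omega>. \<forall>j<k. Y j \<omega> < ?B"]) measurable
    have "0 < ?s"
      using a c_pos elim x by (simp add: tilt_def)
    have "prob ?A1 \<le> real (h n) * exp (- c * q ?B)"
      using elim x by (intro prob_all_jumps_less) auto
    also have "\<dots> = exp (ln (real (h n)) - c * q ?B)"
      using elim by (simp add: exp_diff exp_minus field_simps)
    also have "ln (real (h n)) - c * q ?B = - w n * q (real n)"
      using elim by (simp add: w_def field_simps)
    also have "exp (- w n * q (real n)) \<le> exp (- (v - e / 2) * q (real n))"
      using elim by (simp only: exp_le_cancel_iff) (intro mult_right_mono; linarith)
    finally have 1: "prob ?A1 \<le> exp (- (v - e / 2) * q (real n))" .
    have "prob ?A2 \<le> exp (real (h n) * (?s * E n) - ?s * ?z)"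
      unfolding E_def using elim \<open>0 < ?s\<close> by (intro chernoff_upper) auto
    also have "real (h n) * (?s * E n) - ?s * ?z = - u n * q (real n)"
      using elim x by (simp add: u_def tilt_def field_simps)
    also have "exp (- u n * q (real n)) \<le> exp (- (v - e / 2) * q (real n))"
      using elim by (simp only: exp_le_cancel_iff) (intro mult_right_mono; linarith)
    finally have 2: "prob ?A2 \<le> exp (- (v - e / 2) * q (real n))" .
    have "prob {\<omega> \<in> space M. ?z \<le> J (real (h n)) \<omega>} \<le> prob (?A1 \<union> ?A2)"
      by (intro finite_measure_mono) auto
    also have "\<dots> \<le> prob ?A1 + prob ?A2"
      by (intro measure_Un_le) auto
    also have "\<dots> \<le> 2 * exp (- (v - e / 2) * q (real n))"
      using 1 2 by simp
    also have "\<dots> = 2 * exp (- (e / 2) * q (real n)) * exp (- (v - e) * q (real n))"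
      by (simp add: algebra_simps flip: exp_add)
    also have "\<dots> \<le> 1 * exp (- (v - e) * q (real n))"
      using elim by (intro mult_right_mono) auto
    finally show ?case by simp
  qed
qed

text \<open>Minus the derivative of the Laplace transform at 0, along s = 1/(k + 1); the integrands
  are dominated by Y.\<close>

lemma negative_mgf_limit:
  "(\<lambda>k. expectation (\<lambda>\<omega>. (1 - exp (- Y 0 \<omega> / real (Suc k))) * real (Suc k))) \<longlonglongrightarrow> \<gamma>"
  unfolding Y_mean[symmetric]
proof (rule integral_dominated_convergence[OF _ _ Y_integrable])
  show "AE \<omega> in M. (\<lambda>k. (1 - exp (- Y 0 \<omega> / real (Suc k))) * real (Suc k)) \<longlonglongrightarrow> Y 0 \<omega>"
  proof (rule AE_I2)
    fix \<omega>
    show "(\<lambda>k. (1 - exp (- Y 0 \<omega> / real (Suc k))) * real (Suc k)) \<longlonglongrightarrow> Y 0 \<omega>"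
      by real_asymp
  qed
  show "AE \<omega> in M. norm ((1 - exp (- Y 0 \<omega> / real (Suc k))) * real (Suc k)) \<le> Y 0 \<omega>" for k
  proof (rule AE_I2)
    fix \<omega> assume "\<omega> \<in> space M"
    then have y: "0 \<le> Y 0 \<omega>"
      by (rule Y_nonneg)
    have "1 - exp (- Y 0 \<omega> / real (Suc k)) \<le> Y 0 \<omega> / real (Suc k)"
      using exp_ge_add_one_self[of "- Y 0 \<omega> / real (Suc k)"] by simp
    then have "(1 - exp (- Y 0 \<omega> / real (Suc k))) * real (Suc k) \<le> Y 0 \<omega>"
      by (simp add: field_simps del: of_nat_Suc)
    moreover have "exp (- Y 0 \<omega> / real (Suc k)) \<le> 1"
      using y by simp
    ultimately show "norm ((1 - exp (- Y 0 \<omega> / real (Suc k))) * real (Suc k)) \<le> Y 0 \<omega>"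
      by simp
  qed
qed measurable

lemma chernoff_lower:
  assumes h: "0 < h" and s: "0 < s"
  shows "prob {\<omega> \<in> space M. J (real h) \<omega> \<le> z}
    \<le> exp (s * z - real h * expectation (\<lambda>\<omega>. 1 - exp (- (s * Y 0 \<omega>))))"
proof -
  let ?f = "\<lambda>y. ennreal (exp (- (s * y)))"
  define a where "a = expectation (\<lambda>\<omega>. exp (- (s * Y 0 \<omega>)))"
  have int: "integrable M (\<lambda>\<omega>. exp (- (s * Y 0 \<omega>)))"
    using s Y_nonneg by (intro integrable_const_bound[of _ 1] AE_I2) auto
  have a: "expectation (\<lambda>\<omega>. 1 - exp (- (s * Y 0 \<omega>))) = 1 - a"
    unfolding a_def by (subst Bochner_Integration.integral_diff) (auto simp: int prob_space)
  have a_nonneg: "0 \<le> a"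
    unfolding a_def by (intro integral_nonneg_AE AE_I2) simp
  have fa: "(\<integral>\<^sup>+\<omega>. ?f (Y 0 \<omega>) \<partial>M) = ennreal a"
    unfolding a_def by (intro nn_integral_eq_integral int AE_I2) simp
  have prodmeas: "(\<lambda>\<omega>. \<Prod>j<N (real h) \<omega>. ?f (Y j \<omega>)) \<in> borel_measurable M"
    by (rule measurable_compose_countable[where f = "\<lambda>n \<omega>. \<Prod>j<n. ?f (Y j \<omega>)"]) measurable
  let ?A = "{\<omega> \<in> space M. J (real h) \<omega> \<le> z}"
  have "ennreal (prob ?A) = (\<integral>\<^sup>+\<omega>. indicator ?A \<omega> \<partial>M)"
    by (simp add: emeasure_eq_measure)
  also have "\<dots> \<le> (\<integral>\<^sup>+\<omega>. ennreal (exp (s * z)) * (\<Prod>j<N (real h) \<omega>. ?f (Y j \<omega>)) \<partial>M)"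
  proof (rule nn_integral_mono)
    fix \<omega> assume \<omega>: "\<omega> \<in> space M"
    have "(\<Prod>j<N (real h) \<omega>. ?f (Y j \<omega>)) = ennreal (exp (- (s * J (real h) \<omega>)))"
      using \<omega> by (simp add: prod_ennreal J_eq sum_distrib_left exp_sum sum_negf[symmetric])
    then have "ennreal (exp (s * z)) * (\<Prod>j<N (real h) \<omega>. ?f (Y j \<omega>)) =
        ennreal (exp (s * (z - J (real h) \<omega>)))"
      by (simp add: right_diff_distrib flip: ennreal_mult exp_add)
    moreover have "1 \<le> exp (s * (z - J (real h) \<omega>))" if "\<omega> \<in> ?A"
      using that s by simp
    ultimately show "indicator ?A \<omega> \<le> ennreal (exp (s * z)) * (\<Prod>j<N (real h) \<omega>. ?f (Y j \<omega>))"
      by (auto simp: indicator_def ennreal_leI simp flip: ennreal_1)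
  qed
  also have "\<dots> = ennreal (exp (s * z)) * ennreal (exp (real h * (a - 1)))"
    using prodmeas nn_integral_prod_N_Y[OF _ h a_nonneg fa] by (simp add: nn_integral_cmult)
  also have "\<dots> = ennreal (exp (s * z - real h * (1 - a)))"
    by (simp add: algebra_simps flip: ennreal_mult exp_add)
  finally show ?thesis
    unfolding a by simp
qed

text \<open>K is arbitrary: for a fixed Laplace parameter s the exponent is linear in n, which
  exceeds every multiple of q(n).\<close>

lemma prob_lower_tail_le:
  assumes h: "(\<lambda>n. real (h n) / real n) \<longlonglongrightarrow> \<delta>" "\<forall>\<^sub>F n in sequentially. 0 < h n"
    and e: "0 < e"
  shows "\<forall>\<^sub>F n in sequentially. prob {\<omega> \<in> space M. J (real (h n)) \<omega> \<le> real n * (\<gamma> * \<delta> - e)}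
    \<le> exp (- K * q (real n))"
proof -
  have \<delta>: "0 \<le> \<delta>"
    using h(1) by (rule LIMSEQ_le_const) auto
  \<comment> \<open>The loss \<delta> \<eta> has to stay below e; \<delta> may be 0, hence the
    denominator \<delta> + 1.\<close>
  define \<eta> where "\<eta> = e / (2 * (\<delta> + 1))"
  have \<eta>: "0 < \<eta>" "\<delta> * \<eta> < e"
    using e \<delta> by (auto simp: \<eta>_def field_simps intro!: add_nonneg_pos mult_nonneg_nonneg)
  have "\<forall>\<^sub>F k in sequentially. \<gamma> - \<eta> <
      expectation (\<lambda>\<omega>. (1 - exp (- Y 0 \<omega> / real (Suc k))) * real (Suc k))"
    using negative_mgf_limit \<eta> by (intro order_tendstoD(1)) auto
  then obtain k where k: "\<gamma> - \<eta> < expectation (\<lambda>\<omega>. (1 - exp (- Y 0 \<omega> / real (Suc k))) * real (Suc k))"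
    by (auto simp: eventually_sequentially)
  define s where "s = 1 / real (Suc k)"
  have s: "0 < s"
    by (simp add: s_def)
  have mgf: "s * (\<gamma> - \<eta>) \<le> expectation (\<lambda>\<omega>. 1 - exp (- (s * Y 0 \<omega>)))"
  proof -
    have "expectation (\<lambda>\<omega>. (1 - exp (- Y 0 \<omega> / real (Suc k))) * real (Suc k)) =
        expectation (\<lambda>\<omega>. 1 - exp (- (s * Y 0 \<omega>))) * real (Suc k)"
      unfolding integral_mult_left_zero[symmetric] by (simp add: s_def)
    with k show ?thesis
      by (simp add: s_def field_simps del: of_nat_Suc)
  qed
  define u where "u n = real (h n) / real n * (\<gamma> - \<eta>) - \<gamma> * \<delta> + e" for n
  have "u \<longlonglongrightarrow> \<delta> * (\<gamma> - \<eta>) - \<gamma> * \<delta> + e"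
    unfolding u_def by (intro tendsto_intros h)
  also have "\<delta> * (\<gamma> - \<eta>) - \<gamma> * \<delta> + e = e - \<delta> * \<eta>"
    by (simp add: algebra_simps)
  finally have u: "\<forall>\<^sub>F n in sequentially. (e - \<delta> * \<eta>) / 2 < u n"
    using \<eta> by (intro order_tendstoD(1)) auto
  have "filterlim (\<lambda>n. real n / q (real n)) at_top sequentially"
    by (rule filterlim_compose[OF filterlim_over_q filterlim_real_sequentially])
  then have "\<forall>\<^sub>F n in sequentially. K / (s * ((e - \<delta> * \<eta>) / 2)) \<le> real n / q (real n)"
    by (simp add: filterlim_at_top)
  then show ?thesis
    using u h(2) q_real_pos eventually_gt_at_top[of 0]
  proof eventually_elim
    case (elim n)
    let ?z = "real n * (\<gamma> * \<delta> - e)"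
    have "prob {\<omega> \<in> space M. J (real (h n)) \<omega> \<le> ?z}
        \<le> exp (s * ?z - real (h n) * expectation (\<lambda>\<omega>. 1 - exp (- (s * Y 0 \<omega>))))"
      using elim s by (intro chernoff_lower) auto
    also have "\<dots> \<le> exp (s * ?z - real (h n) * (s * (\<gamma> - \<eta>)))"
      using mult_left_mono[OF mgf, of "real (h n)"] by simp
    also have "s * ?z - real (h n) * (s * (\<gamma> - \<eta>)) = - (s * u n * real n)"
      using elim by (simp add: u_def field_simps)
    also have "exp (- (s * u n * real n)) \<le> exp (- K * q (real n))"
    proof -
      have "K \<le> real n / q (real n) * (s * ((e - \<delta> * \<eta>) / 2))"
      proof -
        have "0 < s * ((e - \<delta> * \<eta>) / 2)"
          using \<eta> s by simp
        from pos_divide_le_eq[OF this] elim(1) show ?thesis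
          by blast
      qed
      also have "\<dots> \<le> real n / q (real n) * (s * u n)"
        using elim s by (intro mult_left_mono) auto
      finally have "K * q (real n) \<le> s * u n * real n"
        using elim by (simp add: field_simps)
      then show ?thesis by simp
    qed
    finally show ?case .
  qed
qed

text \<open>The event that exactly one jump falls into the unit interval, of probability exp(-1),
  and that this jump is at least z.\<close>

lemma prob_J_1_ge:
  assumes "0 \<le> z"
  shows "exp (- 1) * exp (- c * q z) \<le> prob {\<omega> \<in> space M. z \<le> J 1 \<omega>}"
proof -
  have "ennreal (exp (- 1) * exp (- c * q z)) =
      (\<integral>\<^sup>+l. ennreal (exp (- c * q z)) * indicator {1} l \<partial>measure_pmf (poisson_pmf 1))"
    by (subst nn_integral_cmult_indicator) (simp_all add: emeasure_pmf_single ennreal_mult mult.commute)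
  also have "\<dots> \<le> (\<integral>\<^sup>+l. ennreal (prob {\<omega> \<in> space M. (\<Sum>j<l. Y j \<omega>) \<in> {z..}}) \<partial>measure_pmf (poisson_pmf 1))"
    using tail[OF assms] by (intro nn_integral_mono) (auto simp: indicator_def)
  also have "\<dots> = ennreal (prob {\<omega> \<in> space M. z \<le> J 1 \<omega>})"
    using prob_J[of 1 "{z..}"] by simp
  finally show ?thesis by simp
qed

text \<open>A single jump of size n (x + k) in the first unit of time, after which the remaining
  input falls short of its mean by less than n k, an event of probability at least 1/2. By
  continuity k can be so small that the larger jump costs less than e / 2 extra. The unit interval
  keeps the split at integer times.\<close>

lemma prob_upper_tail_ge:
  assumes h: "(\<lambda>n. real (h n) / real n) \<longlonglongrightarrow> \<delta>" "0 < \<delta>" and x: "0 < x" and e: "0 < e"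
  shows "\<forall>\<^sub>F n in sequentially. exp (- (c * x powr \<alpha> + e) * q (real n))
    \<le> prob {\<omega> \<in> space M. real n * (\<gamma> * \<delta> + x) \<le> J (real (h n)) \<omega>}"
proof -
  have "((\<lambda>k. c * (x + k) powr \<alpha>) \<longlongrightarrow> c * (x + 0) powr \<alpha>) (at_right 0)"
    using x by (intro tendsto_intros) auto
  then have "\<forall>\<^sub>F k in at_right 0. c * (x + k) powr \<alpha> < c * x powr \<alpha> + e / 2"
    using e by (intro order_tendstoD(2)) auto
  then have "\<exists>k>0. c * (x + k) powr \<alpha> < c * x powr \<alpha> + e / 2"
    unfolding eventually_at_right_field by (auto intro: exI[of _ "_ / 2"] dest: dense)
  then obtain k where k: "0 < k" "c * (x + k) powr \<alpha> < c * x powr \<alpha> + e / 2"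
    by blast
  have "(\<lambda>n. c * (q (real n * (x + k)) / q (real n))) \<longlonglongrightarrow> c * (x + k) powr \<alpha>"
    using x k by (intro tendsto_intros q_ratio_seq) auto
  then have qk: "\<forall>\<^sub>F n in sequentially. c * (q (real n * (x + k)) / q (real n)) < c * x powr \<alpha> + e / 2"
    using k by (intro order_tendstoD(2)) auto
  have h_large: "\<forall>\<^sub>F n in sequentially. 1 < h n"
  proof -
    have "filterlim (\<lambda>n. real (h n) / real n * real n) at_top sequentially"
      by (rule filterlim_tendsto_pos_mult_at_top[OF h filterlim_real_sequentially])
    then have "\<forall>\<^sub>F n in sequentially. 1 < real (h n) / real n * real n"
      by (simp add: filterlim_at_top_dense)
    then show ?thesis
      using eventually_gt_at_top[of 0] by eventually_elim simp
  qed
  have "(\<lambda>n. real (h n) / real n - 1 / real n) \<longlonglongrightarrow> \<delta> - 0"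
    by (intro tendsto_diff h lim_1_over_n)
  moreover have "\<forall>\<^sub>F n in sequentially. real (h n) / real n - 1 / real n = real (h n - 1) / real n"
    using h_large by eventually_elim (simp add: of_nat_diff diff_divide_distrib)
  ultimately have h': "(\<lambda>n. real (h n - 1) / real n) \<longlonglongrightarrow> \<delta>"
    by (auto intro: Lim_transform_eventually)
  have low: "\<forall>\<^sub>F n in sequentially. prob {\<omega> \<in> space M. J (real (h n - 1)) \<omega> \<le> real n * (\<gamma> * \<delta> - k)}
      \<le> exp (- 1 * q (real n))"
    using h' k h_large by (intro prob_lower_tail_le) (auto elim: eventually_mono)
  have half: "\<forall>\<^sub>F n in sequentially. exp (- 1 * q (real n)) \<le> 1 / 2"
    by (intro exp_less_half_eventually q_real_at_top) simp
  \<comment> \<open>Absorbs the factor exp(-1) of the single jump and the factor 1/2 of the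
    remaining time: 4 / e makes the left side at most exp(-2).\<close>
  have const: "\<forall>\<^sub>F n in sequentially. exp (- (e / 2) * q (real n)) \<le> exp (- 1) / 2"
  proof -
    have "\<forall>\<^sub>F n in sequentially. 4 / e \<le> q (real n)"
      using q_real_at_top by (simp add: filterlim_at_top)
    then show ?thesis
    proof eventually_elim
      case (elim n)
      have "exp (- 1) * 2 \<le> (1 :: real)"
        using exp_ge_add_one_self[of 1] by (simp add: exp_minus field_simps)
      have "exp (- (e / 2) * q (real n)) \<le> exp (- 2)"
        using elim e by (simp add: field_simps)
      also have "exp (- 2) = exp (- 1) * exp (- 1 :: real)"
        by (simp flip: exp_add)
      also have "\<dots> \<le> exp (- 1) * (1 / 2)"
        using \<open>exp (- 1) * 2 \<le> 1\<close> by (intro mult_left_mono) auto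
      finally show ?case by simp
    qed
  qed
  show ?thesis
    using low half const qk h_large q_real_pos
  proof eventually_elim
    case (elim n)
    \<comment> \<open>The times 0, 1, h n; later values only continue \<tau> in a strictly
      increasing way, as \<open>prob_increments\<close> expects.\<close>
    define \<tau> where "\<tau> i = (if i = 0 then 0 else if i = Suc 0 then 1 else h n + i - 2)" for i :: nat
    define A where "A i = (if i = 0 then {real n * (x + k)..} else {real n * (\<gamma> * \<delta> - k)<..})" for i :: nat
    have \<tau>: "strict_mono \<tau>"
      unfolding strict_mono_Suc_iff using elim by (auto simp: \<tau>_def)
    have "exp (- (c * x powr \<alpha> + e) * q (real n)) =
        exp (- (c * x powr \<alpha> + e / 2) * q (real n)) * exp (- (e / 2) * q (real n))"
      by (simp add: algebra_simps flip: exp_add)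
    also have "\<dots> \<le> exp (- c * q (real n * (x + k))) * (exp (- 1) / 2)"
    proof (intro mult_mono)
      have "c * q (real n * (x + k)) \<le> (c * x powr \<alpha> + e / 2) * q (real n)"
        using elim by (simp add: field_simps)
      then have "- (c * x powr \<alpha> + e / 2) * q (real n) \<le> - c * q (real n * (x + k))"
        by (simp only: mult_minus_left neg_le_iff_le)
      then show "exp (- (c * x powr \<alpha> + e / 2) * q (real n)) \<le> exp (- c * q (real n * (x + k)))"
        by (simp only: exp_le_cancel_iff)
    qed (use elim in auto)
    also have "\<dots> \<le> prob {\<omega> \<in> space M. real n * (x + k) \<le> J 1 \<omega>} * (1 / 2)"
      using prob_J_1_ge[of "real n * (x + k)"] x k by (simp add: mult.commute)
    also have "\<dots> \<le> prob {\<omega> \<in> space M. real n * (x + k) \<le> J 1 \<omega>} *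
        prob {\<omega> \<in> space M. real n * (\<gamma> * \<delta> - k) < J (real (h n - 1)) \<omega>}"
    proof (intro mult_left_mono)
      have "{\<omega> \<in> space M. real n * (\<gamma> * \<delta> - k) < J (real (h n - 1)) \<omega>} =
          space M - {\<omega> \<in> space M. J (real (h n - 1)) \<omega> \<le> real n * (\<gamma> * \<delta> - k)}"
        by auto
      then have "prob {\<omega> \<in> space M. real n * (\<gamma> * \<delta> - k) < J (real (h n - 1)) \<omega>} =
          1 - prob {\<omega> \<in> space M. J (real (h n - 1)) \<omega> \<le> real n * (\<gamma> * \<delta> - k)}"
        by (simp add: prob_compl)
      then show "1 / 2 \<le> prob {\<omega> \<in> space M. real n * (\<gamma> * \<delta> - k) < J (real (h n - 1)) \<omega>}"
        using elim by linarith
    qed simp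
    also have "\<dots> = (\<Prod>i<2. prob {\<omega> \<in> space M. J (real (\<tau> (Suc i) - \<tau> i)) \<omega> \<in> A i})"
      by (simp add: numeral_2_eq_2 \<tau>_def A_def)
    also have "\<dots> = prob {\<omega> \<in> space M. \<forall>i<2. J (\<tau> (Suc i)) \<omega> - J (\<tau> i) \<omega> \<in> A i}"
      by (rule prob_increments[OF \<tau>, symmetric]) (auto simp: A_def)
    also have "\<dots> \<le> prob {\<omega> \<in> space M. real n * (\<gamma> * \<delta> + x) \<le> J (real (h n)) \<omega>}"
    proof (rule finite_measure_mono)
      show "{\<omega> \<in> space M. \<forall>i<2. J (\<tau> (Suc i)) \<omega> - J (\<tau> i) \<omega> \<in> A i}
          \<subseteq> {\<omega> \<in> space M. real n * (\<gamma> * \<delta> + x) \<le> J (real (h n)) \<omega>}"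
      proof safe
        fix \<omega> assume \<omega>: "\<omega> \<in> space M" and inc: "\<forall>i<2. J (\<tau> (Suc i)) \<omega> - J (\<tau> i) \<omega> \<in> A i"
        have "real n * (x + k) \<le> J 1 \<omega>" "real n * (\<gamma> * \<delta> - k) < J (real (h n)) \<omega> - J 1 \<omega>"
          using inc[rule_format, of 0] inc[rule_format, of 1] \<omega> by (simp_all add: \<tau>_def A_def J_0)
        then show "real n * (\<gamma> * \<delta> + x) \<le> J (real (h n)) \<omega>"
          by (simp add: algebra_simps)
      qed
    qed measurable
    finally show ?case .
  qed
qed

text \<open>The window is a difference of two upper tails. Because x^\<alpha> is strictly
  increasing, the tail at x + k is smaller by an exponential factor on the scale q and removes at
  most half of the mass.\<close>

lemma prob_window_ge:
  assumes h: "(\<lambda>n. real (h n) / real n) \<longlonglongrightarrow> \<delta>" "0 < \<delta>" "\<forall>\<^sub>F n in sequentially. 0 < h n"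
    and x: "0 < x" and k: "0 < k" and e: "0 < e"
  shows "\<forall>\<^sub>F n in sequentially. exp (- (c * x powr \<alpha> + e) * q (real n)) \<le>
    prob {\<omega> \<in> space M. real n * (\<gamma> * \<delta> + x) \<le> J (real (h n)) \<omega> \<and>
      J (real (h n)) \<omega> < real n * (\<gamma> * \<delta> + (x + k))}"
proof -
  define g where "g = c * (x + k) powr \<alpha> - c * x powr \<alpha>"
  have g: "0 < g"
    using \<alpha> c_pos x k by (simp add: g_def powr_less_mono2)
  define e' where "e' = min (e / 2) (g / 4)"
  have e': "0 < e'" "e' \<le> e / 2" "e' \<le> g / 4"
    using e g by (auto simp: e'_def)
  have lo: "\<forall>\<^sub>F n in sequentially. exp (- (c * x powr \<alpha> + e') * q (real n))
      \<le> prob {\<omega> \<in> space M. real n * (\<gamma> * \<delta> + x) \<le> J (real (h n)) \<omega>}"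
    by (rule prob_upper_tail_ge[OF h(1,2) x e'(1)])
  have up: "\<forall>\<^sub>F n in sequentially. prob {\<omega> \<in> space M. real n * (\<gamma> * \<delta> + (x + k)) \<le> J (real (h n)) \<omega>}
      \<le> exp (- (c * (x + k) powr \<alpha> - g / 4) * q (real n))"
    using x k g by (intro prob_upper_tail_le h) auto
  have half1: "\<forall>\<^sub>F n in sequentially. exp (- (g / 2) * q (real n)) \<le> 1 / 2"
    using g by (intro exp_less_half_eventually q_real_at_top) simp
  have half2: "\<forall>\<^sub>F n in sequentially. exp (- (e / 2) * q (real n)) \<le> 1 / 2"
    using e by (intro exp_less_half_eventually q_real_at_top) simp
  show ?thesis
    using lo up half1 half2 q_real_pos
  proof eventually_elim
    case (elim n)
    let ?X = "exp (- (c * x powr \<alpha> + e') * q (real n))"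
    let ?A = "\<lambda>x. {\<omega> \<in> space M. real n * (\<gamma> * \<delta> + x) \<le> J (real (h n)) \<omega>}"
    have "- (c * (x + k) powr \<alpha> - g / 4) * q (real n) =
        - (c * x powr \<alpha> + g / 4) * q (real n) + (- (g / 2) * q (real n))"
      by (simp add: g_def field_simps)
    then have "exp (- (c * (x + k) powr \<alpha> - g / 4) * q (real n)) =
        exp (- (c * x powr \<alpha> + g / 4) * q (real n)) * exp (- (g / 2) * q (real n))"
      by (simp only: exp_add)
    also have "\<dots> \<le> ?X * (1 / 2)"
      using elim e' by (intro mult_mono) auto
    finally have "prob (?A (x + k)) \<le> ?X / 2"
      using elim by simp
    have "exp (- (c * x powr \<alpha> + e) * q (real n)) =
        exp (- (c * x powr \<alpha> + e / 2) * q (real n)) * exp (- (e / 2) * q (real n))"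
      by (simp add: algebra_simps flip: exp_add)
    also have "\<dots> \<le> ?X * (1 / 2)"
      using elim e' by (intro mult_mono) auto
    also have "\<dots> \<le> prob (?A x) - prob (?A (x + k))"
      using elim \<open>prob (?A (x + k)) \<le> ?X / 2\<close> by simp
    also have "\<dots> \<le> prob (?A x - ?A (x + k))"
      by (simp add: finite_measure_Diff' finite_measure_mono)
    also have "?A x - ?A (x + k) = {\<omega> \<in> space M. real n * (\<gamma> * \<delta> + x) \<le> J (real (h n)) \<omega> \<and>
        J (real (h n)) \<omega> < real n * (\<gamma> * \<delta> + (x + k))}"
      by auto
    finally show ?case .
  qed
qed

end

section \<open>The overflow probability\<close>

lemma grid_time_in:
  fixes T :: real
  assumes "0 < T" "0 < m" "k \<le> m"
  shows "real k * T / real m \<in> {0..T}"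
  using mult_right_mono[of "real k" "real m" T] assms by (simp add: field_simps)

text \<open>Absolute values turn every coefficient vector into an admissible path, so continuity can
  be stated on the whole product space. The increments carry the entire input, hence drift
  0.\<close>

lemma content_functional_grid_path_continuous:
  fixes Q :: "real^'d^'d" and b r :: "real^'d"
  assumes Q: "routing_matrix Q" and r: "\<And>i. 0 \<le> r $ i" and b: "\<And>i. 0 \<le> b $ i" and T: "0 < T"
  shows "continuous_on UNIV
    (\<lambda>v :: nat \<times> 'd \<Rightarrow> real. content_functional T Q r b (grid_path T m 0 (\<lambda>i k. \<bar>v (k, i)\<bar>)))"
    (is "continuous_on UNIV ?g")
  unfolding continuous_on_def
proof
  fix v :: "nat \<times> 'd \<Rightarrow> real"
  obtain C where C: "0 < C"
    "\<And>e (\<eta> :: real \<Rightarrow> real^'d) \<eta>'. 0 \<le> e \<Longrightarrow> input_path T \<eta> \<Longrightarrow> input_path T \<eta>' \<Longrightarrow>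
      (\<And>t i. t \<in> {0..T} \<Longrightarrow> \<bar>\<eta> t $ i - \<eta>' t $ i\<bar> \<le> e) \<Longrightarrow>
      \<bar>content_functional T Q r b \<eta> - content_functional T Q r b \<eta>'\<bar> \<le> C * e"
    using content_functional_lipschitz[OF Q r b T] by blast
  define D where "D w = (\<Sum>i\<in>UNIV. \<Sum>k<m. \<bar>w (k, i) - v (k, i)\<bar>)" for w :: "nat \<times> 'd \<Rightarrow> real"
  have D: "(D \<longlongrightarrow> D v) (at v)"
  proof -
    have "continuous_on UNIV D"
      unfolding D_def by (intro continuous_intros continuous_on_product_coordinates)
    then show ?thesis
      by (simp add: continuous_on_def)
  qed
  have D_nonneg: "0 \<le> D w" for w
    by (simp add: D_def sum_nonneg)
  have ip: "input_path T (grid_path T m 0 (\<lambda>i k. \<bar>w (k, i)\<bar>) :: real \<Rightarrow> real^'d)"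
    for w :: "nat \<times> 'd \<Rightarrow> real"
    using T by (intro grid_path_input_path) auto
  have le: "\<bar>?g w - ?g v\<bar> \<le> C * D w" for w
  proof (rule C(2)[OF D_nonneg ip ip])
    show "\<bar>grid_path T m 0 (\<lambda>i k. \<bar>w (k, i)\<bar>) t $ i - grid_path T m 0 (\<lambda>i k. \<bar>v (k, i)\<bar>) t $ i\<bar> \<le> D w" for t i
    proof -
      have "\<bar>grid_path T m 0 (\<lambda>i k. \<bar>w (k, i)\<bar>) t $ i - grid_path T m 0 (\<lambda>i k. \<bar>v (k, i)\<bar>) t $ i\<bar> =
          \<bar>\<Sum>k<m. (\<bar>w (k, i)\<bar> - \<bar>v (k, i)\<bar>) * indicator {real (Suc k) * T / real m..} t\<bar>"
        unfolding grid_path_def vec_lambda_beta by (simp add: left_diff_distrib sum_subtractf)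
      also have "\<dots> \<le> (\<Sum>k<m. \<bar>(\<bar>w (k, i)\<bar> - \<bar>v (k, i)\<bar>) * indicator {real (Suc k) * T / real m..} t\<bar>)"
        by (rule sum_abs)
      also have "\<dots> \<le> (\<Sum>k<m. \<bar>w (k, i) - v (k, i)\<bar>)"
        by (intro sum_mono) (auto simp: indicator_def)
      also have "\<dots> \<le> D w"
        unfolding D_def by (rule member_le_sum) (auto intro: sum_nonneg)
      finally show ?thesis .
    qed
  qed
  have "((\<lambda>w. ?g w - ?g v) \<longlongrightarrow> 0) (at v)"
  proof (rule Lim_null_comparison)
    show "\<forall>\<^sub>F w in at v. norm (?g w - ?g v) \<le> C * D w"
      using le by (intro always_eventually) simp
    show "((\<lambda>w. C * D w) \<longlongrightarrow> 0) (at v)"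
      using tendsto_mult[OF tendsto_const D, of C] by (simp add: D_def)
  qed
  then show "(?g \<longlongrightarrow> ?g v) (at v within UNIV)"
    by (simp only: LIM_zero_iff)
qed

text \<open>The regulator is an infimum over uncountably many paths, so measurability is obtained by
  approximation: agreement of two inputs on a grid of m + 1 cells fixes the content up to C T / (m +
  1), and the interpolations depend continuously on finitely many increments.\<close>

lemma content_functional_measurable:
  fixes Q :: "real^'d^'d" and b r :: "real^'d" and X :: "'a \<Rightarrow> real \<Rightarrow> real^'d"
  assumes Q: "routing_matrix Q" and r: "\<And>i. 0 \<le> r $ i" and b: "\<And>i. 0 \<le> b $ i" and T: "0 < T"
    and X: "\<And>t i. t \<in> {0..T} \<Longrightarrow> (\<lambda>\<omega>. X \<omega> t $ i) \<in> borel_measurable M"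
    and ip: "\<And>\<omega>. \<omega> \<in> space M \<Longrightarrow> input_path T (X \<omega>)"
    and zero: "\<And>\<omega>. \<omega> \<in> space M \<Longrightarrow> X \<omega> 0 = 0"
  shows "(\<lambda>\<omega>. content_functional T Q r b (X \<omega>)) \<in> borel_measurable M"
proof -
  obtain C where C: "0 < C" and
    grid: "\<And>m e (\<eta> :: real \<Rightarrow> real^'d) \<eta>'. 0 < m \<Longrightarrow> 0 \<le> e \<Longrightarrow> input_path T \<eta> \<Longrightarrow> input_path T \<eta>' \<Longrightarrow>
      (\<And>k i. 1 \<le> k \<Longrightarrow> k \<le> m \<Longrightarrow> \<eta> (real k * T / real m) $ i \<le> \<eta>' (real k * T / real m) $ i + e) \<Longrightarrow>
      (\<And>k i. 1 \<le> k \<Longrightarrow> k < m \<Longrightarrow>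
        \<eta>' (real k * T / real m) $ i \<le> \<eta> (real (Suc k) * T / real m) $ i + e) \<Longrightarrow>
      content_functional T Q r b \<eta> \<le> content_functional T Q r b \<eta>' + C * (T / real m + e)"
    using content_functional_grid_le[OF Q r b T] by blast
  define w where "w m \<omega> = (\<lambda>(k, i). X \<omega> (real (Suc k) * T / real (Suc m)) $ i -
      X \<omega> (real k * T / real (Suc m)) $ i)" for m \<omega>
  \<comment> \<open>Coordinates beyond the grid are set to 0, because only the values at times in
    [0,T] are known to be measurable.\<close>
  define w' where "w' m \<omega> = (\<lambda>(k, i). if k < Suc m then w m \<omega> (k, i) else 0)" for m \<omega>
  let ?g = "\<lambda>m (v :: nat \<times> 'd \<Rightarrow> real).
      content_functional T Q r b (grid_path T (Suc m) 0 (\<lambda>i k. \<bar>v (k, i)\<bar>))"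
  have "(\<lambda>\<omega>. ?g m (w' m \<omega>)) \<in> borel_measurable M" for m
  proof (rule measurable_compose[where f = "w' m"])
    show "?g m \<in> borel_measurable borel"
      by (intro borel_measurable_continuous_onI content_functional_grid_path_continuous Q r b T)
    show "w' m \<in> borel_measurable M"
    proof (rule measurable_coordinatewise_then_product)
      fix p :: "nat \<times> 'd"
      obtain k i where p: "p = (k, i)"
        by force
      show "(\<lambda>\<omega>. w' m \<omega> p) \<in> borel_measurable M"
      proof (cases "k < Suc m")
        case True
        then have "real k * T / real (Suc m) \<in> {0..T}" "real (Suc k) * T / real (Suc m) \<in> {0..T}"
          using T by (intro grid_time_in; simp)+
        then show ?thesis
          using X True by (simp add: p w'_def w_def)
      qed (simp add: p w'_def)
    qed
  qed
  then show ?thesis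
  proof (rule borel_measurable_LIMSEQ_real[rotated])
    fix \<omega> assume \<omega>: "\<omega> \<in> space M"
    let ?\<eta> = "X \<omega>" and ?\<eta>' = "\<lambda>m. grid_path T (Suc m) 0 (\<lambda>i k. \<bar>w' m \<omega> (k, i)\<bar>)"
    have at_grid: "?\<eta>' m (real k * T / real (Suc m)) $ i = ?\<eta> (real k * T / real (Suc m)) $ i"
      if k: "k \<le> Suc m" for m k i
    proof -
      have "?\<eta>' m (real k * T / real (Suc m)) $ i = (\<Sum>l<k. \<bar>w' m \<omega> (l, i)\<bar>)"
        using T k by (subst grid_path_at_grid) auto
      also have "\<dots> = (\<Sum>l<k. ?\<eta> (real (Suc l) * T / real (Suc m)) $ i - ?\<eta> (real l * T / real (Suc m)) $ i)"
      proof (rule sum.cong[OF refl])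
        fix l assume "l \<in> {..<k}"
        then have l: "l < Suc m"
          using k by auto
        have "?\<eta> (real l * T / real (Suc m)) $ i \<le> ?\<eta> (real (Suc l) * T / real (Suc m)) $ i"
          using T l grid_time_in[of T "Suc m" l] grid_time_in[of T "Suc m" "Suc l"]
          by (intro input_path_mono[OF ip[OF \<omega>]] divide_right_mono mult_right_mono) auto
        with l show "\<bar>w' m \<omega> (l, i)\<bar> =
            ?\<eta> (real (Suc l) * T / real (Suc m)) $ i - ?\<eta> (real l * T / real (Suc m)) $ i"
          by (simp add: w'_def w_def)
      qed
      also have "\<dots> = ?\<eta> (real k * T / real (Suc m)) $ i - ?\<eta> (real 0 * T / real (Suc m)) $ i"
        by (rule sum_lessThan_telescope)
      finally show ?thesis
        using zero[OF \<omega>] by simp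
    qed
    have ip': "input_path T (?\<eta>' m)" for m
      using T by (intro grid_path_input_path) auto
    have mono: "\<eta> (real k * T / real (Suc m)) $ i \<le> \<eta> (real (Suc k) * T / real (Suc m)) $ i"
      if "input_path T \<eta>" "k < Suc m" for \<eta> :: "real \<Rightarrow> real^'d" and k m i
      using T that grid_time_in[of T "Suc m" k] grid_time_in[of T "Suc m" "Suc k"]
      by (intro input_path_mono[OF that(1)] divide_right_mono mult_right_mono) auto
    have close: "\<bar>?g m (w' m \<omega>) - content_functional T Q r b ?\<eta>\<bar> \<le> C * (T / real (Suc m))" for m
    proof -
      have "content_functional T Q r b ?\<eta> \<le> ?g m (w' m \<omega>) + C * (T / real (Suc m) + 0)"
        using at_grid mono[OF ip[OF \<omega>]] by (intro grid ip ip' \<omega>) (auto simp: less_imp_le simp del: of_nat_Suc)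
      moreover have "?g m (w' m \<omega>) \<le> content_functional T Q r b ?\<eta> + C * (T / real (Suc m) + 0)"
        using at_grid mono[OF ip[OF \<omega>]] by (intro grid ip ip' \<omega>) (auto simp: less_imp_le simp del: of_nat_Suc)
      ultimately show ?thesis
        by (simp add: abs_le_iff)
    qed
    have "(\<lambda>m. ?g m (w' m \<omega>) - content_functional T Q r b ?\<eta>) \<longlonglongrightarrow> 0"
    proof (rule Lim_null_comparison)
      show "\<forall>\<^sub>F m in sequentially. norm (?g m (w' m \<omega>) - content_functional T Q r b ?\<eta>)
          \<le> C * (T / real (Suc m))"
        using close by (intro always_eventually) simp
      have "(\<lambda>m. T / real (Suc m)) \<longlonglongrightarrow> 0"
        by real_asymp
      then show "(\<lambda>m. C * (T / real (Suc m))) \<longlonglongrightarrow> 0"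
        by (rule tendsto_mult_right_zero)
    qed
    then show "(\<lambda>m. ?g m (w' m \<omega>)) \<longlonglongrightarrow> content_functional T Q r b ?\<eta>"
      by (simp only: LIM_zero_iff)
  qed
qed

section \<open>The network and its variational problem\<close>

locale stochastic_network = prob_space M for M :: "'a measure" +
  fixes T \<alpha> y :: real
    and Q :: "real^'d^'d"
    and r \<gamma> b :: "real^'d"
    and \<J> :: "'d set"
    and c :: "'d \<Rightarrow> real"
    and q :: "real \<Rightarrow> real"
    and N :: "'d \<Rightarrow> real \<Rightarrow> 'a \<Rightarrow> nat"
    and Y :: "'d \<Rightarrow> nat \<Rightarrow> 'a \<Rightarrow> real"
    and J :: "'d \<Rightarrow> real \<Rightarrow> 'a \<Rightarrow> real"
  assumes T: "0 < T"
    and Q: "routing_matrix Q"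
    and r: "0 \<le> r $ i"
    and b: "0 \<le> b $ i"
    and inputs: "i \<in> \<J> \<Longrightarrow> semiexponential_compound_poisson M (N i) (Y i) (J i) q \<alpha> (c i) (\<gamma> $ i)"
    and no_input: "i \<notin> \<J> \<Longrightarrow> 0 \<le> t \<Longrightarrow> \<omega> \<in> space M \<Longrightarrow> J i t \<omega> = 0"
    and no_mean: "i \<notin> \<J> \<Longrightarrow> \<gamma> $ i = 0"
    and independent: "independent_processes M J UNIV"
    and overflow_input: "\<J> \<inter> {j. 0 < b $ j} \<noteq> {}"
begin

lemma c_pos: "i \<in> \<J> \<Longrightarrow> 0 < c i"
  using inputs[of i] by (simp add: semiexponential_compound_poisson.c_pos)

lemma input_compound: "i \<in> \<J> \<Longrightarrow> compound_poisson M (N i) (Y i) (J i)"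
  using inputs[of i] by (simp add: semiexponential_compound_poisson_def)

lemma \<gamma>_nonneg: "0 \<le> \<gamma> $ i"
  using inputs[of i] no_mean[of i] semiexponential_compound_poisson.\<gamma>_nonneg by (cases "i \<in> \<J>") auto

lemma J_measurable [measurable]: "0 \<le> t \<Longrightarrow> J i t \<in> borel_measurable M"
proof (cases "i \<in> \<J>")
  case True
  then interpret compound_poisson M "N i" "Y i" "J i"
    by (rule input_compound)
  show "0 \<le> t \<Longrightarrow> J i t \<in> borel_measurable M"
    by (rule J_measurable)
next
  case False
  show "0 \<le> t \<Longrightarrow> J i t \<in> borel_measurable M"
    by (subst measurable_cong[OF no_input[OF False]]) auto
qed

lemma J_mono: "\<omega> \<in> space M \<Longrightarrow> 0 \<le> s \<Longrightarrow> s \<le> t \<Longrightarrow> J i s \<omega> \<le> J i t \<omega>"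
  using input_compound[of i] no_input[of i] by (cases "i \<in> \<J>") (auto simp: compound_poisson.J_mono)

lemma J_0: "\<omega> \<in> space M \<Longrightarrow> J i 0 \<omega> = 0"
  using input_compound[of i] no_input[of i] by (cases "i \<in> \<J>") (auto simp: compound_poisson.J_0)

sublocale rate: semiexponential_rate q \<alpha>
proof -
  obtain i where "i \<in> \<J>"
    using overflow_input by blast
  then show "semiexponential_rate q \<alpha>"
    using inputs[of i] by (simp add: semiexponential_compound_poisson_def)
qed

definition scaled_input :: "nat \<Rightarrow> 'a \<Rightarrow> real \<Rightarrow> real^'d" where
  "scaled_input n \<omega> t = (1 / real n) *\<^sub>R (\<chi> i. J i (real n * t) \<omega>)"

lemma scaled_input_path: "\<omega> \<in> space M \<Longrightarrow> input_path T (scaled_input n \<omega>)"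
  unfolding input_path_def scaled_input_def
  by (auto intro!: mono_onI divide_right_mono J_mono mult_left_mono simp: J_0)

lemma overflow_event:
  assumes n: "0 < n" and \<omega>: "\<omega> \<in> space M"
  shows "b \<bullet> scaled_buffer_content Q r J n \<omega> T = content_functional T Q r b (scaled_input n \<omega>)"
proof -
  have pot: "potential_content Q r J \<omega> = net_input Q r (\<lambda>t. \<chi> i. J i t \<omega>)"
    by (simp add: fun_eq_iff potential_content_def net_input_def)
  show ?thesis
    unfolding scaled_buffer_content_def buffer_content_def scaled_input_def[abs_def] pot
    by (rule content_map_rescale[OF r T]) (use n J_mono[OF \<omega>] J_0[OF \<omega>] in auto)
qed

lemma overflow_measurable:
  "{\<omega> \<in> space M. y \<le> content_functional T Q r b (scaled_input n \<omega>)} \<in> sets M"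
proof -
  have "(\<lambda>\<omega>. content_functional T Q r b (scaled_input n \<omega>)) \<in> borel_measurable M"
    by (rule content_functional_measurable[OF Q r b T _ scaled_input_path])
      (auto simp: scaled_input_def J_0 vec_eq_iff)
  then show ?thesis by measurable
qed

abbreviation V :: ereal where
  "V \<equiv> V_star_ge T \<alpha> Q r \<gamma> \<J> c b y"

definition grid_cost :: "nat \<Rightarrow> ('d \<Rightarrow> nat \<Rightarrow> real) \<Rightarrow> real" where
  "grid_cost m x = (\<Sum>i\<in>\<J>. c i * (\<Sum>k<m. x i k powr \<alpha>))"

lemma V_le_grid_cost:
  assumes m: "0 < m" and x: "\<And>i k. 0 \<le> x i k" "\<And>i k. i \<notin> \<J> \<Longrightarrow> x i k = 0"
    and y: "y \<le> content_functional T Q r b (grid_path T m \<gamma> x)"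
  shows "V \<le> ereal (grid_cost m x)"
proof -
  let ?\<xi> = "net_input Q r (grid_path T m \<gamma> x)"
  have D: "(\<lambda>t. ?\<xi> t $ i) \<in> D_jump_drift T ((\<gamma> - reflection_matrix Q *v r) $ i)" for i
    by (intro grid_path_D_jump_drift T m x)
  have "?\<xi> t $ i = - (reflection_matrix Q *v r) $ i * t" if "i \<notin> \<J>" for i t
    using that x(2) no_mean by (simp add: net_input_def grid_path_def)
  then have "rate_function T \<alpha> Q r \<gamma> \<J> c ?\<xi> =
      (\<Sum>i\<in>\<J>. ereal (c i) * jump_cost T \<alpha> (\<lambda>t. ?\<xi> t $ i))"
    using D by (simp add: rate_function_def)
  also have "\<dots> \<le> (\<Sum>i\<in>\<J>. ereal (c i) * ereal (\<Sum>k<m. x i k powr \<alpha>))"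
    using c_pos by (intro sum_mono ereal_mult_left_mono jump_cost_grid_path T m) (auto simp: less_imp_le)
  also have "\<dots> = ereal (grid_cost m x)"
    by (simp add: grid_cost_def)
  finally have "rate_function T \<alpha> Q r \<gamma> \<J> c ?\<xi> \<le> ereal (grid_cost m x)" .
  moreover have "?\<xi> \<in> V_ge T Q r \<gamma> b y"
    using D y by (simp add: V_ge_def content_functional_def)
  ultimately show ?thesis
    unfolding V_star_ge_def by (rule INF_lower2[rotated])
qed

lemma V_le_grid_cost_plus:
  assumes m: "0 < m" and x: "\<And>i k. 0 \<le> x i k" "\<And>i k. i \<notin> \<J> \<Longrightarrow> x i k = 0"
    and j: "j \<in> \<J>" "0 < b $ j" and a: "0 \<le> a"
    and y: "y - a * b $ j \<le> content_functional T Q r b (grid_path T m \<gamma> x)"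
  shows "V \<le> ereal (grid_cost m x + c j * a powr \<alpha>)"
proof -
  \<comment> \<open>Cell m - 1 jumps at T, so this is the final jump of
    \<open>content_functional_final_jump\<close>.\<close>
  define x' where "x' i k = x i k + (if i = j \<and> k = m - 1 then a else 0)" for i k
  have "grid_path T m \<gamma> x' t = grid_path T m \<gamma> x t + (if T \<le> t then a *\<^sub>R axis j 1 else 0)" for t
  proof -
    have "grid_path T m \<gamma> x' t $ i = (grid_path T m \<gamma> x t + (if T \<le> t then a *\<^sub>R axis j 1 else 0)) $ i" for i
    proof -
      have "(\<Sum>k<m. x' i k * indicator {real (Suc k) * T / real m..} t) =
          (\<Sum>k<m. x i k * indicator {real (Suc k) * T / real m..} t) +
          (\<Sum>k<m. if k = m - 1 then (if i = j then a * indicator {real (Suc k) * T / real m..} t else 0) else 0)"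
        unfolding sum.distrib[symmetric] by (intro sum.cong) (auto simp: x'_def algebra_simps)
      also have "(\<Sum>k<m. if k = m - 1 then (if i = j then a * indicator {real (Suc k) * T / real m..} t else 0) else 0)
          = (if i = j then a * indicator {real (Suc (m - 1)) * T / real m..} t else 0)"
        using m by (subst sum.delta) auto
      also have "real (Suc (m - 1)) * T / real m = T"
        using m by simp
      finally show ?thesis
        by (simp add: grid_path_def axis_def indicator_def)
    qed
    then show ?thesis
      by (simp add: vec_eq_iff)
  qed
  then have "grid_path T m \<gamma> x' = (\<lambda>t. grid_path T m \<gamma> x t + (if T \<le> t then a *\<^sub>R axis j 1 else 0))"
    by (rule ext)
  then have "content_functional T Q r b (grid_path T m \<gamma> x') =
      content_functional T Q r b (grid_path T m \<gamma> x) + a * b $ j"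
    using content_functional_final_jump[OF Q r T a grid_path_input_path[OF \<gamma>_nonneg x(1) T]] by simp
  then have "V \<le> ereal (grid_cost m x')"
    using m x j a y by (intro V_le_grid_cost) (auto simp: x'_def)
  also have "grid_cost m x' \<le> grid_cost m x + c j * a powr \<alpha>"
  proof -
    have "x' i k powr \<alpha> \<le> x i k powr \<alpha> + (if k = m - 1 then (if i = j then a powr \<alpha> else 0) else 0)" for i k
      using powr_subadditive[of "x i k" a \<alpha>] x(1) a rate.\<alpha> by (auto simp: x'_def)
    then have "grid_cost m x' \<le> (\<Sum>i\<in>\<J>. c i * (\<Sum>k<m. x i k powr \<alpha> +
        (if k = m - 1 then (if i = j then a powr \<alpha> else 0) else 0)))"
      unfolding grid_cost_def using c_pos by (intro sum_mono mult_left_mono) (auto simp: less_imp_le)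
    also have "\<dots> = grid_cost m x + (\<Sum>i\<in>\<J>. c i * (if i = j then a powr \<alpha> else 0))"
      using m by (simp add: grid_cost_def sum.distrib distrib_left sum.delta)
    also have "(\<Sum>i\<in>\<J>. c i * (if i = j then a powr \<alpha> else 0)) =
        (\<Sum>i\<in>\<J>. if i = j then c j * a powr \<alpha> else 0)"
      by (intro sum.cong) auto
    also have "\<dots> = c j * a powr \<alpha>"
      using j by (simp add: sum.delta)
    finally show ?thesis .
  qed
  finally show ?thesis by simp
qed

lemma V_nonneg: "0 \<le> V"
proof -
  have "0 \<le> jump_cost T \<alpha> \<xi>" for \<xi>
    unfolding jump_cost_def by (intro infsum_nonneg) simp
  then have "0 \<le> rate_function T \<alpha> Q r \<gamma> \<J> c \<xi>" for \<xi>
    using c_pos by (auto simp: rate_function_def less_imp_le intro!: sum_nonneg)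
  then show ?thesis
    unfolding V_star_ge_def by (intro INF_greatest)
qed

text \<open>The infimum is finite: starting from no jumps at all, one large final jump at a node of
  \<open>overflow_input\<close> reaches the level y.\<close>

lemma V_real: obtains v where "V = ereal v" "0 \<le> v"
proof -
  obtain j where j: "j \<in> \<J>" "0 < b $ j"
    using overflow_input by blast
  define a where "a = max 0 ((y - content_functional T Q r b (grid_path T 1 \<gamma> (\<lambda>i k. 0))) / b $ j)"
  have "(y - content_functional T Q r b (grid_path T 1 \<gamma> (\<lambda>i k. 0))) / b $ j \<le> a"
    by (simp add: a_def)
  then have "y - a * b $ j \<le> content_functional T Q r b (grid_path T 1 \<gamma> (\<lambda>i k. 0))"
    using j by (simp add: pos_divide_le_eq)
  then have "V \<le> ereal (grid_cost 1 (\<lambda>i k. 0) + c j * a powr \<alpha>)"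
    by (intro V_le_grid_cost_plus j) (auto simp: a_def)
  with V_nonneg show thesis
    using that by (cases V) auto
qed

lemma prob_joint_increments:
  assumes h: "0 < h" and A: "\<And>i k. A i k \<in> sets borel"
  shows "prob {\<omega> \<in> space M. \<forall>i\<in>\<J>. \<forall>k<m. J i (real (Suc k * h)) \<omega> - J i (real (k * h)) \<omega> \<in> A i k} =
    (\<Prod>i\<in>\<J>. \<Prod>k<m. prob {\<omega> \<in> space M. J i (real h) \<omega> \<in> A i k})"
proof -
  have ne: "\<J> \<noteq> {}"
    using overflow_input by blast
  let ?S = "Pi\<^sub>M {0..} (\<lambda>_. borel) :: (real \<Rightarrow> real) measure"
  define B where "B i = {p \<in> space ?S. \<forall>k<m. p (real (Suc k * h)) - p (real (k * h)) \<in> A i k}" for i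
  have [measurable]: "(\<lambda>p. p (real k)) \<in> borel_measurable ?S" for k
    by (rule measurable_component_singleton) simp
  have B: "B i \<in> sets ?S" for i
    unfolding B_def using A by measurable
  have ind: "indep_vars (\<lambda>_. ?S) (\<lambda>i \<omega>. \<lambda>t\<in>{0..}. J i t \<omega>) UNIV"
    using independent by (simp add: independent_processes_def)
  have pre: "(\<lambda>\<omega>. \<lambda>t\<in>{0..}. J i t \<omega>) -` B i \<inter> space M =
      {\<omega> \<in> space M. \<forall>k<m. J i (real (Suc k * h)) \<omega> - J i (real (k * h)) \<omega> \<in> A i k}" for i
    by (auto simp: B_def space_PiM simp del: of_nat_mult)
  have "{\<omega> \<in> space M. \<forall>i\<in>\<J>. \<forall>k<m. J i (real (Suc k * h)) \<omega> - J i (real (k * h)) \<omega> \<in> A i k} =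
      (\<Inter>i\<in>\<J>. (\<lambda>\<omega>. \<lambda>t\<in>{0..}. J i t \<omega>) -` B i \<inter> space M)"
    unfolding pre using ne by auto
  also have "prob \<dots> = (\<Prod>i\<in>\<J>. prob ((\<lambda>\<omega>. \<lambda>t\<in>{0..}. J i t \<omega>) -` B i \<inter> space M))"
    using ne B by (intro indep_varsD[OF ind]) auto
  also have "\<dots> = (\<Prod>i\<in>\<J>. \<Prod>k<m. prob {\<omega> \<in> space M. J i (real h) \<omega> \<in> A i k})"
  proof (rule prod.cong[OF refl])
    fix i assume "i \<in> \<J>"
    then interpret cp: compound_poisson M "N i" "Y i" "J i"
      by (rule input_compound)
    have "strict_mono (\<lambda>k. k * h)"
      using h by (simp add: strict_mono_Suc_iff)
    from cp.prob_increments[OF this, of "A i" m]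
    show "prob ((\<lambda>\<omega>. \<lambda>t\<in>{0..}. J i t \<omega>) -` B i \<inter> space M) =
        (\<Prod>k<m. prob {\<omega> \<in> space M. J i (real h) \<omega> \<in> A i k})"
      unfolding pre using A by (simp del: of_nat_mult)
  qed
  finally show ?thesis .
qed

end

section \<open>Blocks of integer length and the lower bound for the overflow probability\<close>

lemma floor_block_ratio:
  fixes \<delta> :: real
  assumes "0 < \<delta>"
  shows "(\<lambda>n. real (nat \<lfloor>real n * \<delta>\<rfloor>) / real n) \<longlonglongrightarrow> \<delta>"
proof (rule tendsto_sandwich)
  have "real n * \<delta> - 1 \<le> real (nat \<lfloor>real n * \<delta>\<rfloor>)" "real (nat \<lfloor>real n * \<delta>\<rfloor>) \<le> real n * \<delta>" for n
  proof -
    have "0 \<le> real n * \<delta>"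
      using assms by simp
    then show "real n * \<delta> - 1 \<le> real (nat \<lfloor>real n * \<delta>\<rfloor>)" "real (nat \<lfloor>real n * \<delta>\<rfloor>) \<le> real n * \<delta>"
      by linarith+
  qed
  then show "\<forall>\<^sub>F n in sequentially. (real n * \<delta> - 1) / real n \<le> real (nat \<lfloor>real n * \<delta>\<rfloor>) / real n"
    "\<forall>\<^sub>F n in sequentially. real (nat \<lfloor>real n * \<delta>\<rfloor>) / real n \<le> (real n * \<delta>) / real n"
    by (intro always_eventually allI divide_right_mono; simp del: of_nat_nat)+
  show "(\<lambda>n. (real n * \<delta> - 1) / real n) \<longlonglongrightarrow> \<delta>" "(\<lambda>n. (real n * \<delta>) / real n) \<longlonglongrightarrow> \<delta>"
    by real_asymp+
qed

lemma ceiling_block_ratio: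
  fixes \<delta> :: real
  assumes "0 < \<delta>"
  shows "(\<lambda>n. real (nat \<lceil>real n * \<delta>\<rceil>) / real n) \<longlonglongrightarrow> \<delta>"
proof (rule tendsto_sandwich)
  have "real (nat \<lceil>real n * \<delta>\<rceil>) \<le> real n * \<delta> + 1" "real n * \<delta> \<le> real (nat \<lceil>real n * \<delta>\<rceil>)" for n
  proof -
    have "0 \<le> real n * \<delta>"
      using assms by simp
    then show "real (nat \<lceil>real n * \<delta>\<rceil>) \<le> real n * \<delta> + 1" "real n * \<delta> \<le> real (nat \<lceil>real n * \<delta>\<rceil>)"
      by linarith+
  qed
  then show "\<forall>\<^sub>F n in sequentially. real (nat \<lceil>real n * \<delta>\<rceil>) / real n \<le> (real n * \<delta> + 1) / real n"
    "\<forall>\<^sub>F n in sequentially. (real n * \<delta>) / real n \<le> real (nat \<lceil>real n * \<delta>\<rceil>) / real n"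
    by (intro always_eventually allI divide_right_mono; simp del: of_nat_nat)+
  show "(\<lambda>n. (real n * \<delta> + 1) / real n) \<longlonglongrightarrow> \<delta>" "(\<lambda>n. (real n * \<delta>) / real n) \<longlonglongrightarrow> \<delta>"
    by real_asymp+
qed

lemma small_powr_ex:
  fixes A B e \<alpha> :: real
  assumes "0 < \<alpha>" "0 < e" "0 \<le> B"
  obtains p :: nat where "A * (B / real (Suc p)) powr \<alpha> < e"
proof -
  have "(\<lambda>p. B / real (Suc p)) \<longlonglongrightarrow> 0"
    by real_asymp
  then have "(\<lambda>p. A * (B / real (Suc p)) powr \<alpha>) \<longlonglongrightarrow> A * 0 powr \<alpha>"
    using assms by (intro tendsto_mult tendsto_const tendsto_powr') auto
  then have "(\<lambda>p. A * (B / real (Suc p)) powr \<alpha>) \<longlonglongrightarrow> 0"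
    by simp
  then have "\<forall>\<^sub>F p in sequentially. A * (B / real (Suc p)) powr \<alpha> < e"
    using assms(2) by (rule order_tendstoD)
  then show thesis
    using that by (auto simp: eventually_sequentially)
qed

lemma eventually_all_blocks:
  fixes m :: nat
  assumes "finite I" "\<And>i k. i \<in> I \<Longrightarrow> k < m \<Longrightarrow> \<forall>\<^sub>F n in F. P n i k"
  shows "\<forall>\<^sub>F n in F. \<forall>i\<in>I. \<forall>k<m. P n i k"
proof -
  have "\<forall>\<^sub>F n in F. \<forall>i\<in>I. \<forall>k\<in>{..<m}. P n i k"
    using assms by (intro eventually_ball_finite ballI) auto
  then show ?thesis
    by (auto elim: eventually_mono)
qed

lemma prod_exp_blocks:
  fixes f :: "'i \<Rightarrow> nat \<Rightarrow> real"
  assumes "finite I"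
  shows "(\<Prod>i\<in>I. \<Prod>k<m. exp (- (f i k + s) * t)) =
    exp (- ((\<Sum>i\<in>I. \<Sum>k<m. f i k) + real (card I * m) * s) * t)"
proof -
  have "(\<Prod>i\<in>I. \<Prod>k<m. exp (- (f i k + s) * t)) = exp (\<Sum>i\<in>I. \<Sum>k<m. - (f i k + s) * t)"
    using assms by (simp add: exp_sum)
  also have "(\<Sum>i\<in>I. \<Sum>k<m. - (f i k + s) * t) = - (\<Sum>i\<in>I. \<Sum>k<m. f i k + s) * t"
    by (simp only: sum_distrib_right[symmetric] sum_negf)
  also have "(\<Sum>i\<in>I. \<Sum>k<m. f i k + s) = (\<Sum>i\<in>I. \<Sum>k<m. f i k) + real (card I * m) * s"
    by (simp add: sum.distrib)
  finally show ?thesis .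
qed

context stochastic_network
begin

lemma finite_\<J> [simp]: "finite \<J>"
  by simp

lemma J_block_sum:
  assumes "\<omega> \<in> space M"
  shows "J i (real (k * h)) \<omega> = (\<Sum>l<k. J i (real (Suc l * h)) \<omega> - J i (real (l * h)) \<omega>)"
  using sum_lessThan_telescope[of "\<lambda>l. J i (real (l * h)) \<omega>" k] J_0[OF assms]
  by (simp del: of_nat_mult)

lemma prob_block:
  assumes h: "0 < h" and i: "i \<in> \<J>" and A: "A \<in> sets borel"
  shows "prob {\<omega> \<in> space M. J i (real (Suc k * h)) \<omega> - J i (real (k * h)) \<omega> \<in> A} =
    prob {\<omega> \<in> space M. J i (real h) \<omega> \<in> A}"
proof -
  interpret cp: compound_poisson M "N i" "Y i" "J i"
    by (rule input_compound[OF i])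
  \<comment> \<open>The earlier cells are left free and contribute factors 1.\<close>
  define B where "B l = (if l = k then A else UNIV)" for l
  have "strict_mono (\<lambda>k. k * h)"
    using h by (simp add: strict_mono_Suc_iff)
  then have "prob {\<omega> \<in> space M. \<forall>l<Suc k. J i (real (Suc l * h)) \<omega> - J i (real (l * h)) \<omega> \<in> B l} =
      (\<Prod>l<Suc k. prob {\<omega> \<in> space M. J i (real (Suc l * h - l * h)) \<omega> \<in> B l})"
    using A by (intro cp.prob_increments) (auto simp: B_def)
  also have "\<dots> = (\<Prod>l<Suc k. if l = k then prob {\<omega> \<in> space M. J i (real h) \<omega> \<in> A} else 1)"
    by (intro prod.cong) (auto simp: B_def prob_space)
  also have "\<dots> = prob {\<omega> \<in> space M. J i (real h) \<omega> \<in> A}"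
    by (simp add: prod.delta)
  also have "{\<omega> \<in> space M. \<forall>l<Suc k. J i (real (Suc l * h)) \<omega> - J i (real (l * h)) \<omega> \<in> B l} =
      {\<omega> \<in> space M. J i (real (Suc k * h)) \<omega> - J i (real (k * h)) \<omega> \<in> A}"
    by (auto simp: B_def simp del: of_nat_mult mult_Suc)
  finally show ?thesis .
qed

text \<open>A nearly optimal path becomes a finite pattern of cell increments, and every increment
  of the input is forced into a window at this pattern; independence adds the exponents. The slack e
  is split in four: near-optimality, the final jump, the lifts \<kappa>, and the tail
  estimates.\<close>

lemma overflow_prob_ge:
  assumes v: "V = ereal v" and e: "0 < e"
  shows "\<forall>\<^sub>F n in sequentially. exp (- (v + e) * q (real n)) \<le>
    prob {\<omega> \<in> space M. y \<le> content_functional T Q r b (scaled_input n \<omega>)}"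
proof -
  let ?R = "reflection_matrix Q"
  obtain j where j: "j \<in> \<J>" "0 < b $ j"
    using overflow_input by blast
  obtain C where C: "0 < C" and
    grid: "\<And>m e (\<eta> :: real \<Rightarrow> real^'d) \<eta>'. 0 < m \<Longrightarrow> 0 \<le> e \<Longrightarrow> input_path T \<eta> \<Longrightarrow> input_path T \<eta>' \<Longrightarrow>
      (\<And>k i. 1 \<le> k \<Longrightarrow> k \<le> m \<Longrightarrow> \<eta> (real k * T / real m) $ i \<le> \<eta>' (real k * T / real m) $ i + e) \<Longrightarrow>
      (\<And>k i. 1 \<le> k \<Longrightarrow> k < m \<Longrightarrow>
        \<eta>' (real k * T / real m) $ i \<le> \<eta> (real (Suc k) * T / real m) $ i + e) \<Longrightarrow>
      content_functional T Q r b \<eta> \<le> content_functional T Q r b \<eta>' + C * (T / real m + e)"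
    using content_functional_grid_le[OF Q r b T] by blast
  have "V < ereal (v + e / 4)"
    using v e by simp
  then obtain \<xi> where \<xi>: "\<xi> \<in> V_ge T Q r \<gamma> b y" and rate: "rate_function T \<alpha> Q r \<gamma> \<J> c \<xi> < ereal (v + e / 4)"
    unfolding V_star_ge_def INF_less_iff by blast
  have D: "(\<lambda>t. \<xi> t $ i) \<in> D_jump_drift T ((\<gamma> - ?R *v r) $ i)" for i
    using \<xi> by (simp add: V_ge_def)
  have off: "\<xi> t $ i = - (?R *v r) $ i * t" if "i \<notin> \<J>" "t \<in> {0..T}" for i t
    using rate that unfolding rate_function_def by (auto split: if_splits)
  have cost: "(\<Sum>i\<in>\<J>. ereal (c i) * jump_cost T \<alpha> (\<lambda>t. \<xi> t $ i)) < ereal (v + e / 4)"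
    using rate unfolding rate_function_def by (auto split: if_splits)
  \<comment> \<open>Adding the drain back leaves the jumps plus the mean input \<gamma> t, which is
    nondecreasing because \<gamma> \<ge> 0.\<close>
  define \<eta> where "\<eta> t = \<xi> t + t *\<^sub>R (?R *v r)" for t
  have \<eta>_path: "input_path T \<eta>"
    unfolding input_path_def
  proof (intro allI conjI mono_onI)
    fix i
    obtain h where h: "h \<in> D_up {0..T}" "\<And>t. \<xi> t $ i = h t + (\<gamma> - ?R *v r) $ i * t"
      using D[of i] unfolding D_jump_drift_def D_jump_def by (auto simp: fun_eq_iff)
    have \<eta>_i: "\<eta> t $ i = h t + \<gamma> $ i * t" for t
      by (simp add: \<eta>_def h(2) algebra_simps)
    show "0 \<le> \<eta> 0 $ i"
      using h(1) by (simp add: \<eta>_i D_up_def)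
    show "\<eta> s $ i \<le> \<eta> t $ i" if "s \<in> {0..T}" "t \<in> {0..T}" "s \<le> t" for s t
      unfolding \<eta>_i using that by (intro add_mono mult_left_mono D_up_mono[OF h(1)] \<gamma>_nonneg) auto
  qed
  have "net_input Q r \<eta> = \<xi>"
    by (simp add: fun_eq_iff net_input_def \<eta>_def)
  then have F_\<eta>: "y \<le> content_functional T Q r b \<eta>"
    using \<xi> by (simp add: content_functional_def V_ge_def)
  \<comment> \<open>The mesh is dictated by the price of the final jump: its size a = 2 C \<delta> /
    b_j repairs the content error C (\<delta> + \<delta>), from the mesh and from the
    windows.\<close>
  obtain m' where m': "c j * (2 * C * T / b $ j / real (Suc m')) powr \<alpha> < e / 4"
    using small_powr_ex[of \<alpha> "e / 4" "2 * C * T / b $ j" "c j"] rate.\<alpha> e C T j by auto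
  define m where "m = Suc m'"
  define \<delta> where "\<delta> = T / real m"
  define a where "a = 2 * C * \<delta> / b $ j"
  have m: "0 < m" and \<delta>: "0 < \<delta>" and a: "0 < a"
    using T C j by (simp_all add: m_def \<delta>_def a_def)
  have a_cost: "c j * a powr \<alpha> < e / 4"
    using m' by (simp add: a_def \<delta>_def m_def mult.commute)
  have kd: "real k * T / real m = real k * \<delta>" for k
    by (simp add: \<delta>_def)
  have kd_in: "real k * \<delta> \<in> {0..T}" if "k \<le> m" for k
    using grid_time_in[OF T m that] by (simp add: kd)
  \<comment> \<open>Suc p shrinks \<kappa> until the lifts of all cells cost less than e / 4 in
    total, while 2 m \<kappa> \<le> \<delta> keeps the windows within the mesh error.\<close>
  obtain p where p: "(\<Sum>i\<in>\<J>. c i) * real m * (\<delta> / (2 * real m) / real (Suc p)) powr \<alpha> < e / 4"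
    using small_powr_ex[of \<alpha> "e / 4" "\<delta> / (2 * real m)" "(\<Sum>i\<in>\<J>. c i) * real m"] rate.\<alpha> e \<delta> by auto
  define \<kappa> where "\<kappa> = \<delta> / (2 * real m) / real (Suc p)"
  have \<kappa>: "0 < \<kappa>" "2 * real m * \<kappa> \<le> \<delta>"
  proof -
    show "0 < \<kappa>"
      using \<delta> m by (simp add: \<kappa>_def)
    have "\<delta> / real (Suc p) \<le> \<delta> / 1"
      using \<delta> by (intro divide_left_mono) auto
    then show "2 * real m * \<kappa> \<le> \<delta>"
      using m by (simp add: \<kappa>_def)
  qed
  define d where "d i k = \<eta> (real (Suc k) * \<delta>) $ i - (if k = 0 then 0 else \<eta> (real k * \<delta>) $ i) - \<gamma> $ i * \<delta>"
    for i k
  have d_eq: "d i k = \<xi> (real (Suc k) * T / real m) $ i - (if k = 0 then 0 else \<xi> (real k * T / real m) $ i) -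
      (\<gamma> - ?R *v r) $ i * (T / real m)" for i k
    unfolding kd by (simp add: d_def \<eta>_def \<delta>_def[symmetric] algebra_simps)
  have d_nonneg: "0 \<le> d i k" if "k < m" for i k
    unfolding d_eq using that by (intro jump_cost_ge_increments(1)[OF D T m rate.\<alpha>])
  have d_cost: "(\<Sum>i\<in>\<J>. c i * (\<Sum>k<m. d i k powr \<alpha>)) < v + e / 4"
  proof -
    have "ereal (\<Sum>i\<in>\<J>. c i * (\<Sum>k<m. d i k powr \<alpha>)) = (\<Sum>i\<in>\<J>. ereal (c i) * ereal (\<Sum>k<m. d i k powr \<alpha>))"
      by simp
    also have "\<dots> \<le> (\<Sum>i\<in>\<J>. ereal (c i) * jump_cost T \<alpha> (\<lambda>t. \<xi> t $ i))"
      unfolding d_eq using c_pos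
      by (intro sum_mono ereal_mult_left_mono jump_cost_ge_increments(2)[OF D T m rate.\<alpha>])
        (auto simp: less_imp_le)
    also note cost
    finally show ?thesis
      by simp
  qed
  have \<eta>_grid: "\<eta> (real k * \<delta>) $ i = (\<Sum>l<k. \<gamma> $ i * \<delta> + d i l)" if "1 \<le> k" for k i
  proof -
    have "(\<Sum>l<k. \<gamma> $ i * \<delta> + d i l) =
        (\<Sum>l<k. (if Suc l = 0 then 0 else \<eta> (real (Suc l) * \<delta>) $ i) - (if l = 0 then 0 else \<eta> (real l * \<delta>) $ i))"
      by (intro sum.cong) (auto simp: d_def)
    also have "\<dots> = (if k = 0 then 0 else \<eta> (real k * \<delta>) $ i) - (if (0::nat) = 0 then 0 else \<eta> (real 0 * \<delta>) $ i)"
      by (rule sum_lessThan_telescope)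
    finally show ?thesis
      using that by simp
  qed
  define \<eta>' where "\<eta>' t = \<eta> t + (if T \<le> t then a *\<^sub>R axis j 1 else 0)" for t
  have \<eta>'_path: "input_path T \<eta>'"
    unfolding input_path_def
  proof (intro allI conjI mono_onI)
    fix i
    show "0 \<le> \<eta>' 0 $ i"
      using \<eta>_path T by (simp add: \<eta>'_def input_path_def)
    show "\<eta>' s $ i \<le> \<eta>' t $ i" if "s \<in> {0..T}" "t \<in> {0..T}" "s \<le> t" for s t
    proof -
      have "\<eta> s $ i \<le> \<eta> t $ i"
        using that by (intro input_path_mono[OF \<eta>_path]) auto
      then show ?thesis
        using that a by (auto simp: \<eta>'_def axis_def)
    qed
  qed
  have F_\<eta>': "content_functional T Q r b \<eta>' = content_functional T Q r b \<eta> + 2 * C * \<delta>"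
    using content_functional_final_jump[OF Q r T _ \<eta>_path, of a b j] a j by (simp add: \<eta>'_def[abs_def] a_def)
  \<comment> \<open>The lift \<kappa> makes every target strictly positive, as
    \<open>prob_window_ge\<close> requires, even for cells without a jump.\<close>
  define x where "x i k = d i k + \<kappa> + (if i = j \<and> k = m - 1 then a else 0)" for i k
  have x_pos: "0 < x i k" if "k < m" for i k
  proof -
    have "0 \<le> (if i = j \<and> k = m - 1 then a else 0)"
      using a by simp
    with d_nonneg[OF that, of i] \<kappa>(1) show ?thesis
      unfolding x_def by linarith
  qed
  have \<eta>'_grid: "\<eta>' (real k * \<delta>) $ i = (\<Sum>l<k. \<gamma> $ i * \<delta> + x i l) - real k * \<kappa>" if k: "1 \<le> k" "k \<le> m" for k i
  proof -
    have "T \<le> real k * \<delta> \<longleftrightarrow> k = m"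
      using k T m by (auto simp: \<delta>_def field_simps)
    moreover have "(\<Sum>l<k. if i = j \<and> l = m - 1 then a else 0) = (if i = j \<and> k = m then a else 0)"
    proof (cases "i = j")
      case True
      then have "(\<Sum>l<k. if i = j \<and> l = m - 1 then a else 0) = (\<Sum>l<k. if l = m - 1 then a else 0)"
        by simp
      also have "\<dots> = (if m - 1 < k then a else 0)"
        by (simp add: sum.delta)
      finally show ?thesis
        using True k m by auto
    qed simp
    moreover have "(\<Sum>l<k. \<gamma> $ i * \<delta> + x i l) =
        (\<Sum>l<k. \<gamma> $ i * \<delta> + d i l) + real k * \<kappa> + (\<Sum>l<k. if i = j \<and> l = m - 1 then a else 0)"
      unfolding x_def by (simp add: sum.distrib)
    ultimately show ?thesis
      using \<eta>_grid[OF k(1), of i] by (auto simp: \<eta>'_def axis_def)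
  qed
  have \<eta>'_off: "\<eta>' t $ i = 0" if "i \<notin> \<J>" "t \<in> {0..T}" for i t
    using off[OF that] that j by (auto simp: \<eta>'_def \<eta>_def axis_def)
  have x_cost: "(\<Sum>i\<in>\<J>. \<Sum>k<m. c i * x i k powr \<alpha>) < v + 3 / 4 * e"
  proof -
    have "x i k powr \<alpha> \<le> d i k powr \<alpha> + \<kappa> powr \<alpha> + (if k = m - 1 then (if i = j then a powr \<alpha> else 0) else 0)"
      if "k < m" for i k
    proof -
      have "x i k powr \<alpha> \<le> (d i k + \<kappa>) powr \<alpha> + (if k = m - 1 then (if i = j then a powr \<alpha> else 0) else 0)"
        using powr_subadditive[of "d i k + \<kappa>" a \<alpha>] d_nonneg[OF that] \<kappa> a rate.\<alpha> by (auto simp: x_def)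
      moreover have "(d i k + \<kappa>) powr \<alpha> \<le> d i k powr \<alpha> + \<kappa> powr \<alpha>"
        using d_nonneg[OF that] \<kappa> rate.\<alpha> by (intro powr_subadditive) auto
      ultimately show ?thesis
        by linarith
    qed
    then have "(\<Sum>i\<in>\<J>. \<Sum>k<m. c i * x i k powr \<alpha>) \<le> (\<Sum>i\<in>\<J>. \<Sum>k<m. c i *
        (d i k powr \<alpha> + \<kappa> powr \<alpha> + (if k = m - 1 then (if i = j then a powr \<alpha> else 0) else 0)))"
      using c_pos by (intro sum_mono mult_left_mono) (auto simp: less_imp_le)
    also have "\<dots> = (\<Sum>i\<in>\<J>. c i * (\<Sum>k<m. d i k powr \<alpha>)) + (\<Sum>i\<in>\<J>. c i) * real m * \<kappa> powr \<alpha> +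
        (\<Sum>i\<in>\<J>. c i * (if i = j then a powr \<alpha> else 0))"
      using m unfolding sum_distrib_left[symmetric]
      by (simp add: sum.distrib distrib_left sum.delta sum_distrib_right mult.assoc)
    also have "(\<Sum>i\<in>\<J>. c i * (if i = j then a powr \<alpha> else 0)) = (\<Sum>i\<in>\<J>. if i = j then c j * a powr \<alpha> else 0)"
      by (intro sum.cong) auto
    also have "\<dots> = c j * a powr \<alpha>"
      using j by (simp add: sum.delta)
    finally show ?thesis
      using d_cost a_cost p by (simp add: \<kappa>_def)
  qed
  define P where "P = card \<J> * m"
  define e' where "e' = e / (4 * (real P + 1))"
  have e': "0 < e'" "real P * e' \<le> e / 4"
  proof -
    have D0: "0 < 4 * (real P + 1)"
      by simp
    then show "0 < e'"
      using e by (simp add: e'_def)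
    have "(real P + 1) * e' = e / 4"
      using D0 by (simp add: e'_def field_simps)
    then show "real P * e' \<le> e / 4"
      using \<open>0 < e'\<close> by (simp add: distrib_right)
  qed
  (* Independence of counts and jump sizes is available at integer times only.  Rounding the block
     length down keeps the block ends before the grid times, which is the safe side here. *)
  define h where "h n = nat \<lfloor>real n * \<delta>\<rfloor>" for n
  have h_lim: "(\<lambda>n. real (h n) / real n) \<longlonglongrightarrow> \<delta>"
    unfolding h_def by (rule floor_block_ratio[OF \<delta>])
  \<comment> \<open>Rounding moves the end of block k by at most k \<le> m time units, so under this
    bound it stays within one cell of its grid time.\<close>
  have large: "\<forall>\<^sub>F n in sequentially. real m \<le> real n * \<delta>"
    by (intro filterlim_at_top[THEN iffD1, rule_format]
        filterlim_at_top_mult_tendsto_pos[OF tendsto_const \<delta> filterlim_real_sequentially])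
  have h_pos: "\<forall>\<^sub>F n in sequentially. 0 < h n"
    using large
  proof eventually_elim
    case (elim n)
    then have "1 \<le> real n * \<delta>"
      using m by linarith
    then show ?case
      by (simp add: h_def)
  qed
  define A where "A n i k = {real n * (\<gamma> $ i * \<delta> + x i k)..<real n * (\<gamma> $ i * \<delta> + (x i k + \<kappa>))}" for n i k
  have windows: "\<forall>\<^sub>F n in sequentially. \<forall>i\<in>\<J>. \<forall>k<m.
      exp (- (c i * x i k powr \<alpha> + e') * q (real n)) \<le> prob {\<omega> \<in> space M. J i (real (h n)) \<omega> \<in> A n i k}"
  proof (rule eventually_all_blocks)
    fix i k assume i: "i \<in> \<J>" and k: "k < m"
    interpret sp: semiexponential_compound_poisson M "N i" "Y i" "J i" q \<alpha> "c i" "\<gamma> $ i"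
      by (rule inputs[OF i])
    show "\<forall>\<^sub>F n in sequentially. exp (- (c i * x i k powr \<alpha> + e') * q (real n))
        \<le> prob {\<omega> \<in> space M. J i (real (h n)) \<omega> \<in> A n i k}"
      using sp.prob_window_ge[OF h_lim \<delta> h_pos x_pos[OF k] \<kappa>(1) e'(1), of i]
      by (simp add: A_def)
  qed simp
  show ?thesis
    using windows large h_pos eventually_gt_at_top[of 0]
  proof eventually_elim
    case (elim n)
    have h_bounds: "real (h n) \<le> real n * \<delta>" "real n * \<delta> - 1 \<le> real (h n)"
    proof -
      have "0 \<le> real n * \<delta>"
        using \<delta> by simp
      then show "real (h n) \<le> real n * \<delta>" "real n * \<delta> - 1 \<le> real (h n)"
        unfolding h_def by linarith+
    qed
    let ?E = "{\<omega> \<in> space M. \<forall>i\<in>\<J>. \<forall>k<m.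
        J i (real (Suc k * h n)) \<omega> - J i (real (k * h n)) \<omega> \<in> A n i k}"
    have "?E \<subseteq> {\<omega> \<in> space M. y \<le> content_functional T Q r b (scaled_input n \<omega>)}"
    proof safe
      fix \<omega> assume \<omega>: "\<omega> \<in> space M"
        and inc: "\<forall>i\<in>\<J>. \<forall>k<m. J i (real (Suc k * h n)) \<omega> - J i (real (k * h n)) \<omega> \<in> A n i k"
      \<comment> \<open>After division by n, the lower ends of the first k windows add up to \<eta>'
        plus k \<kappa>: one \<kappa> per cell is this lift, a second one is the width of the
        window.\<close>
      have block: "real n * (\<eta>' (real k * \<delta>) $ i) \<le> J i (real (k * h n)) \<omega>"
        "J i (real (k * h n)) \<omega> \<le> real n * (\<eta>' (real k * \<delta>) $ i + 2 * real m * \<kappa>)"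
        if k: "1 \<le> k" "k \<le> m" and i: "i \<in> \<J>" for k i
      proof -
        have cell: "real n * (\<gamma> $ i * \<delta> + x i l) \<le> J i (real (Suc l * h n)) \<omega> - J i (real (l * h n)) \<omega>"
          "J i (real (Suc l * h n)) \<omega> - J i (real (l * h n)) \<omega> \<le> real n * (\<gamma> $ i * \<delta> + x i l) + real n * \<kappa>"
          if "l < k" for l
          using inc[rule_format, OF i, of l] k that by (auto simp: A_def algebra_simps simp del: of_nat_mult mult_Suc)
        have "real n * (\<Sum>l<k. \<gamma> $ i * \<delta> + x i l) \<le> J i (real (k * h n)) \<omega>"
          unfolding J_block_sum[OF \<omega>, of i k] sum_distrib_left using cell by (intro sum_mono) auto
        then have "real n * (\<eta>' (real k * \<delta>) $ i) + real n * (real k * \<kappa>) \<le> J i (real (k * h n)) \<omega>"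
          unfolding \<eta>'_grid[OF k] by (simp add: right_diff_distrib)
        then show "real n * (\<eta>' (real k * \<delta>) $ i) \<le> J i (real (k * h n)) \<omega>"
          using \<kappa> by (smt (verit) mult_nonneg_nonneg of_nat_0_le_iff)
        have "J i (real (k * h n)) \<omega> \<le> (\<Sum>l<k. real n * (\<gamma> $ i * \<delta> + x i l) + real n * \<kappa>)"
          unfolding J_block_sum[OF \<omega>, of i k] using cell by (intro sum_mono) auto
        also have "\<dots> = real n * (\<Sum>l<k. \<gamma> $ i * \<delta> + x i l) + real n * (real k * \<kappa>)"
          by (simp add: sum.distrib sum_distrib_left[symmetric])
        also have "\<dots> = real n * (\<eta>' (real k * \<delta>) $ i + 2 * real k * \<kappa>)"
          unfolding \<eta>'_grid[OF k] by (simp add: right_diff_distrib distrib_left)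
        also have "\<dots> \<le> real n * (\<eta>' (real k * \<delta>) $ i + 2 * real m * \<kappa>)"
          using k \<kappa> by (intro mult_left_mono add_left_mono mult_right_mono) auto
        finally show "J i (real (k * h n)) \<omega> \<le> real n * (\<eta>' (real k * \<delta>) $ i + 2 * real m * \<kappa>)" .
      qed
      have "content_functional T Q r b \<eta>' \<le> content_functional T Q r b (scaled_input n \<omega>) +
          C * (T / real m + 2 * real m * \<kappa>)"
      proof (rule grid[OF m _ \<eta>'_path scaled_input_path[OF \<omega>]])
        show "0 \<le> 2 * real m * \<kappa>"
          using \<kappa> by simp
        fix k i assume k: "1 \<le> (k :: nat)"
        \<comment> \<open>Block k ends no later than grid time k, so the lower bound transfers by
          monotonicity; for the upper bound, block k + 1 ends no earlier than grid time k.\<close>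
        show "\<eta>' (real k * T / real m) $ i \<le> scaled_input n \<omega> (real k * T / real m) $ i + 2 * real m * \<kappa>"
          if "k \<le> m"
        proof (cases "i \<in> \<J>")
          case True
          have "real k * real (h n) \<le> real k * (real n * \<delta>)"
            by (intro mult_left_mono h_bounds) simp
          then have "J i (real (k * h n)) \<omega> \<le> J i (real n * (real k * \<delta>)) \<omega>"
            by (intro J_mono[OF \<omega>]) (auto simp: mult_ac)
          with block(1)[OF k that True] have "real n * (\<eta>' (real k * \<delta>) $ i) \<le> J i (real n * (real k * \<delta>)) \<omega>"
            by linarith
          then have "\<eta>' (real k * \<delta>) $ i \<le> scaled_input n \<omega> (real k * \<delta>) $ i"
            using \<open>0 < n\<close> by (simp add: scaled_input_def field_simps)
          then show ?thesis
            using \<kappa> by (simp add: kd add_increasing2)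
        next
          case False
          have "0 \<le> scaled_input n \<omega> (real k * \<delta>) $ i"
            using kd_in[OF that] by (intro input_path_nonneg[OF scaled_input_path[OF \<omega>]])
          then show ?thesis
            using \<kappa> \<eta>'_off[OF False kd_in[OF that]] by (simp add: kd)
        qed
        show "scaled_input n \<omega> (real k * T / real m) $ i \<le> \<eta>' (real (Suc k) * T / real m) $ i + 2 * real m * \<kappa>"
          if "k < m"
        proof (cases "i \<in> \<J>")
          case True
          have "real n * (real k * \<delta>) \<le> real (Suc k) * (real n * \<delta> - 1)"
          proof -
            have "real (Suc k) \<le> real n * \<delta>"
              using elim that by linarith
            then show ?thesis
              by (simp add: algebra_simps)
          qed
          also have "\<dots> \<le> real (Suc k) * real (h n)"
            by (intro mult_left_mono h_bounds) simp
          finally have "J i (real n * (real k * \<delta>)) \<omega> \<le> J i (real (Suc k * h n)) \<omega>"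
            using \<delta> by (intro J_mono[OF \<omega>]) (auto simp: distrib_right)
          also have "\<dots> \<le> real n * (\<eta>' (real (Suc k) * \<delta>) $ i + 2 * real m * \<kappa>)"
            using that True by (intro block) auto
          finally show ?thesis
            using \<open>0 < n\<close> unfolding kd by (simp add: scaled_input_def pos_divide_le_eq mult.commute)
        next
          case False
          have "real n * (real k * \<delta>) \<ge> 0"
            using \<delta> by simp
          then have "scaled_input n \<omega> (real k * \<delta>) $ i = 0"
            using no_input[OF False _ \<omega>] by (simp add: scaled_input_def)
          moreover have "\<eta>' (real (Suc k) * \<delta>) $ i = 0"
            using that by (intro \<eta>'_off[OF False] kd_in) simp
          ultimately show ?thesis
            unfolding kd using \<kappa> by simp
        qed
      qed
      also have "C * (T / real m + 2 * real m * \<kappa>) \<le> C * (\<delta> + \<delta>)"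
        using C \<kappa> by (intro mult_left_mono) (auto simp: \<delta>_def)
      finally show "y \<le> content_functional T Q r b (scaled_input n \<omega>)"
        using F_\<eta> F_\<eta>' by simp
    qed
    then have "prob ?E \<le> prob {\<omega> \<in> space M. y \<le> content_functional T Q r b (scaled_input n \<omega>)}"
      by (intro finite_measure_mono overflow_measurable)
    moreover have "prob ?E = (\<Prod>i\<in>\<J>. \<Prod>k<m. prob {\<omega> \<in> space M. J i (real (h n)) \<omega> \<in> A n i k})"
      using elim by (intro prob_joint_increments) (auto simp: A_def)
    moreover have "(\<Prod>i\<in>\<J>. \<Prod>k<m. exp (- (c i * x i k powr \<alpha> + e') * q (real n))) \<le> \<dots>"
      using elim by (intro prod_mono conjI prod_nonneg) auto
    moreover have "(\<Prod>i\<in>\<J>. \<Prod>k<m. exp (- (c i * x i k powr \<alpha> + e') * q (real n))) =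
        exp (- ((\<Sum>i\<in>\<J>. \<Sum>k<m. c i * x i k powr \<alpha>) + real P * e') * q (real n))"
      unfolding P_def by (rule prod_exp_blocks) simp
    moreover have "exp (- (v + e) * q (real n)) \<le>
        exp (- ((\<Sum>i\<in>\<J>. \<Sum>k<m. c i * x i k powr \<alpha>) + real P * e') * q (real n))"
      unfolding exp_le_cancel_iff
      using x_cost e' e by (intro mult_right_mono rate.q_nonneg) auto
    ultimately show ?case
      by linarith
  qed
qed

end

section \<open>The upper bound for the overflow probability\<close>

context stochastic_network
begin

text \<open>On the overflow event some cell falls short of its mean, or some cell exceeds it by
  \<kappa> K, or the increments rounded to multiples of \<kappa> form one of finitely many patterns.
  Such a pattern, repaired by the final jump, is admissible for V, so it costs at least v - e / 4. A
  union bound over these events remains.\<close>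

lemma overflow_prob_le:
  assumes v: "V = ereal v" and v0: "0 \<le> v" and e: "0 < e"
  shows "\<forall>\<^sub>F n in sequentially.
    prob {\<omega> \<in> space M. y \<le> content_functional T Q r b (scaled_input n \<omega>)} \<le> exp (- (v - e) * q (real n))"
proof -
  obtain j where j: "j \<in> \<J>" "0 < b $ j"
    using overflow_input by blast
  obtain C where C: "0 < C" and
    grid: "\<And>m e (\<eta> :: real \<Rightarrow> real^'d) \<eta>'. 0 < m \<Longrightarrow> 0 \<le> e \<Longrightarrow> input_path T \<eta> \<Longrightarrow> input_path T \<eta>' \<Longrightarrow>
      (\<And>k i. 1 \<le> k \<Longrightarrow> k \<le> m \<Longrightarrow> \<eta> (real k * T / real m) $ i \<le> \<eta>' (real k * T / real m) $ i + e) \<Longrightarrow>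
      (\<And>k i. 1 \<le> k \<Longrightarrow> k < m \<Longrightarrow>
        \<eta>' (real k * T / real m) $ i \<le> \<eta> (real (Suc k) * T / real m) $ i + e) \<Longrightarrow>
      content_functional T Q r b \<eta> \<le> content_functional T Q r b \<eta>' + C * (T / real m + e)"
    using content_functional_grid_le[OF Q r b T] by blast
  \<comment> \<open>Again a repairs the error C (\<delta> + \<delta>); the second \<delta> is now
    the rounding error m \<kappa> of the increments.\<close>
  obtain m' where m': "c j * (2 * C * T / b $ j / real (Suc m')) powr \<alpha> < e / 4"
    using small_powr_ex[of \<alpha> "e / 4" "2 * C * T / b $ j" "c j"] rate.\<alpha> e C T j by auto
  define m where "m = Suc m'"
  define \<delta> where "\<delta> = T / real m"
  define a where "a = 2 * C * \<delta> / b $ j"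
  define \<kappa> where "\<kappa> = \<delta> / real m"
  have m: "0 < m" and \<delta>: "0 < \<delta>" and a: "0 < a" and \<kappa>: "0 < \<kappa>"
    using T C j by (simp_all add: m_def \<delta>_def a_def \<kappa>_def)
  have a_cost: "c j * a powr \<alpha> < e / 4"
    using m' by (simp add: a_def \<delta>_def m_def mult.commute)
  have m\<kappa>: "real m * \<kappa> = \<delta>"
    using m by (simp add: \<kappa>_def)
  have kd: "real k * T / real m = real k * \<delta>" for k
    by (simp add: \<delta>_def)
  have kd_in: "real k * \<delta> \<in> {0..T}" if "k \<le> m" for k
    using grid_time_in[OF T m that] by (simp add: kd)
  \<comment> \<open>The sum stands in for the maximum over the nodes: an excess of \<kappa> K in one
    cell costs at least v + 1, where 1 pays for the slack in the tail estimate.\<close>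
  define K where "K = nat \<lceil>(\<Sum>i\<in>\<J>. ((v + 1) / c i) powr (1 / \<alpha>)) / \<kappa>\<rceil>"
  have K: "v + 1 \<le> c i * (\<kappa> * real K) powr \<alpha>" if i: "i \<in> \<J>" for i
  proof -
    have "((v + 1) / c i) powr (1 / \<alpha>) \<le> (\<Sum>i\<in>\<J>. ((v + 1) / c i) powr (1 / \<alpha>))"
      using i by (intro member_le_sum) auto
    also have "\<dots> \<le> \<kappa> * real K"
    proof -
      have "(\<Sum>i\<in>\<J>. ((v + 1) / c i) powr (1 / \<alpha>)) / \<kappa> \<le> real K"
        unfolding K_def by linarith
      then show ?thesis
        using \<kappa> by (simp add: pos_divide_le_eq mult.commute)
    qed
    finally have "(((v + 1) / c i) powr (1 / \<alpha>)) powr \<alpha> \<le> (\<kappa> * real K) powr \<alpha>"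
      using rate.\<alpha> by (intro powr_mono2) auto
    then have "(v + 1) / c i \<le> (\<kappa> * real K) powr \<alpha>"
      using rate.\<alpha> v0 c_pos[OF i] by (simp add: powr_powr)
    then show ?thesis
      using c_pos[OF i] by (simp add: pos_divide_le_eq mult.commute)
  qed
  have K_pos: "0 < \<kappa> * real K"
  proof (rule ccontr)
    assume "\<not> 0 < \<kappa> * real K"
    then have "\<kappa> * real K = 0"
      using \<kappa> by (simp add: not_less mult_le_0_iff)
    with K[OF j(1)] v0 show False
      by simp
  qed
  define P where "P = card \<J> * m"
  define e' where "e' = e / (4 * (real P + 1))"
  have e': "0 < e'" "real P * e' \<le> e / 4"
  proof -
    have D0: "0 < 4 * (real P + 1)"
      by simp
    then show "0 < e'"
      using e by (simp add: e'_def)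
    have "(real P + 1) * e' = e / 4"
      using D0 by (simp add: e'_def field_simps)
    then show "real P * e' \<le> e / 4"
      using \<open>0 < e'\<close> by (simp add: distrib_right)
  qed
  (* Rounded up, so that the input up to a grid time is bounded by the input up to the block end. *)
  define h where "h n = nat \<lceil>real n * \<delta>\<rceil>" for n
  have h_lim: "(\<lambda>n. real (h n) / real n) \<longlonglongrightarrow> \<delta>"
    unfolding h_def by (rule ceiling_block_ratio[OF \<delta>])
  have large: "\<forall>\<^sub>F n in sequentially. real m \<le> real n * \<delta>"
    by (intro filterlim_at_top[THEN iffD1, rule_format]
        filterlim_at_top_mult_tendsto_pos[OF tendsto_const \<delta> filterlim_real_sequentially])
  have h_pos: "\<forall>\<^sub>F n in sequentially. 0 < h n"
    using large
  proof eventually_elim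
    case (elim n)
    then have "0 < real n * \<delta>"
      using m by linarith
    then show ?case
      by (simp add: h_def)
  qed
  define Low where "Low n i = {..real n * (\<gamma> $ i * \<delta> - \<kappa>)}" for n i
  define High where "High n i = {real n * (\<gamma> $ i * \<delta> + \<kappa> * real K)..}" for n i
  \<comment> \<open>Level 0 carries no constraint: its cost is 0, and it also collects the small
    negative deviations that \<open>nat\<close> truncates.\<close>
  define A where "A n i l = (if l = 0 then UNIV else {real n * (\<gamma> $ i * \<delta> + \<kappa> * real l)..})" for n i and l :: nat
  have low: "\<forall>\<^sub>F n in sequentially. \<forall>i\<in>\<J>. prob {\<omega> \<in> space M. J i (real (h n)) \<omega> \<in> Low n i} \<le> exp (- v * q (real n))"
  proof (intro eventually_ball_finite ballI)
    fix i assume i: "i \<in> \<J>"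
    interpret sp: semiexponential_compound_poisson M "N i" "Y i" "J i" q \<alpha> "c i" "\<gamma> $ i"
      by (rule inputs[OF i])
    show "\<forall>\<^sub>F n in sequentially. prob {\<omega> \<in> space M. J i (real (h n)) \<omega> \<in> Low n i} \<le> exp (- v * q (real n))"
      using sp.prob_lower_tail_le[OF h_lim h_pos \<kappa>, of v] by (simp add: Low_def)
  qed simp
  have high: "\<forall>\<^sub>F n in sequentially. \<forall>i\<in>\<J>. prob {\<omega> \<in> space M. J i (real (h n)) \<omega> \<in> High n i} \<le> exp (- v * q (real n))"
  proof (intro eventually_ball_finite ballI)
    fix i assume i: "i \<in> \<J>"
    interpret sp: semiexponential_compound_poisson M "N i" "Y i" "J i" q \<alpha> "c i" "\<gamma> $ i"
      by (rule inputs[OF i])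
    show "\<forall>\<^sub>F n in sequentially. prob {\<omega> \<in> space M. J i (real (h n)) \<omega> \<in> High n i} \<le> exp (- v * q (real n))"
      using sp.prob_upper_tail_le[OF h_lim h_pos K_pos zero_less_one] sp.q_real_pos
    proof eventually_elim
      case (elim n)
      have "exp (- (c i * (\<kappa> * real K) powr \<alpha> - 1) * q (real n)) \<le> exp (- v * q (real n))"
        using K[OF i] elim by (simp only: exp_le_cancel_iff) (intro mult_right_mono; linarith)
      then show ?case
        unfolding High_def atLeast_iff by (rule order_trans[OF elim(1)])
    qed
  qed simp
  have cells: "\<forall>\<^sub>F n in sequentially. \<forall>i\<in>\<J>. \<forall>l<Suc K. prob {\<omega> \<in> space M. J i (real (h n)) \<omega> \<in> A n i l}
      \<le> exp (- (c i * (\<kappa> * real l) powr \<alpha> - e') * q (real n))"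
  proof (rule eventually_all_blocks)
    fix i l assume i: "i \<in> \<J>"
    interpret sp: semiexponential_compound_poisson M "N i" "Y i" "J i" q \<alpha> "c i" "\<gamma> $ i"
      by (rule inputs[OF i])
    show "\<forall>\<^sub>F n in sequentially. prob {\<omega> \<in> space M. J i (real (h n)) \<omega> \<in> A n i l}
        \<le> exp (- (c i * (\<kappa> * real l) powr \<alpha> - e') * q (real n))"
    proof (cases "l = 0")
      case True
      show ?thesis
        using sp.q_real_pos
      proof eventually_elim
        case (elim n)
        have "1 \<le> exp (e' * q (real n))"
          using elim e' by simp
        then show ?case
          using True by (simp add: A_def prob_space)
      qed
    next
      case False
      then have "0 < \<kappa> * real l"
        using \<kappa> by simp
      from sp.prob_upper_tail_le[OF h_lim h_pos this e'(1)] False show ?thesis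
        by (simp add: A_def)
    qed
  qed simp
  define G where "G = Pi\<^sub>E \<J> (\<lambda>_. Pi\<^sub>E {..<m} (\<lambda>_. {..K}))"
  have fin_G: "finite G"
    unfolding G_def by (intro finite_PiE) auto
  define cost where "cost l = (\<Sum>i\<in>\<J>. \<Sum>k<m. c i * (\<kappa> * real (l i k)) powr \<alpha>)" for l :: "'d \<Rightarrow> nat \<Rightarrow> nat"
  define G' where "G' = {l \<in> G. v - e / 4 \<le> cost l}"
  have fin_G': "finite G'"
    using fin_G by (simp add: G'_def)
  \<comment> \<open>The number of events in the union bound is absorbed by half of the slack
    e.\<close>
  have const: "\<forall>\<^sub>F n in sequentially. 2 * real P + real (card G) \<le> exp (e / 2 * q (real n))"
  proof -
    have "\<forall>\<^sub>F n in sequentially. 2 * (2 * real P + real (card G)) / e \<le> q (real n)"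
      using filterlim_compose[OF rate.filterlim_q filterlim_real_sequentially] by (simp add: filterlim_at_top)
    then show ?thesis
    proof eventually_elim
      case (elim n)
      then have "2 * real P + real (card G) \<le> e / 2 * q (real n)"
        using e by (simp add: field_simps)
      then show ?case
        using exp_ge_add_one_self[of "e / 2 * q (real n)"] by linarith
    qed
  qed
  show ?thesis
    using low high cells large h_pos const eventually_gt_at_top[of 0]
  proof eventually_elim
    case (elim n)
    have h_bounds: "real n * \<delta> \<le> real (h n)" "real (h n) \<le> real n * \<delta> + 1"
    proof -
      have "0 \<le> real n * \<delta>"
        using \<delta> by simp
      then show "real n * \<delta> \<le> real (h n)" "real (h n) \<le> real n * \<delta> + 1"
        unfolding h_def by linarith+
    qed
    define W where "W i k \<omega> = J i (real (Suc k * h n)) \<omega> - J i (real (k * h n)) \<omega>" for i k \<omega>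
    have [measurable]: "W i k \<in> borel_measurable M" for i k
      unfolding W_def by measurable
    define EL where "EL p = {\<omega> \<in> space M. W (fst p) (snd p) \<omega> \<in> Low n (fst p)}" for p
    define EH where "EH p = {\<omega> \<in> space M. W (fst p) (snd p) \<omega> \<in> High n (fst p)}" for p
    define EG where "EG l = {\<omega> \<in> space M. \<forall>i\<in>\<J>. \<forall>k<m. W i k \<omega> \<in> A n i (l i k)}" for l
    have sets_A: "A n i l \<in> sets borel" for i l
      by (simp add: A_def)
    have ev_sets: "EL p \<in> sets M" "EH p \<in> sets M" "EG l \<in> sets M" for p l
      unfolding EL_def EH_def EG_def Low_def High_def using sets_A by measurable
    have unions: "(\<Union>p\<in>\<J> \<times> {..<m}. EL p) \<in> sets M" "(\<Union>p\<in>\<J> \<times> {..<m}. EH p) \<in> sets M"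
      "(\<Union>l\<in>G'. EG l) \<in> sets M"
      using ev_sets fin_G' by (intro sets.finite_UN; simp)+
    have sub: "{\<omega> \<in> space M. y \<le> content_functional T Q r b (scaled_input n \<omega>)}
        \<subseteq> (\<Union>p\<in>\<J> \<times> {..<m}. EL p) \<union> (\<Union>p\<in>\<J> \<times> {..<m}. EH p) \<union> (\<Union>l\<in>G'. EG l)"
    proof safe
      fix \<omega> assume \<omega>: "\<omega> \<in> space M" and y_le: "y \<le> content_functional T Q r b (scaled_input n \<omega>)"
        and nG: "\<omega> \<notin> (\<Union>l\<in>G'. EG l)" and nH: "\<omega> \<notin> (\<Union>p\<in>\<J> \<times> {..<m}. EH p)"
      show "\<omega> \<in> (\<Union>p\<in>\<J> \<times> {..<m}. EL p)"
      proof (rule ccontr)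
        assume nL: "\<omega> \<notin> (\<Union>p\<in>\<J> \<times> {..<m}. EL p)"
        define u where "u i k = W i k \<omega> / real n - \<gamma> $ i * \<delta>" for i k
        have W_eq: "W i k \<omega> = real n * (\<gamma> $ i * \<delta> + u i k)" for i k
          using \<open>0 < n\<close> by (simp add: u_def)
        have u: "- \<kappa> < u i k" "u i k < \<kappa> * real K" if "i \<in> \<J>" "k < m" for i k
        proof -
          have "\<not> W i k \<omega> \<in> Low n i" "\<not> W i k \<omega> \<in> High n i"
            using nL nH that \<omega> by (auto simp: EL_def EH_def)
          then show "- \<kappa> < u i k" "u i k < \<kappa> * real K"
            using \<open>0 < n\<close> unfolding W_eq Low_def High_def by simp_all
        qed
        define l where "l = (\<lambda>i\<in>\<J>. \<lambda>k\<in>{..<m}. nat \<lfloor>u i k / \<kappa>\<rfloor>)"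
        have l_eq: "l i k = nat \<lfloor>u i k / \<kappa>\<rfloor>" if "i \<in> \<J>" "k < m" for i k
          using that by (simp add: l_def)
        have l_close: "\<bar>u i k - \<kappa> * real (l i k)\<bar> \<le> \<kappa>" "l i k \<noteq> 0 \<Longrightarrow> \<kappa> * real (l i k) \<le> u i k" "l i k \<le> K"
          if ik: "i \<in> \<J>" "k < m" for i k
        proof -
          have lo: "- 1 < u i k / \<kappa>" and hi: "u i k / \<kappa> < real K"
            using u[OF ik] \<kappa> by (simp_all add: field_simps)
          \<comment> \<open>\<open>nat\<close> sends negative values to 0. This keeps the rounding
            error at most 1 but lets the level lie above u, hence the separate claim for nonzero
            levels.\<close>
          have "\<bar>u i k / \<kappa> - real (l i k)\<bar> \<le> 1" "l i k \<noteq> 0 \<Longrightarrow> real (l i k) \<le> u i k / \<kappa>"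
            using lo unfolding l_eq[OF ik] by linarith+
          moreover have "u i k = \<kappa> * (u i k / \<kappa>)"
            using \<kappa> by simp
          ultimately show "l i k \<noteq> 0 \<Longrightarrow> \<kappa> * real (l i k) \<le> u i k"
            using \<kappa> by (simp add: field_simps)
          have "u i k - \<kappa> * real (l i k) = \<kappa> * (u i k / \<kappa> - real (l i k))"
            using \<kappa> by (simp add: right_diff_distrib)
          then have "\<bar>u i k - \<kappa> * real (l i k)\<bar> = \<kappa> * \<bar>u i k / \<kappa> - real (l i k)\<bar>"
            using \<kappa> by (simp add: abs_mult)
          also have "\<dots> \<le> \<kappa> * 1"
            using \<kappa> \<open>\<bar>u i k / \<kappa> - real (l i k)\<bar> \<le> 1\<close> by (intro mult_left_mono) auto
          finally show "\<bar>u i k - \<kappa> * real (l i k)\<bar> \<le> \<kappa>" by simp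
          show "l i k \<le> K"
            using hi unfolding l_eq[OF ik] by linarith
        qed
        define x where "x i k = (if i \<in> \<J> \<and> k < m then \<kappa> * real (l i k) else 0)" for i k
        have x: "0 \<le> x i k" "i \<notin> \<J> \<Longrightarrow> x i k = 0" for i k
          using \<kappa> by (auto simp: x_def)
        \<comment> \<open>Each of the at most m cells contributes a rounding error of at most
          \<kappa>, and m \<kappa> = \<delta>.\<close>
        have block: "\<bar>J i (real (k * h n)) \<omega> - real n * (grid_path T m \<gamma> x (real k * \<delta>) $ i)\<bar> \<le> real n * \<delta>"
          if i: "i \<in> \<J>" and k: "k \<le> m" for i k
        proof -
          have gp: "grid_path T m \<gamma> x (real k * \<delta>) $ i = (\<Sum>l<k. \<gamma> $ i * \<delta> + x i l)"
            using grid_path_at_grid[OF T m k, of \<gamma> x i] by (simp only: kd \<delta>_def[symmetric])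
          have "J i (real (k * h n)) \<omega> - real n * (grid_path T m \<gamma> x (real k * \<delta>) $ i) =
              (\<Sum>l<k. W i l \<omega>) - real n * (\<Sum>l<k. \<gamma> $ i * \<delta> + x i l)"
            unfolding W_def J_block_sum[OF \<omega>, symmetric] gp ..
          also have "\<dots> = (\<Sum>l<k. real n * (u i l - x i l))"
            unfolding W_eq sum_distrib_left sum_subtractf[symmetric] by (simp add: algebra_simps)
          finally have "\<bar>J i (real (k * h n)) \<omega> - real n * (grid_path T m \<gamma> x (real k * \<delta>) $ i)\<bar> =
              \<bar>\<Sum>l<k. real n * (u i l - x i l)\<bar>"
            by simp
          also have "\<dots> \<le> (\<Sum>l<k. \<bar>real n * (u i l - x i l)\<bar>)"
            by (rule sum_abs)
          also have "\<dots> \<le> (\<Sum>l<k. real n * \<kappa>)"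
          proof (rule sum_mono)
            fix l' assume "l' \<in> {..<k}"
            then have "\<bar>u i l' - x i l'\<bar> \<le> \<kappa>"
              using l_close(1)[OF i, of l'] i k by (simp add: x_def)
            then show "\<bar>real n * (u i l' - x i l')\<bar> \<le> real n * \<kappa>"
              by (simp add: abs_mult mult_left_mono)
          qed
          also have "\<dots> = real n * (real k * \<kappa>)"
            by simp
          also have "\<dots> \<le> real n * (real m * \<kappa>)"
            using k \<kappa> by (intro mult_left_mono mult_right_mono) auto
          finally show ?thesis
            unfolding m\<kappa> .
        qed
        have "content_functional T Q r b (scaled_input n \<omega>)
            \<le> content_functional T Q r b (grid_path T m \<gamma> x) + C * (T / real m + \<delta>)"
        proof (rule grid[OF m _ scaled_input_path[OF \<omega>] grid_path_input_path[OF \<gamma>_nonneg x(1) T]])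
          show "0 \<le> \<delta>"
            using \<delta> by simp
          fix k :: nat and i
          have zero: "scaled_input n \<omega> (real k * \<delta>) $ i = 0" "grid_path T m \<gamma> x t $ i = 0" if "i \<notin> \<J>" for k t
            using no_input[OF that _ \<omega>] no_mean[OF that] x(2)[OF that] \<delta>
            by (simp_all add: scaled_input_def grid_path_def)
          show "scaled_input n \<omega> (real k * T / real m) $ i \<le> grid_path T m \<gamma> x (real k * T / real m) $ i + \<delta>"
            if k: "k \<le> m"
          proof (cases "i \<in> \<J>")
            case True
            have "real k * (real n * \<delta>) \<le> real k * real (h n)"
              by (intro mult_left_mono h_bounds) simp
            then have "J i (real n * (real k * \<delta>)) \<omega> \<le> J i (real (k * h n)) \<omega>"
              using \<delta> by (intro J_mono[OF \<omega>]) (auto simp: mult_ac)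
            also have "\<dots> \<le> real n * (grid_path T m \<gamma> x (real k * \<delta>) $ i + \<delta>)"
              using block[OF True k] by (simp add: abs_le_iff distrib_left)
            finally show ?thesis
              using \<open>0 < n\<close> unfolding kd by (simp add: scaled_input_def pos_divide_le_eq mult.commute)
          next
            case False
            then show ?thesis
              unfolding kd zero[OF False] using \<delta> by simp
          qed
          show "grid_path T m \<gamma> x (real k * T / real m) $ i \<le> scaled_input n \<omega> (real (Suc k) * T / real m) $ i + \<delta>"
            if k: "k < m"
          proof (cases "i \<in> \<J>")
            case True
            have "real n * (grid_path T m \<gamma> x (real k * \<delta>) $ i) \<le> J i (real (k * h n)) \<omega> + real n * \<delta>"
              using block[OF True, of k] k by (simp add: abs_le_iff)
            \<comment> \<open>The rounded-up end of block k overshoots its grid time by at most k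
              \<le> n \<delta>, that is, by at most one cell.\<close>
            also have "J i (real (k * h n)) \<omega> \<le> J i (real n * (real (Suc k) * \<delta>)) \<omega>"
            proof (rule J_mono[OF \<omega>])
              have "real k * real (h n) \<le> real k * (real n * \<delta> + 1)"
                by (intro mult_left_mono h_bounds) simp
              also have "\<dots> \<le> real n * (real (Suc k) * \<delta>)"
                using elim k by (simp add: algebra_simps)
              finally show "real (k * h n) \<le> real n * (real (Suc k) * \<delta>)"
                by simp
            qed simp
            finally have "grid_path T m \<gamma> x (real k * \<delta>) $ i
                \<le> (J i (real n * (real (Suc k) * \<delta>)) \<omega> + real n * \<delta>) / real n"
              using \<open>0 < n\<close> by (simp add: pos_le_divide_eq mult.commute)
            also have "\<dots> = scaled_input n \<omega> (real (Suc k) * \<delta>) $ i + \<delta>"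
              using \<open>0 < n\<close> by (simp add: scaled_input_def add_divide_distrib)
            finally show ?thesis
              unfolding kd .
          next
            case False
            then show ?thesis
              unfolding kd zero[OF False] using \<delta> by simp
          qed
        qed
        also have "C * (T / real m + \<delta>) = a * b $ j"
          using j by (simp add: a_def \<delta>_def)
        finally have "y - a * b $ j \<le> content_functional T Q r b (grid_path T m \<gamma> x)"
          using y_le by linarith
        then have "V \<le> ereal (grid_cost m x + c j * a powr \<alpha>)"
          using a x by (intro V_le_grid_cost_plus m j) auto
        then have "v \<le> grid_cost m x + e / 4"
          using v a_cost by simp
        also have "grid_cost m x = cost l"
          unfolding grid_cost_def cost_def sum_distrib_left by (intro sum.cong) (auto simp: x_def)
        finally have "l \<in> G'"
          using l_close(3) by (auto simp: G'_def G_def l_def)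
        moreover have "\<omega> \<in> EG l"
          unfolding EG_def
        proof (intro CollectI conjI ballI allI impI \<omega>)
          fix i k assume ik: "i \<in> \<J>" "k < m"
          show "W i k \<omega> \<in> A n i (l i k)"
            using l_close(2)[OF ik] \<open>0 < n\<close> by (simp add: A_def W_eq)
        qed
        ultimately show False
          using nG by blast
      qed
    qed
    have pEL: "prob (EL p) \<le> exp (- v * q (real n))" if "p \<in> \<J> \<times> {..<m}" for p
      unfolding EL_def W_def using that elim by (subst prob_block) (auto simp: Low_def)
    have pEH: "prob (EH p) \<le> exp (- v * q (real n))" if "p \<in> \<J> \<times> {..<m}" for p
      unfolding EH_def W_def using that elim by (subst prob_block) (auto simp: High_def)
    have q0: "0 \<le> q (real n)"
      by (intro rate.q_nonneg) simp
    have pEG: "prob (EG l) \<le> exp (- (v - e / 2) * q (real n))" if l: "l \<in> G'" for l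
    proof -
      have "prob (EG l) = (\<Prod>i\<in>\<J>. \<Prod>k<m. prob {\<omega> \<in> space M. J i (real (h n)) \<omega> \<in> A n i (l i k)})"
        unfolding EG_def W_def using elim sets_A by (intro prob_joint_increments) auto
      also have "\<dots> \<le> (\<Prod>i\<in>\<J>. \<Prod>k<m. exp (- (c i * (\<kappa> * real (l i k)) powr \<alpha> - e') * q (real n)))"
      proof (intro prod_mono conjI prod_nonneg)
        fix i k assume "i \<in> \<J>" "k \<in> {..<m}"
        then show "prob {\<omega> \<in> space M. J i (real (h n)) \<omega> \<in> A n i (l i k)}
            \<le> exp (- (c i * (\<kappa> * real (l i k)) powr \<alpha> - e') * q (real n))"
          using elim l by (auto simp: G'_def G_def PiE_iff less_Suc_eq_le)
      qed auto
      also have "\<dots> = exp (- (cost l - real P * e') * q (real n))"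
        using prod_exp_blocks[OF finite_\<J>, where s = "- e'" and t = "q (real n)" and m = m
            and f = "\<lambda>i k. c i * (\<kappa> * real (l i k)) powr \<alpha>"]
        by (simp add: cost_def P_def)
      \<comment> \<open>Patterns in G' cost at least v - e / 4, and the P tail estimates together
        lose another e / 4.\<close>
      also have "\<dots> \<le> exp (- (v - e / 2) * q (real n))"
        unfolding exp_le_cancel_iff using l e' by (intro mult_right_mono q0) (auto simp: G'_def)
      finally show ?thesis .
    qed
    have ev: "exp (- v * q (real n)) \<le> exp (- (v - e / 2) * q (real n))"
      unfolding exp_le_cancel_iff using e by (intro mult_right_mono q0) auto
    have "prob {\<omega> \<in> space M. y \<le> content_functional T Q r b (scaled_input n \<omega>)}
        \<le> prob ((\<Union>p\<in>\<J> \<times> {..<m}. EL p) \<union> (\<Union>p\<in>\<J> \<times> {..<m}. EH p) \<union> (\<Union>l\<in>G'. EG l))"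
      using unions by (intro finite_measure_mono sub sets.Un)
    also have "\<dots> \<le> prob ((\<Union>p\<in>\<J> \<times> {..<m}. EL p) \<union> (\<Union>p\<in>\<J> \<times> {..<m}. EH p)) + prob (\<Union>l\<in>G'. EG l)"
      using unions by (intro measure_Un_le sets.Un)
    also have "\<dots> \<le> prob (\<Union>p\<in>\<J> \<times> {..<m}. EL p) + prob (\<Union>p\<in>\<J> \<times> {..<m}. EH p) + prob (\<Union>l\<in>G'. EG l)"
      using unions by (intro add_right_mono measure_Un_le)
    also have "\<dots> \<le> (\<Sum>p\<in>\<J> \<times> {..<m}. prob (EL p)) + (\<Sum>p\<in>\<J> \<times> {..<m}. prob (EH p)) + (\<Sum>l\<in>G'. prob (EG l))"
      using ev_sets fin_G' by (intro add_mono measure_UNION_le) auto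
    also have "\<dots> \<le> (\<Sum>p\<in>\<J> \<times> {..<m}. exp (- (v - e / 2) * q (real n))) +
        (\<Sum>p\<in>\<J> \<times> {..<m}. exp (- (v - e / 2) * q (real n))) + (\<Sum>l\<in>G'. exp (- (v - e / 2) * q (real n)))"
      using pEL[THEN order_trans, OF _ ev] pEH[THEN order_trans, OF _ ev] pEG
      by (intro add_mono sum_mono)
    also have "\<dots> = (2 * real P + real (card G')) * exp (- (v - e / 2) * q (real n))"
      by (simp add: P_def card_cartesian_product algebra_simps)
    also have "\<dots> \<le> (2 * real P + real (card G)) * exp (- (v - e / 2) * q (real n))"
      using fin_G by (intro mult_right_mono add_left_mono) (auto simp: G'_def intro!: card_mono)
    also have "\<dots> \<le> exp (e / 2 * q (real n)) * exp (- (v - e / 2) * q (real n))"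
      using elim by (intro mult_right_mono) auto
    also have "\<dots> = exp (- (v - e) * q (real n))"
      by (simp add: algebra_simps flip: exp_add)
    finally show ?case .
  qed
qed

section \<open>The logarithmic limit and the passage from the model to the locales\<close>

lemma overflow_limit:
  "(\<lambda>n. ereal (ln (prob {\<omega> \<in> space M. y \<le> b \<bullet> scaled_buffer_content Q r J n \<omega> T}) / q (real n)))
    \<longlonglongrightarrow> - V"
proof -
  obtain v where v: "V = ereal v" "0 \<le> v"
    by (rule V_real)
  let ?p = "\<lambda>n. prob {\<omega> \<in> space M. y \<le> content_functional T Q r b (scaled_input n \<omega>)}"
  have "(\<lambda>n. ln (?p n) / q (real n)) \<longlonglongrightarrow> - v"
  proof (rule tendstoI)
    fix e :: real assume e: "0 < e"
    have "0 < e / 2"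
      using e by simp
    have "\<forall>\<^sub>F n in sequentially. 0 < q (real n)"
      using rate.q_pos filterlim_real_sequentially by (rule eventually_compose_filterlim)
    then show "\<forall>\<^sub>F n in sequentially. dist (ln (?p n) / q (real n)) (- v) < e"
      using overflow_prob_ge[OF v(1) \<open>0 < e / 2\<close>] overflow_prob_le[OF v \<open>0 < e / 2\<close>]
    proof eventually_elim
      case (elim n)
      \<comment> \<open>The lower bound makes the probability positive, so \<open>ln\<close> is a
        genuine logarithm here and not its default value at 0.\<close>
      have pos: "0 < ?p n"
        using elim(2) by (rule less_le_trans[OF exp_gt_zero])
      have "ln (exp (- (v + e / 2) * q (real n))) \<le> ln (?p n)"
        using elim(2) pos by (subst ln_le_cancel_iff) auto
      moreover have "ln (?p n) \<le> ln (exp (- (v - e / 2) * q (real n)))"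
        using elim(3) pos by (subst ln_le_cancel_iff) auto
      ultimately have "- (v + e / 2) * q (real n) \<le> ln (?p n)" "ln (?p n) \<le> - (v - e / 2) * q (real n)"
        by (simp_all only: ln_exp)
      then have "- (v + e / 2) \<le> ln (?p n) / q (real n)" "ln (?p n) / q (real n) \<le> - (v - e / 2)"
        using elim(1) by (simp_all only: pos_le_divide_eq pos_divide_le_eq)
      then show ?case
        using e by (simp add: dist_real_def abs_less_iff)
    qed
  qed
  then have "(\<lambda>n. ereal (ln (?p n) / q (real n))) \<longlonglongrightarrow> ereal (- v)"
    by simp
  \<comment> \<open>The time change divides by n, so the two events are identified for n > 0
    only.\<close>
  moreover have "\<forall>\<^sub>F n in sequentially. ereal (ln (?p n) / q (real n)) =
      ereal (ln (prob {\<omega> \<in> space M. y \<le> b \<bullet> scaled_buffer_content Q r J n \<omega> T}) / q (real n))"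
    using eventually_gt_at_top[of 0]
  proof eventually_elim
    case (elim n)
    then have "{\<omega> \<in> space M. y \<le> content_functional T Q r b (scaled_input n \<omega>)} =
        {\<omega> \<in> space M. y \<le> b \<bullet> scaled_buffer_content Q r J n \<omega> T}"
      by (auto simp: overflow_event)
    then show ?case by simp
  qed
  ultimately show ?thesis
    unfolding v(1) by (simp add: Lim_transform_eventually)
qed

end

text \<open>On the half-line, c q is minus the logarithm of a tail probability. This gives
  monotonicity and nonnegativity of q everywhere, beyond what slow variation says near
  infinity.\<close>

lemma semiexponential_rateI:
  fixes L :: "real \<Rightarrow> real"
  assumes \<alpha>: "0 < \<alpha>" "\<alpha> < 1" and L: "slowly_varying L"
    and ratio: "\<exists>x0>0. antimono_on {x0..} (\<lambda>x. L x / x powr (1 - \<alpha>))"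
    and M: "prob_space M" and Y: "Y \<in> borel_measurable M" and c: "0 < c"
    and tail: "\<And>x. 0 \<le> x \<Longrightarrow> measure M {\<omega> \<in> space M. x \<le> Y \<omega>} = exp (- c * L x * x powr \<alpha>)"
  shows "semiexponential_rate (\<lambda>x. L x * x powr \<alpha>) \<alpha>"
proof
  interpret prob_space M by (rule M)
  note [measurable] = Y
  have pos: "\<forall>\<^sub>F x in at_top. 0 < L x \<and> 0 < x"
  proof -
    obtain A where "\<And>x. A \<le> x \<Longrightarrow> 0 < L x"
      using L unfolding slowly_varying_def by blast
    then have "\<forall>\<^sub>F x in at_top. 0 < L x"
      by (auto simp: eventually_at_top_linorder)
    then show ?thesis
      by (intro eventually_conj eventually_gt_at_top)
  qed
  show "0 < \<alpha>" "\<alpha> < 1"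
    by (fact \<alpha>)+
  show "L x * x powr \<alpha> \<le> L z * z powr \<alpha>" if "0 \<le> x" "x \<le> z" for x z
  proof -
    have "prob {\<omega> \<in> space M. z \<le> Y \<omega>} \<le> prob {\<omega> \<in> space M. x \<le> Y \<omega>}"
      using that by (intro finite_measure_mono) auto
    then have "c * (L x * x powr \<alpha>) \<le> c * (L z * z powr \<alpha>)"
      using that by (simp add: tail mult.assoc)
    with c show ?thesis by simp
  qed
  show "0 \<le> L x * x powr \<alpha>" if "0 \<le> x" for x
  proof -
    have "exp (- (c * (L x * x powr \<alpha>))) \<le> 1"
      using tail[OF that] prob_le_1[of "{\<omega> \<in> space M. x \<le> Y \<omega>}"] by (simp add: mult.assoc)
    then have "0 \<le> c * (L x * x powr \<alpha>)"
      by simp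
    with c show ?thesis
      by (simp add: zero_le_mult_iff)
  qed
  show "\<forall>\<^sub>F x in at_top. 0 < L x * x powr \<alpha>"
    using pos by eventually_elim simp
  show "\<exists>x0>0. \<forall>x z. x0 \<le> x \<longrightarrow> x \<le> z \<longrightarrow> L z * z powr \<alpha> / z \<le> L x * x powr \<alpha> / x"
  proof -
    obtain x0 where x0: "0 < x0" "antimono_on {x0..} (\<lambda>x. L x / x powr (1 - \<alpha>))"
      using ratio by blast
    have eq: "L x * x powr \<alpha> / x = L x / x powr (1 - \<alpha>)" if "0 < x" for x
      using that by (simp add: powr_diff)
    have "L z * z powr \<alpha> / z \<le> L x * x powr \<alpha> / x" if "x0 \<le> x" "x \<le> z" for x z
      using monotone_onD[OF x0(2), of x z] that x0(1) by (simp add: eq)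
    with x0(1) show ?thesis by blast
  qed
  show "((\<lambda>x. L (a * x) * (a * x) powr \<alpha> / (L x * x powr \<alpha>)) \<longlongrightarrow> a powr \<alpha>) at_top" if a: "0 < a" for a
  proof -
    have "((\<lambda>x. L (a * x) / L x * a powr \<alpha>) \<longlongrightarrow> 1 * a powr \<alpha>) at_top"
      using L a unfolding slowly_varying_def by (intro tendsto_mult tendsto_const) blast
    moreover have "\<forall>\<^sub>F x in at_top. L (a * x) / L x * a powr \<alpha> = L (a * x) * (a * x) powr \<alpha> / (L x * x powr \<alpha>)"
      using pos by eventually_elim (use a in \<open>simp add: powr_mult\<close>)
    ultimately show ?thesis
      by (auto intro: Lim_transform_eventually)
  qed
qed

theorem theorem4p1:
  fixes M :: "'a measure"
    and T \<alpha> y :: real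
    and Q :: "real^'d^'d"
    and r \<gamma> b :: "real^'d"
    and \<J> :: "'d set"
    and c :: "'d \<Rightarrow> real"
    and L :: "real \<Rightarrow> real"
    and N :: "'d \<Rightarrow> real \<Rightarrow> 'a \<Rightarrow> nat"
    and Y :: "'d \<Rightarrow> nat \<Rightarrow> 'a \<Rightarrow> real"
    and J :: "'d \<Rightarrow> real \<Rightarrow> 'a \<Rightarrow> real"
  assumes "prob_space M"
    and "0 < T"
    and "routing_matrix Q"
    and "0 < \<alpha>" "\<alpha> < 1"
    and "slowly_varying L"
    and "\<exists>x0>0. antimono_on {x0..} (\<lambda>x. L x / x powr (1 - \<alpha>))"
    and "\<And>i. i \<in> \<J> \<Longrightarrow> 0 < c i"
    and "\<And>i. i \<in> \<J> \<Longrightarrow> compound_poisson_process M 1 (N i) (Y i) (J i)"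
    and "\<And>i j \<omega>. i \<in> \<J> \<Longrightarrow> \<omega> \<in> space M \<Longrightarrow> 0 \<le> Y i j \<omega>"
    and "\<And>i. i \<in> \<J> \<Longrightarrow> integrable M (Y i 0) \<and> integral\<^sup>L M (Y i 0) = \<gamma> $ i"
    and "\<And>i x. i \<in> \<J> \<Longrightarrow> 0 \<le> x \<Longrightarrow>
           measure M {\<omega> \<in> space M. x \<le> Y i 0 \<omega>} = exp (- c i * L x * x powr \<alpha>)"
    and "\<And>i t \<omega>. i \<notin> \<J> \<Longrightarrow> 0 \<le> t \<Longrightarrow> \<omega> \<in> space M \<Longrightarrow> J i t \<omega> = 0"
    and "\<And>i. i \<notin> \<J> \<Longrightarrow> \<gamma> $ i = 0"
    and "independent_processes M J UNIV"
    and "\<And>i. (matrix_inv (reflection_matrix Q) *v \<gamma>) $ i < r $ i"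
    and "\<And>i. 0 \<le> b $ i"
    and "\<J> \<inter> {j. 0 < b $ j} \<noteq> {}"
  shows "(\<lambda>n. ereal (ln (measure M {\<omega> \<in> space M. y \<le> b \<bullet> scaled_buffer_content Q r J n \<omega> T})
                     / (L (real n) * real n powr \<alpha>)))
           \<longlonglongrightarrow> - V_star_ge T \<alpha> Q r \<gamma> \<J> c b y"
proof -
  interpret prob_space M by fact
  let ?q = "\<lambda>x. L x * x powr \<alpha>"
  have cp: "compound_poisson M (N i) (Y i) (J i)" if "i \<in> \<J>" for i
    using assms(9)[OF that] assms(10)[OF that] by unfold_locales
  have tail: "prob {\<omega> \<in> space M. x \<le> Y i 0 \<omega>} = exp (- c i * ?q x)" if "i \<in> \<J>" "0 \<le> x" for i x
    using assms(12)[OF that] by (simp add: mult.assoc)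
  have rate: "semiexponential_rate ?q \<alpha>"
  proof -
    obtain i where i: "i \<in> \<J>"
      using assms(18) by blast
    show ?thesis
      by (rule semiexponential_rateI[OF assms(4-7) assms(1) _ assms(8)[OF i] assms(12)[OF i]])
        (rule compound_poisson.Y_measurable[OF cp[OF i]])
  qed
  have inputs: "semiexponential_compound_poisson M (N i) (Y i) (J i) ?q \<alpha> (c i) (\<gamma> $ i)" if i: "i \<in> \<J>" for i
    unfolding semiexponential_compound_poisson_def semiexponential_compound_poisson_axioms_def
    using cp[OF i] rate assms(8)[OF i] tail[OF i] assms(11)[OF i] by blast
  have \<gamma>: "0 \<le> \<gamma> $ i" for i
  proof (cases "i \<in> \<J>")
    case True
    from semiexponential_compound_poisson.\<gamma>_nonneg[OF inputs[OF this]] show ?thesis .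
  qed (simp add: assms(14))
  \<comment> \<open>The effective arrival rates are nonnegative by the minimum principle, so
    stability yields r \<ge> 0, the form in which the reflection lemmas use it.\<close>
  have "0 \<le> (matrix_inv (reflection_matrix Q) *v \<gamma>) $ i" for i
    by (rule routing_matrix_nonneg_of_reflection_nonneg[OF assms(3)])
      (simp add: reflection_matrix_inv[OF assms(3)] \<gamma>)
  then have r: "0 \<le> r $ i" for i
    using assms(16)[of i] by (meson less_eq_real_def order_le_less_trans)
  interpret stochastic_network M T \<alpha> y Q r \<gamma> b \<J> c ?q N Y J
    by (intro stochastic_network.intro stochastic_network_axioms.intro prob_space_axioms r inputs
        assms(2,3,13-15,17,18))
  show ?thesis
    by (rule overflow_limit)
qed

end
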